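(* Let $n \in \mathbb{N}$, $n\ge 1$, $p \geq 1$, $q \in (1, +\infty)$ and $s \in (0,1)$ with $sp < n$ be such that $$\frac{1}{q} = \frac{1}{p} - \frac{s}{n}.$$ Let $u \in \mathcal{S}'(\mathbb{R}^{n})$ be such that $d_{s} u \in L^{p}_{od}(\mathbb{R}^{2n})$. Then there is a constant $C_u \in \mathbb{C}$ such that $u - C_{u} \in L^{q}(\mathbb{R}^n)$, together with the estimate $$\| u - C_{u} \|_{L^{q}(\mathbb{R}^n)} \le K\, \| d_{s} u \|_{L^{p}_{od}(\mathbb{R}^{2n})},$$ where $K>0$ is a constant independent of $u$ (depending only on $n,p,s$).
   Context: $\mathcal{S}(\mathbb{R}^m)$ is the Fréchet space of complex-valued Schwartz functions, $\mathcal{S}'(\mathbb{R}^m)$ its topological dual (tempered distributions), and $\langle\cdot,\cdot\rangle$ the bilinear pairing; functions are identified with distributions by integration. $\mathcal{S}_{od}(\mathbb{R}^{2n})$ (off-diagonal Schwartz functions) is the set of $G \in \mathcal{S}(\mathbb{R}^{2n})$, $G = G(x,y)$ with $x,y\in\mathbb{R}^n$, such that $G(x,y) = -G(y,x)$ for all $x,y$ and $\partial_x^{\alpha}\partial_y^{\beta} G(z,z) = 0$ for all $z \in \mathbb{R}^n$ and all multi-indices $\alpha,\beta \in \mathbb{N}_0^n$; it carries the subspace topology of $\mathcal{S}(\mathbb{R}^{2n})$, and $\mathcal{S}'_{od}(\mathbb{R}^{2n})$ is its topological dual. For $s\in\mathbb{R}$ and $G \in \mathcal{S}_{od}(\mathbb{R}^{2n})$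 set $\operatorname{div}_{s} G(x) := \int_{\mathbb{R}^n} \frac{2G(x,y)}{|x-y|^{s}} \frac{dy}{|x-y|^n}$; this defines a continuous linear map $\mathcal{S}_{od}(\mathbb{R}^{2n}) \to \mathcal{S}(\mathbb{R}^n)$. For $u \in \mathcal{S}'(\mathbb{R}^n)$ the distributional fractional gradient $d_{s}u \in \mathcal{S}'_{od}(\mathbb{R}^{2n})$ is defined by $\langle d_{s} u, G\rangle := \langle u, \operatorname{div}_{s} G\rangle$ for $G \in \mathcal{S}_{od}(\mathbb{R}^{2n})$. For $p\in[1,\infty)$, $L^p_{od}(\mathbb{R}^{2n})$ is the space of measurable functions $F$ on $\mathbb{R}^{2n}$ with $F(x,y) = -F(y,x)$ and $\|F\|_{L^p_{od}}^p := \int_{\mathbb{R}^n}\int_{\mathbb{R}^n} |F(x,y)|^p \frac{dx\,dy}{|x-y|^n} < \infty$. Such an $F$ is identified with the element of $\mathcal{S}'_{od}(\mathbb{R}^{2n})$ given by $\langle F, G\rangle := \int_{\mathbb{R}^n}\int_{\mathbb{R}^n} F(x,y) G(x,y) \frac{dx\,dy}{|x-y|^n}$; "$d_{s}u \in L^p_{od}$" means that $d_{s}u$ equals such an $F$ in $\mathcal{S}'_{od}(\mathbb{R}^{2n})$, and then $\|d_{s}u\|_{L^p_{od}} := \|F\|_{L^p_{od}}$. *)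

theory Defs
  imports "HOL-Analysis.Analysis"
begin

section \<open>Schwartz functions and tempered distributions\<close>

definition directional_deriv ::
    "'a::euclidean_space \<Rightarrow> ('a \<Rightarrow> complex) \<Rightarrow> 'a \<Rightarrow> complex" where
  "directional_deriv b f x = frechet_derivative f (at x) b"

text \<open>
  A partial derivative of arbitrary order is indexed by the list of basis vectors along which one
  differentiates, instead of by a multi-index. For smooth functions the order in the list is
  irrelevant, so the lists over \<^term>\<open>Basis\<close> produce exactly the derivatives given by all
  multi-indices.
\<close>

definition iter_partial ::
    "'a::euclidean_space list \<Rightarrow> ('a \<Rightarrow> complex) \<Rightarrow> 'a \<Rightarrow> complex" where
  "iter_partial bs f = foldr directional_deriv bs f"

definition smooth :: "('a::euclidean_space \<Rightarrow> complex) \<Rightarrow> bool" where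
  "smooth f \<longleftrightarrow> (\<forall>bs \<in> lists Basis. \<forall>x. iter_partial bs f differentiable (at x))"

definition schwartz :: "('a::euclidean_space \<Rightarrow> complex) set" where
  "schwartz = {f. smooth f \<and>
     (\<forall>k. \<forall>bs \<in> lists Basis. bdd_above (range (\<lambda>x. norm x ^ k * cmod (iter_partial bs f x))))}"

definition schwartz_seminorm ::
    "nat \<Rightarrow> 'a::euclidean_space list \<Rightarrow> ('a \<Rightarrow> complex) \<Rightarrow> real" where
  "schwartz_seminorm k bs f = (SUP x. norm x ^ k * cmod (iter_partial bs f x))"

text \<open>The Frechet topology: the open seminorm balls form a subbase.\<close>

definition schwartz_topology :: "('a::euclidean_space \<Rightarrow> complex) topology" where
  "schwartz_topology = topology_generated_by
     {{g \<in> schwartz. schwartz_seminorm k bs (\<lambda>x. g x - f x) < e} | f k bs e.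
        f \<in> schwartz \<and> bs \<in> lists Basis \<and> e > 0}"

lemma iter_partial_zero: "iter_partial bs (\<lambda>_. 0) = (\<lambda>_. 0)"
proof (induction bs)
  case Nil
  show ?case by (simp add: iter_partial_def)
next
  case (Cons b bs)
  have "iter_partial (b # bs) (\<lambda>_. 0) = directional_deriv b (iter_partial bs (\<lambda>_. 0))"
    by (simp only: iter_partial_def foldr.simps o_apply)
  also have "\<dots> = (\<lambda>_. 0)"
    unfolding Cons.IH by (rule ext) (simp add: directional_deriv_def)
  finally show ?case .
qed

lemma topspace_schwartz_topology: "topspace schwartz_topology = (schwartz :: ('a::euclidean_space \<Rightarrow> complex) set)"
proof
  show "topspace schwartz_topology \<subseteq> (schwartz :: ('a \<Rightarrow> complex) set)"
    unfolding schwartz_topology_def topology_generated_by_topspace by blast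
next
  show "(schwartz :: ('a \<Rightarrow> complex) set) \<subseteq> topspace schwartz_topology"
  proof (rule subsetI)
    fix f :: "'a \<Rightarrow> complex"
    assume f: "f \<in> schwartz"
    have "schwartz_seminorm 0 [] (\<lambda>x. f x - f x) < 1"
      unfolding schwartz_seminorm_def diff_self iter_partial_zero by simp
    then have "f \<in> {g \<in> schwartz. schwartz_seminorm 0 [] (\<lambda>x. g x - f x) < 1}"
      using f by simp
    moreover have "([] :: 'a list) \<in> lists Basis" "(0::real) < 1"
      by simp_all
    ultimately show "f \<in> topspace schwartz_topology"
      unfolding schwartz_topology_def topology_generated_by_topspace using f by blast
  qed
qed

text \<open>
  A distribution is a total function on \<^typ>\<open>'a \<Rightarrow> complex\<close> of which only the values on
  \<^const>\<open>schwartz\<close> matter; equality of distributions is equality on \<^const>\<open>schwartz\<close>.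
\<close>

definition tempered_distribution :: "(('a::euclidean_space \<Rightarrow> complex) \<Rightarrow> complex) set" where
  "tempered_distribution = {u.
     (\<forall>f \<in> schwartz. \<forall>g \<in> schwartz. u (\<lambda>x. f x + g x) = u f + u g) \<and>
     (\<forall>c. \<forall>f \<in> schwartz. u (\<lambda>x. c * f x) = c * u f) \<and>
     continuous_map schwartz_topology euclidean u}"

definition distribution_of ::
    "('a::euclidean_space \<Rightarrow> complex) \<Rightarrow> ('a \<Rightarrow> complex) \<Rightarrow> complex" where
  "distribution_of f \<phi> = (LINT x|lebesgue. f x * \<phi> x)"


section \<open>Lebesgue spaces\<close>

definition Lp_space :: "real \<Rightarrow> 'a measure \<Rightarrow> ('a \<Rightarrow> complex) set" where
  "Lp_space p M = {f \<in> borel_measurable M. integrable M (\<lambda>x. cmod (f x) powr p)}"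

definition Lp_norm :: "real \<Rightarrow> 'a measure \<Rightarrow> ('a \<Rightarrow> complex) \<Rightarrow> real" where
  "Lp_norm p M f = (LINT x|M. cmod (f x) powr p) powr (1 / p)"


section \<open>Off-diagonal functions and the fractional gradient\<close>

definition antisymmetric :: "('a \<times> 'a \<Rightarrow> complex) \<Rightarrow> bool" where
  "antisymmetric F \<longleftrightarrow> (\<forall>x y. F (x, y) = - F (y, x))"

definition schwartz_od :: "((real ^ 'n) \<times> (real ^ 'n) \<Rightarrow> complex) set" where
  "schwartz_od = {G \<in> schwartz. antisymmetric G \<and>
     (\<forall>bs \<in> lists Basis. \<forall>z. iter_partial bs G (z, z) = 0)}"

text \<open>
  The measure \<open>dx dy / |x - y|^n\<close>. On the diagonal, a null set, the density is
  \<open>1 / 0 = 0\<close>.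
\<close>

definition od_measure :: "((real ^ 'n) \<times> (real ^ 'n)) measure" where
  "od_measure = density lebesgue (\<lambda>(x, y). ennreal (1 / norm (x - y) ^ CARD('n)))"

definition Lp_od :: "real \<Rightarrow> ((real ^ 'n) \<times> (real ^ 'n) \<Rightarrow> complex) set" where
  "Lp_od p = {F \<in> Lp_space p od_measure. antisymmetric F}"

definition Lp_od_norm :: "real \<Rightarrow> ((real ^ 'n) \<times> (real ^ 'n) \<Rightarrow> complex) \<Rightarrow> real" where
  "Lp_od_norm p F = Lp_norm p od_measure F"

definition od_distribution_of ::
    "((real ^ 'n) \<times> (real ^ 'n) \<Rightarrow> complex) \<Rightarrow> ((real ^ 'n) \<times> (real ^ 'n) \<Rightarrow> complex) \<Rightarrow> complex"
  where "od_distribution_of F G = (LINT z|od_measure. F z * G z)"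

definition frac_div ::
    "real \<Rightarrow> ((real ^ 'n) \<times> (real ^ 'n) \<Rightarrow> complex) \<Rightarrow> real ^ 'n \<Rightarrow> complex" where
  "frac_div s G x = (LINT y|lebesgue.
     2 * G (x, y) / complex_of_real (norm (x - y) powr s)
       / complex_of_real (norm (x - y) ^ CARD('n)))"

definition frac_grad ::
    "real \<Rightarrow> ((real ^ 'n \<Rightarrow> complex) \<Rightarrow> complex) \<Rightarrow> ((real ^ 'n) \<times> (real ^ 'n) \<Rightarrow> complex) \<Rightarrow> complex"
  where "frac_grad s u G = u (frac_div s G)"

end

theory Submission
  imports Defs
begin

text \<open>
  Let \<open>n\<close> be the dimension and write \<open>\<Phi>(y, z) = F(y, z) |y - z|^s\<close>. If \<open>u\<close> were a function,
  the hypothesis would say \<open>u(y) - u(z) = \<Phi>(y, z)\<close>. The proof makes this precise and then runs a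
  short pointwise argument for the Sobolev inequality.

  From the distribution to a function. Let \<open>\<eta>\<close> and \<open>\<theta>\<close> be test functions with disjoint compact
  supports. Then \<open>|y - z|^(s+n) (\<eta>(y) \<theta>(z) - \<eta>(z) \<theta>(y)) / 2\<close> is an off-diagonal Schwartz function:
  it vanishes near the diagonal, so the singularity of the weight is never seen. Its
  fractional divergence is \<open>\<eta> \<integral>\<theta> - \<theta> \<integral>\<eta>\<close>, whence
  \<open>u(\<eta>) \<integral>\<theta> - u(\<theta>) \<integral>\<eta> = \<integral>\<integral> \<Phi>(y, z) \<eta>(y) \<theta>(z) dy dz\<close> (lemma \<open>frac_grad_pairing\<close>). For \<open>\<integral>\<theta> = 1\<close> this
  says that off the support of \<open>\<theta>\<close> the distribution \<open>u\<close> is the function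
  \<open>w\<^sub>\<theta>(y) = u(\<theta>) + \<integral> \<Phi>(y, z) \<theta>(z) dz\<close>. Two such functions agree almost everywhere off both supports
  (\<open>reconstructions_agree\<close>), so two of them glue to a function \<open>w\<close> that represents \<open>u\<close> on all
  compactly supported test functions (\<open>pairing_representative\<close>).

  The estimate. Let \<open>\<theta>\<close> be a bump of mass one in a cube of side comparable to \<open>r\<close> at distance comparable to
  \<open>r\<close> from \<open>a\<close>, put \<open>\<gamma>(x) = \<integral> |F(x, z)|^p |x - z|^(-n) dz\<close> and let \<open>N\<close> be the norm of \<open>F\<close>, so that
  \<open>\<integral>\<gamma> = N^p\<close>. Jensen's inequality gives \<open>|\<integral> \<Phi>(x, z) \<theta>(z) dz| \<le> K r^s \<gamma>(x)^(1/p)\<close> for \<open>|x - a| \<le> r\<close>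
  (\<open>increment_mean_bound\<close>), and it bounds the difference of the values of \<open>u\<close> at such bumps of scales
  \<open>r\<close> and \<open>4 r\<close> by \<open>K r^(s - n/p) N\<close> (\<open>average_diff_bound\<close>). As \<open>s p < n\<close>, the latter is summable
  over the scales \<open>4^k\<close> going to infinity, so the values of \<open>u\<close> at bumps of growing scale converge to one
  constant \<open>C\<close>, wherever the bumps sit (\<open>average_limit\<close>). Since \<open>w(x) = w\<^sub>\<theta>(x)\<close> for almost all \<open>x\<close> near \<open>a\<close>,
  \<open>|w(x) - C| \<le> K (r^s \<gamma>(x)^(1/p) + r^(s - n/p) N)\<close> at every scale. The best scale yields
  \<open>|w(x) - C| \<le> K \<gamma>(x)^(1/q) N^(s p/n)\<close>, and integrating the \<open>q\<close>-th power gives the theorem. Only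
  the integrability of \<open>\<gamma>\<close> enters, in place of the boundedness of a maximal function; this is
  why \<open>p = 1\<close> needs no separate treatment.

  It remains to pass from compactly supported to arbitrary Schwartz functions, by dilated cutoffs
  (\<open>tempered_distribution_cutoff_tendsto\<close>). Smoothness of the bumps and of the kernel above, in the sense of
  iterated partial derivatives, is obtained by coinduction (\<open>smooth_on_coinduct\<close>).
\<close>

section \<open>Smooth functions on open sets\<close>

definition smooth_on :: "'a::euclidean_space set \<Rightarrow> ('a \<Rightarrow> complex) \<Rightarrow> bool" where
  "smooth_on U f \<longleftrightarrow> (\<forall>bs \<in> lists Basis. \<forall>x\<in>U. iter_partial bs f differentiable (at x))"

lemma smooth_iff_smooth_on: "smooth f \<longleftrightarrow> smooth_on UNIV f"
  by (simp add: smooth_def smooth_on_def)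

lemma iter_partial_Nil [simp]: "iter_partial [] f = f"
  by (simp add: iter_partial_def)

lemma iter_partial_Cons: "iter_partial (b # bs) f = directional_deriv b (iter_partial bs f)"
  by (simp add: iter_partial_def)

lemma iter_partial_snoc: "iter_partial (bs @ [b]) f = iter_partial bs (directional_deriv b f)"
  by (simp add: iter_partial_def)

lemma directional_derivI: "(f has_derivative f') (at x) \<Longrightarrow> directional_deriv b f x = f' b"
  by (simp add: directional_deriv_def frechet_derivative_at [symmetric])

lemma has_derivative_frechet:
  "f differentiable at x \<Longrightarrow> (f has_derivative frechet_derivative f (at x)) (at x)"
  by (simp add: frechet_derivative_works)

lemma directional_deriv_cong_on:
  assumes "open U" "x \<in> U" "f differentiable at x" "\<And>y. y \<in> U \<Longrightarrow> f y = g y"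
  shows "directional_deriv b f x = directional_deriv b g x"
  using frechet_derivative_transform_within_open[of f x U g] assms
  by (simp add: directional_deriv_def)

lemma differentiable_cong_on:
  assumes "open U" "x \<in> U" "f differentiable at x" "\<And>y. y \<in> U \<Longrightarrow> f y = g y"
  shows "g differentiable at x"
  using assms has_derivative_transform_within_open unfolding differentiable_def by metis

text \<open>
  Coinduction for smoothness: all iterated derivatives of a function exist as soon as it lies in
  some class of differentiable functions that is closed under partial derivatives. The lemma also says that
  the derivatives stay in the class. It is stated for families, because an estimate uniform in the index
  can then be read off the class; one index alone would lose the uniformity.
\<close>

lemma iter_partial_in_closed_family:
  fixes S :: "('i \<Rightarrow> 'a::euclidean_space \<Rightarrow> complex) set"
  assumes "open U"
    and diff: "\<And>f i x. f \<in> S \<Longrightarrow> x \<in> U \<Longrightarrow> f i differentiable at x"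
    and closed: "\<And>f b. f \<in> S \<Longrightarrow> b \<in> Basis \<Longrightarrow>
      \<exists>g\<in>S. \<forall>i. \<forall>x\<in>U. directional_deriv b (f i) x = g i x"
    and "f \<in> S" "bs \<in> lists Basis"
  shows "\<exists>g\<in>S. \<forall>i. \<forall>x\<in>U. iter_partial bs (f i) x = g i x \<and> iter_partial bs (f i) differentiable at x"
  using \<open>bs \<in> lists Basis\<close>
proof (induction bs)
  case Nil
  then show ?case using diff \<open>f \<in> S\<close> by auto
next
  case (Cons b bs)
  then obtain g where g: "g \<in> S"
    "\<And>i x. x \<in> U \<Longrightarrow> iter_partial bs (f i) x = g i x"
    "\<And>i x. x \<in> U \<Longrightarrow> iter_partial bs (f i) differentiable at x"
    by blast
  from closed[OF g(1) Cons.hyps(1)] obtain g' where g': "g' \<in> S"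
    "\<And>i x. x \<in> U \<Longrightarrow> directional_deriv b (g i) x = g' i x" by blast
  have eq: "iter_partial (b # bs) (f i) x = g' i x" if "x \<in> U" for i x
    using directional_deriv_cong_on[OF \<open>open U\<close> that g(3)[OF that] g(2)] g'(2)[OF that]
    by (simp add: iter_partial_Cons)
  then have "iter_partial (b # bs) (f i) differentiable at x" if "x \<in> U" for i x
    using differentiable_cong_on[OF \<open>open U\<close> that diff[OF g'(1) that], of i] by simp
  with eq g'(1) show ?case by blast
qed

lemma iter_partial_in_closed_class:
  assumes "open U"
    and "\<And>f x. f \<in> S \<Longrightarrow> x \<in> U \<Longrightarrow> f differentiable at x"
    and "\<And>f b. f \<in> S \<Longrightarrow> b \<in> Basis \<Longrightarrow> \<exists>g\<in>S. \<forall>x\<in>U. directional_deriv b f x = g x"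
    and "f \<in> S" "bs \<in> lists Basis"
  shows "\<exists>g\<in>S. \<forall>x\<in>U. iter_partial bs f x = g x \<and> iter_partial bs f differentiable at x"
proof -
  let ?S = "(\<lambda>f (_::unit). f) ` S"
  have "\<exists>g\<in>?S. \<forall>i. \<forall>x\<in>U. iter_partial bs f x = g i x \<and> iter_partial bs f differentiable at x"
  proof (rule iter_partial_in_closed_family[where f = "\<lambda>_. f", OF assms(1)])
    show "\<exists>g\<in>?S. \<forall>i. \<forall>x\<in>U. directional_deriv b (f i) x = g i x" if "f \<in> ?S" "b \<in> Basis" for f b
      using that assms(3) by force
  qed (use assms in auto)
  then show ?thesis by auto
qed

lemma smooth_on_coinduct:
  assumes "open U" "f \<in> S"
    and "\<And>f x. f \<in> S \<Longrightarrow> x \<in> U \<Longrightarrow> f differentiable at x"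
    and "\<And>f b. f \<in> S \<Longrightarrow> b \<in> Basis \<Longrightarrow> \<exists>g\<in>S. \<forall>x\<in>U. directional_deriv b f x = g x"
  shows "smooth_on U f"
  unfolding smooth_on_def
  using iter_partial_in_closed_class[OF assms(1,3,4,2)] by blast

lemma smooth_on_differentiable: "smooth_on U f \<Longrightarrow> x \<in> U \<Longrightarrow> f differentiable at x"
  unfolding smooth_on_def using iter_partial_Nil[of f] by (metis lists.Nil)

lemma smooth_on_directional_deriv:
  "smooth_on U f \<Longrightarrow> b \<in> Basis \<Longrightarrow> smooth_on U (directional_deriv b f)"
  unfolding smooth_on_def by (metis iter_partial_snoc append_in_lists_conv lists.Cons lists.Nil)

lemma smooth_on_cong:
  assumes "open U" "smooth_on U f" "\<And>x. x \<in> U \<Longrightarrow> f x = g x"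
  shows "smooth_on U g"
proof (rule smooth_on_coinduct[of U g "{g. \<exists>f. smooth_on U f \<and> (\<forall>x\<in>U. f x = g x)}"])
  fix g :: "'a \<Rightarrow> complex" and x
  assume "g \<in> {g. \<exists>f. smooth_on U f \<and> (\<forall>x\<in>U. f x = g x)}" and x: "x \<in> U"
  then obtain f where "smooth_on U f" "\<forall>x\<in>U. f x = g x" by blast
  then show "g differentiable at x"
    using differentiable_cong_on[OF \<open>open U\<close> x] smooth_on_differentiable x by metis
next
  fix g :: "'a \<Rightarrow> complex" and b :: 'a
  assume "g \<in> {g. \<exists>f. smooth_on U f \<and> (\<forall>x\<in>U. f x = g x)}" and b: "b \<in> Basis"
  then obtain f where f: "smooth_on U f" "\<forall>x\<in>U. f x = g x" by blast
  have "\<forall>x\<in>U. directional_deriv b g x = directional_deriv b f x"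
    using directional_deriv_cong_on[OF \<open>open U\<close>] smooth_on_differentiable[OF f(1)] f(2) by metis
  then show "\<exists>h\<in>{g. \<exists>f. smooth_on U f \<and> (\<forall>x\<in>U. f x = g x)}. \<forall>x\<in>U. directional_deriv b g x = h x"
    using smooth_on_directional_deriv[OF f(1) b] by blast
qed (use assms in auto)

lemma smooth_on_subset: "smooth_on U f \<Longrightarrow> V \<subseteq> U \<Longrightarrow> smooth_on V f"
  unfolding smooth_on_def by blast

lemma smooth_on_Un: "smooth_on U f \<Longrightarrow> smooth_on V f \<Longrightarrow> smooth_on (U \<union> V) f"
  unfolding smooth_on_def by blast

lemma smooth_on_const: "open U \<Longrightarrow> smooth_on U (\<lambda>_. c)"
  by (rule smooth_on_coinduct[of U _ "range (\<lambda>c _. c)"])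
    (auto simp: directional_derivI[OF has_derivative_const])

lemma smooth_on_bounded_linear:
  assumes "open U" "bounded_linear f"
  shows "smooth_on U f"
proof (rule smooth_on_coinduct[of U f "insert f (range (\<lambda>c _. c))"])
  fix g and b :: 'a
  assume "g \<in> insert f (range (\<lambda>c _. c))"
  then show "\<exists>h\<in>insert f (range (\<lambda>c _. c)). \<forall>x\<in>U. directional_deriv b g x = h x"
    by (auto simp: directional_derivI[OF has_derivative_const]
        directional_derivI[OF bounded_linear_imp_has_derivative[OF assms(2)]])
qed (use assms in \<open>auto simp: bounded_linear_imp_differentiable\<close>)

lemma directional_deriv_mult:
  assumes "f differentiable at x" "g differentiable at x"
  shows "directional_deriv b (\<lambda>x. f x * g x) x
    = f x * directional_deriv b g x + directional_deriv b f x * g x"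
  by (subst directional_derivI[OF has_derivative_mult[OF assms[THEN has_derivative_frechet]]])
    (simp add: directional_deriv_def)

lemma directional_deriv_add:
  assumes "f differentiable at x" "g differentiable at x"
  shows "directional_deriv b (\<lambda>x. f x + g x) x = directional_deriv b f x + directional_deriv b g x"
  by (subst directional_derivI[OF has_derivative_add[OF assms[THEN has_derivative_frechet]]])
    (simp add: directional_deriv_def)

lemma smooth_on_add:
  assumes "open U" "smooth_on U f" "smooth_on U g"
  shows "smooth_on U (\<lambda>x. f x + g x)"
proof (rule smooth_on_coinduct
    [of U _ "{h. \<exists>f g. smooth_on U f \<and> smooth_on U g \<and> h = (\<lambda>x. f x + g x)}"])
  fix h and b :: 'a
  assume "h \<in> {h. \<exists>f g. smooth_on U f \<and> smooth_on U g \<and> h = (\<lambda>x. f x + g x)}" and b: "b \<in> Basis"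
  then obtain f g where h: "h = (\<lambda>x. f x + g x)" and f: "smooth_on U f" and g: "smooth_on U g"
    by blast
  have "directional_deriv b h x = directional_deriv b f x + directional_deriv b g x" if "x \<in> U" for x
    unfolding h using directional_deriv_add smooth_on_differentiable f g that by blast
  then show "\<exists>h'\<in>{h. \<exists>f g. smooth_on U f \<and> smooth_on U g \<and> h = (\<lambda>x. f x + g x)}.
      \<forall>x\<in>U. directional_deriv b h x = h' x"
    by (intro bexI[of _ "\<lambda>x. directional_deriv b f x + directional_deriv b g x"] CollectI
        exI[of _ "directional_deriv b f"] exI[of _ "directional_deriv b g"] conjI ballI
        smooth_on_directional_deriv[OF f b] smooth_on_directional_deriv[OF g b]) auto
next
  show "(\<lambda>x. f x + g x) \<in> {h. \<exists>f g. smooth_on U f \<and> smooth_on U g \<and> h = (\<lambda>x. f x + g x)}"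
    using assms by blast
qed (use assms(1) in \<open>auto intro!: differentiable_add dest: smooth_on_differentiable\<close>)

text \<open>
  The Leibniz rule leads out of the products, but not out of their finite sums.
\<close>

inductive_set sums_of_products ::
    "('a \<Rightarrow> complex) set \<Rightarrow> ('a \<Rightarrow> complex) set \<Rightarrow> ('a \<Rightarrow> complex) set"
  for A B where
  product: "f \<in> A \<Longrightarrow> g \<in> B \<Longrightarrow> (\<lambda>x. f x * g x) \<in> sums_of_products A B"
| sum: "f \<in> sums_of_products A B \<Longrightarrow> g \<in> sums_of_products A B
    \<Longrightarrow> (\<lambda>x. f x + g x) \<in> sums_of_products A B"

text \<open>
  The common core of the product rule and the chain rule. A derivative of a factor from \<open>A\<close> may produce a
  further factor, as the chain rule does; it is absorbed by the partner from \<open>B\<close>.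
  Asking for this absorption, rather than for closure of \<open>B\<close> under products, lets the lemma prove such a closure.
\<close>

lemma smooth_on_sums_of_products:
  assumes "open U"
    and A: "\<And>f x. f \<in> A \<Longrightarrow> x \<in> U \<Longrightarrow> f differentiable at x"
    and B: "\<And>f x. f \<in> B \<Longrightarrow> x \<in> U \<Longrightarrow> f differentiable at x"
    and A': "\<And>f b. f \<in> A \<Longrightarrow> b \<in> Basis \<Longrightarrow>
      \<exists>f'\<in>A. \<forall>g\<in>B. \<exists>h\<in>B. \<forall>x\<in>U. directional_deriv b f x * g x = f' x * h x"
    and B': "\<And>f b. f \<in> B \<Longrightarrow> b \<in> Basis \<Longrightarrow> \<exists>f'\<in>B. (\<forall>x\<in>U. directional_deriv b f x = f' x)"
    and "h \<in> sums_of_products A B"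
  shows "smooth_on U h"
proof (rule smooth_on_coinduct[OF \<open>open U\<close> \<open>h \<in> _\<close>])
  show diff: "h differentiable at x" if "h \<in> sums_of_products A B" "x \<in> U" for h x
    using that by (induction h rule: sums_of_products.induct) (blast intro: A B differentiable_mult differentiable_add)+
  fix h b assume "h \<in> sums_of_products A B" and b: "b \<in> (Basis::'a set)"
  then show "\<exists>g\<in>sums_of_products A B. \<forall>x\<in>U. directional_deriv b h x = g x"
  proof (induction h rule: sums_of_products.induct)
    case (product f g)
    from A'[OF product(1) b] product(2) obtain f' g\<^sub>1 where f': "f' \<in> A" "g\<^sub>1 \<in> B"
      "\<And>x. x \<in> U \<Longrightarrow> directional_deriv b f x * g x = f' x * g\<^sub>1 x" by blast
    from B'[OF product(2) b] obtain g' where g': "g' \<in> B"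
      "\<And>x. x \<in> U \<Longrightarrow> directional_deriv b g x = g' x" by blast
    have "(\<lambda>x. f x * g' x + f' x * g\<^sub>1 x) \<in> sums_of_products A B"
      using product f' g' by (intro sums_of_products.intros) auto
    moreover have "directional_deriv b (\<lambda>x. f x * g x) x = f x * g' x + f' x * g\<^sub>1 x"
      if "x \<in> U" for x
      using directional_deriv_mult[OF A[OF product(1) that] B[OF product(2) that]] f'(3) g'(2) that
      by simp
    ultimately show ?case by (intro bexI[of _ "\<lambda>x. f x * g' x + f' x * g\<^sub>1 x"]) auto
  next
    case (sum f g)
    then obtain f' g' where *: "f' \<in> sums_of_products A B" "g' \<in> sums_of_products A B"
      "\<And>x. x \<in> U \<Longrightarrow> directional_deriv b f x = f' x"
      "\<And>x. x \<in> U \<Longrightarrow> directional_deriv b g x = g' x" by blast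
    then have "directional_deriv b (\<lambda>x. f x + g x) x = f' x + g' x" if "x \<in> U" for x
      using directional_deriv_add[OF diff[OF sum(1) that] diff[OF sum(2) that]] that by simp
    then show ?case
      using sums_of_products.sum[OF *(1,2)] by (intro bexI[of _ "\<lambda>x. f' x + g' x"]) auto
  qed
qed

lemma smooth_on_mult:
  assumes "open U" "smooth_on U f" "smooth_on U g"
  shows "smooth_on U (\<lambda>x. f x * g x)"
proof (rule smooth_on_sums_of_products[of U "Collect (smooth_on U)" "Collect (smooth_on U)"])
  show "\<exists>f'\<in>Collect (smooth_on U). \<forall>g\<in>Collect (smooth_on U). \<exists>h\<in>Collect (smooth_on U).
      \<forall>x\<in>U. directional_deriv b f x * g x = f' x * h x"
    if "f \<in> Collect (smooth_on U)" "b \<in> Basis" for f b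
    using smooth_on_directional_deriv[of U f b] that by auto
  show "\<exists>f'\<in>Collect (smooth_on U). \<forall>x\<in>U. directional_deriv b f x = f' x"
    if "f \<in> Collect (smooth_on U)" "b \<in> Basis" for f b
    using smooth_on_directional_deriv[of U f b] that by blast
qed (use assms smooth_on_differentiable in \<open>auto intro: sums_of_products.product\<close>)

lemma smooth_on_sum:
  assumes "open U" "\<And>i. i \<in> I \<Longrightarrow> smooth_on U (f i)"
  shows "smooth_on U (\<lambda>x. \<Sum>i\<in>I. f i x)"
  using assms(2)
  by (induction I rule: infinite_finite_induct)
    (auto intro: smooth_on_add[OF assms(1)] smooth_on_const[OF assms(1)])

lemma smooth_on_prod:
  assumes "open U" "\<And>i. i \<in> I \<Longrightarrow> smooth_on U (f i)"
  shows "smooth_on U (\<lambda>x. \<Prod>i\<in>I. f i x)"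
  using assms(2)
  by (induction I rule: infinite_finite_induct)
    (auto intro: smooth_on_mult[OF assms(1)] smooth_on_const[OF assms(1)])

text \<open>
  The outer functions form a class closed under differentiation: the derivatives of profiles such as
  \<open>exp (- 1 / t)\<close> or \<open>t powr a\<close> stay within an explicit family with parameters. The inner function is
  assumed smooth as a complex-valued function; its complex derivative is real, which is
  what the proof has to extract.
\<close>

lemma smooth_on_compose_real:
  fixes v :: "'a::euclidean_space \<Rightarrow> real" and \<Psi> :: "(real \<Rightarrow> real) set"
  assumes "open U" and v: "smooth_on U (\<lambda>x. complex_of_real (v x))" and vT: "v ` U \<subseteq> T"
    and \<Psi>: "\<And>\<psi>. \<psi> \<in> \<Psi> \<Longrightarrow> \<exists>\<psi>'\<in>\<Psi>. \<forall>t\<in>T. (\<psi> has_field_derivative \<psi>' t) (at t)"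
    and "\<psi> \<in> \<Psi>"
  shows "smooth_on U (\<lambda>x. complex_of_real (\<psi> (v x)))"
proof -
  let ?v = "\<lambda>x. complex_of_real (v x)"
  let ?A = "(\<lambda>\<psi> x. complex_of_real (\<psi> (v x))) ` \<Psi>"
  have deriv: "((\<lambda>x. complex_of_real (\<psi> (v x))) has_derivative
      (\<lambda>h. complex_of_real (\<psi>' (v x)) * frechet_derivative ?v (at x) h)) (at x)"
    if \<psi>': "\<forall>t\<in>T. (\<psi> has_field_derivative \<psi>' t) (at t)" and "x \<in> U" for \<psi> \<psi>' x
  proof -
    let ?V = "frechet_derivative ?v (at x)"
    have V: "(?v has_derivative ?V) (at x)"
      using smooth_on_differentiable[OF v \<open>x \<in> U\<close>] by (rule has_derivative_frechet)
    have Re: "((\<lambda>y. Re (?v y)) has_derivative (\<lambda>h. Re (?V h))) (at x)"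
      and Im: "((\<lambda>y. Im (?v y)) has_derivative (\<lambda>h. Im (?V h))) (at x)"
      by (rule bounded_linear.has_derivative[OF bounded_linear_Re V]
          bounded_linear.has_derivative[OF bounded_linear_Im V])+
    have "(\<lambda>h. Im (?V h)) = (\<lambda>h. 0)"
      using has_derivative_unique[OF Im] has_derivative_const[of 0 "at x"] by simp
    then have real: "complex_of_real (Re (?V h)) = ?V h" for h
      by (metis complex_eq_iff Re_complex_of_real Im_complex_of_real)
    have "(\<psi> has_derivative (\<lambda>h. \<psi>' (v x) * h)) (at (v x))"
      using \<psi>' \<open>x \<in> U\<close> vT by (auto simp: has_field_derivative_def)
    from has_derivative_compose[OF Re[simplified] this]
    have "((\<lambda>y. \<psi> (v y)) has_derivative (\<lambda>h. \<psi>' (v x) * Re (?V h))) (at x)" .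
    from bounded_linear.has_derivative[OF bounded_linear_of_real[where ?'a=complex] this]
    show ?thesis by (simp add: real)
  qed
  show ?thesis
  proof (rule smooth_on_sums_of_products[OF \<open>open U\<close>, of ?A "Collect (smooth_on U)"])
    show "f differentiable at x" if "f \<in> ?A" "x \<in> U" for f x
      using that \<Psi> deriv unfolding differentiable_def by blast
    show "\<exists>f'\<in>?A. \<forall>g\<in>Collect (smooth_on U). \<exists>h\<in>Collect (smooth_on U).
        \<forall>x\<in>U. directional_deriv b f x * g x = f' x * h x"
      if f: "f \<in> ?A" and b: "b \<in> Basis" for f b
    proof -
      from f \<Psi> obtain \<psi> \<psi>' where f: "f = (\<lambda>x. complex_of_real (\<psi> (v x)))"
        and \<psi>': "\<psi>' \<in> \<Psi>" "\<forall>t\<in>T. (\<psi> has_field_derivative \<psi>' t) (at t)" by blast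
      have "directional_deriv b f x = complex_of_real (\<psi>' (v x)) * directional_deriv b ?v x"
        if "x \<in> U" for x
        unfolding f using directional_derivI[OF deriv[OF \<psi>'(2) that]]
        by (simp add: directional_deriv_def)
      then show ?thesis
        using \<psi>'(1) smooth_on_mult[OF \<open>open U\<close> smooth_on_directional_deriv[OF v b]]
        by (intro bexI[of _ "\<lambda>x. complex_of_real (\<psi>' (v x))"] ballI
            bexI[of _ "\<lambda>x. directional_deriv b ?v x * g x" for g]) auto
    qed
    show "(\<lambda>x. complex_of_real (\<psi> (v x))) \<in> sums_of_products ?A (Collect (smooth_on U))"
      using sums_of_products.product[of "\<lambda>x. complex_of_real (\<psi> (v x))" ?A "\<lambda>_. 1"]
        smooth_on_const[OF \<open>open U\<close>, of 1] \<open>\<psi> \<in> \<Psi>\<close> by auto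
    show "\<exists>f'\<in>Collect (smooth_on U). \<forall>x\<in>U. directional_deriv b f x = f' x"
      if "f \<in> Collect (smooth_on U)" "b \<in> Basis" for f b
      using smooth_on_directional_deriv[of U f b] that by blast
  qed (use smooth_on_differentiable in auto)
qed

text \<open>
  Linear maps that send basis vectors to multiples of basis vectors cover the two projections of a product
  and all dilations; for them a partial derivative of the composition is a multiple of one partial
  derivative of \<open>\<eta>\<close>.
\<close>

lemma smooth_compose_linear:
  fixes L :: "'a::euclidean_space \<Rightarrow> 'b::euclidean_space"
  assumes \<eta>: "smooth \<eta>" and L: "bounded_linear L"
    and Basis: "\<And>b. b \<in> Basis \<Longrightarrow> \<exists>c. \<exists>b'\<in>Basis. L b = c *\<^sub>R b'"
  shows "smooth (\<lambda>x. \<eta> (L x))"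
proof -
  let ?S = "{f. \<exists>k \<eta>. smooth \<eta> \<and> f = (\<lambda>x. complex_of_real k * \<eta> (L x))}"
  have deriv: "((\<lambda>x. complex_of_real k * \<eta> (L x)) has_derivative
      (\<lambda>h. complex_of_real k * frechet_derivative \<eta> (at (L x)) (L h))) (at x)"
    if "smooth \<eta>" for k \<eta> x
  proof -
    have "(\<eta> has_derivative frechet_derivative \<eta> (at (L x))) (at (L x))"
      using that by (simp add: smooth_iff_smooth_on has_derivative_frechet smooth_on_differentiable)
    from has_derivative_compose[OF bounded_linear_imp_has_derivative[OF L] this]
    show ?thesis by (rule has_derivative_mult_right)
  qed
  have "smooth_on UNIV (\<lambda>x. \<eta> (L x))"
  proof (rule smooth_on_coinduct[of _ _ ?S])
    show "(\<lambda>x. \<eta> (L x)) \<in> ?S" using \<eta> by (intro CollectI exI[of _ 1] exI[of _ \<eta>]) auto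
    show "f differentiable at x" if "f \<in> ?S" for f x
      using that deriv unfolding differentiable_def by blast
    show "\<exists>g\<in>?S. \<forall>x\<in>UNIV. directional_deriv b f x = g x" if f: "f \<in> ?S" and b: "b \<in> Basis" for f b
    proof -
      from f obtain k \<eta> where \<eta>: "smooth \<eta>" and f: "f = (\<lambda>x. complex_of_real k * \<eta> (L x))" by blast
      from Basis[OF b] obtain c b' where b': "b' \<in> Basis" "L b = c *\<^sub>R b'" by blast
      have "directional_deriv b f x = complex_of_real (k * c) * directional_deriv b' \<eta> (L x)" for x
      proof -
        have "linear (frechet_derivative \<eta> (at (L x)))"
          using \<eta> by (simp add: smooth_iff_smooth_on linear_frechet_derivative smooth_on_differentiable)
        then have "frechet_derivative \<eta> (at (L x)) (L b) = c *\<^sub>R directional_deriv b' \<eta> (L x)"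
          by (simp add: b' linear_cmul directional_deriv_def)
        then show ?thesis
          unfolding f by (simp add: directional_derivI[OF deriv[OF \<eta>]] scaleR_conv_of_real)
      qed
      moreover have "smooth (directional_deriv b' \<eta>)"
        using \<eta> b' by (simp add: smooth_iff_smooth_on smooth_on_directional_deriv)
      ultimately show ?thesis
        by (intro bexI[of _ "\<lambda>x. complex_of_real (k * c) * directional_deriv b' \<eta> (L x)"]) blast+
    qed
  qed simp
  then show ?thesis by (simp add: smooth_iff_smooth_on)
qed

lemma smooth_eq_0_outside_in_schwartz:
  assumes "smooth f" "compact K" and zero: "\<And>x. x \<notin> K \<Longrightarrow> f x = 0"
  shows "f \<in> schwartz"
    and "\<And>bs x. bs \<in> lists Basis \<Longrightarrow> x \<notin> K \<Longrightarrow> iter_partial bs f x = 0"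
proof -
  have "open (- K)" using compact_imp_closed[OF assms(2)] by (rule open_Compl)
  show zero': "iter_partial bs f x = 0" if "bs \<in> lists Basis" "x \<notin> K" for bs x
  proof -
    have "\<exists>g\<in>{g. \<forall>x\<in>-K. g x = 0}. \<forall>x\<in>-K. iter_partial bs f x = g x \<and> iter_partial bs f differentiable at x"
    proof (rule iter_partial_in_closed_class[OF \<open>open (-K)\<close> _ _ _ that(1)])
      fix g :: "'a \<Rightarrow> complex" and x assume g: "g \<in> {g. \<forall>x\<in>-K. g x = 0}" "x \<in> -K"
      show "g differentiable at x"
        by (rule differentiable_cong_on[OF \<open>open (-K)\<close> g(2) differentiable_const[of 0]]) (use g in auto)
    next
      fix g :: "'a \<Rightarrow> complex" and b :: 'a assume g: "g \<in> {g. \<forall>x\<in>-K. g x = 0}"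
      have "directional_deriv b g x = 0" if "x \<in> -K" for x
        using directional_deriv_cong_on[OF \<open>open (-K)\<close> that differentiable_const[of 0], of g b] g
          directional_derivI[OF has_derivative_const[of 0 "at x"], of b] by simp
      then show "\<exists>h\<in>{g. \<forall>x\<in>-K. g x = 0}. \<forall>x\<in>-K. directional_deriv b g x = h x" by auto
    qed (use zero in auto)
    then show ?thesis using that by auto
  qed
  show "f \<in> schwartz"
    unfolding schwartz_def
  proof (intro CollectI conjI allI ballI assms(1))
    fix k and bs :: "'a list" assume bs: "bs \<in> lists Basis"
    let ?g = "\<lambda>x. norm x ^ k * cmod (iter_partial bs f x)"
    have "continuous_on UNIV (iter_partial bs f)"
      using assms(1) bs unfolding smooth_def
      by (auto simp: continuous_on_eq_continuous_at intro: differentiable_imp_continuous_within)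
    then have "continuous_on K ?g"
      by (intro continuous_intros) (auto intro: continuous_on_subset)
    from bounded_imp_bdd_above[OF compact_imp_bounded[OF compact_continuous_image[OF this assms(2)]]]
    have "bdd_above (?g ` K)" .
    then obtain M where M: "\<And>x. x \<in> K \<Longrightarrow> ?g x \<le> M" by (auto simp: bdd_above_def)
    have "?g x \<le> max M 0" for x
      using M[of x] zero'[OF bs, of x] by (cases "x \<in> K") auto
    then show "bdd_above (range ?g)" by (auto simp: bdd_above_def)
  qed
qed

section \<open>Smooth bumps on boxes\<close>

definition exp_inv :: "real \<Rightarrow> real" where
  "exp_inv t = (if t > 0 then exp (- (1 / t)) else 0)"

lemma exp_inv_nonneg: "0 \<le> exp_inv t" and exp_inv_le_1: "exp_inv t \<le> 1"
  and exp_inv_pos_iff: "0 < exp_inv t \<longleftrightarrow> 0 < t" and exp_inv_eq_0_iff: "exp_inv t = 0 \<longleftrightarrow> t \<le> 0"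
  by (auto simp: exp_inv_def)

lemma poly_times_exp_minus_tendsto_0:
  fixes P :: "real poly"
  shows "((\<lambda>s. poly P s * exp (- s)) \<longlongrightarrow> 0) at_top"
proof -
  have "((\<lambda>s. \<Sum>i\<le>degree P. coeff P i * (s ^ i / exp s)) \<longlongrightarrow> (\<Sum>i\<le>degree P. coeff P i * 0)) at_top"
    by (intro tendsto_sum tendsto_mult tendsto_const tendsto_power_div_exp_0)
  moreover have "(\<Sum>i\<le>degree P. coeff P i * (s ^ i / exp s)) = poly P s * exp (- s)" for s :: real
    by (simp add: poly_altdef sum_distrib_right exp_minus divide_inverse mult.assoc)
  ultimately show ?thesis by simp
qed

text \<open>
  The functions \<open>P(1/t) exp(-1/t)\<close>, with \<open>P\<close> a polynomial and the value 0 for \<open>t \<le> 0\<close>, are closed under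
  differentiation; at the origin this is the decay of \<open>exp\<close> against polynomials.
\<close>

lemma poly_times_exp_inv_deriv:
  fixes P :: "real poly"
  defines "Q \<equiv> monom 1 2 * (P - pderiv P)"
  shows "((\<lambda>t. poly P (1 / t) * exp_inv t) has_field_derivative poly Q (1 / t) * exp_inv t) (at t)"
proof (cases t "0::real" rule: linorder_cases)
  case less
  have "((\<lambda>_. 0) has_field_derivative 0) (at t)" by simp
  from has_field_derivative_transform_within_open[OF this, of "{..<0}" "\<lambda>t. poly P (1 / t) * exp_inv t"] less
  show ?thesis by (simp add: exp_inv_def)
next
  case equal
  have right: "((\<lambda>h. (poly P (1 / h) * exp_inv h) / h) \<longlongrightarrow> 0) (at_right 0)"
    unfolding filterlim_at_right_to_top
  proof (rule Lim_transform_eventually)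
    show "((\<lambda>s. poly (P * monom 1 1) s * exp (- s)) \<longlongrightarrow> 0) at_top"
      by (rule poly_times_exp_minus_tendsto_0)
    show "\<forall>\<^sub>F s in at_top. poly (P * monom 1 1) s * exp (- s)
      = poly P (1 / inverse s) * exp_inv (inverse s) / inverse s"
      using eventually_gt_at_top[of 0]
      by eventually_elim (simp add: exp_inv_def poly_monom field_simps)
  qed
  have left: "((\<lambda>h. (poly P (1 / h) * exp_inv h) / h) \<longlongrightarrow> 0) (at_left 0)"
    by (rule Lim_transform_eventually[OF tendsto_const])
      (auto simp: eventually_at exp_inv_def intro!: exI[of _ 1])
  from filterlim_split_at_real[OF left right] equal show ?thesis
    by (simp add: DERIV_def) (simp add: exp_inv_def)
next
  case greater
  have "((\<lambda>t. poly P (1 / t) * exp (- (1 / t))) has_field_derivative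
      (poly (pderiv P) (1 / t) * (- 1 / t ^ 2)) * exp (- (1 / t))
      + (exp (- (1 / t)) * (1 / t ^ 2)) * poly P (1 / t)) (at t)"
    using greater
    by (auto intro!: derivative_eq_intros DERIV_chain2[OF poly_DERIV] simp: power2_eq_square field_simps)
  also have "(poly (pderiv P) (1 / t) * (- 1 / t ^ 2)) * exp (- (1 / t))
      + (exp (- (1 / t)) * (1 / t ^ 2)) * poly P (1 / t) = poly Q (1 / t) * exp_inv t"
    using greater by (simp add: Q_def exp_inv_def poly_monom field_simps)
  finally show ?thesis
    by (rule has_field_derivative_transform_within_open[of _ _ _ "{0<..}"])
      (use greater in \<open>auto simp: exp_inv_def\<close>)
qed

lemma smooth_on_exp_inv:
  assumes "open U" "smooth_on U (\<lambda>x. complex_of_real (v x))"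
  shows "smooth_on U (\<lambda>x. complex_of_real (exp_inv (v x)))"
  by (rule smooth_on_compose_real[OF assms, of UNIV "range (\<lambda>P t. poly P (1 / t) * exp_inv t)"])
    (auto intro: poly_times_exp_inv_deriv intro!: image_eqI[of _ _ 1])

text \<open>
  The parameter \<open>m\<close> serves twice: for \<open>m \<rightarrow> \<infinity>\<close> the bumps approximate the indicator function
  of the box, and \<open>m = 1 / r\<close> on a box of side proportional to \<open>r\<close> makes the bumps dilates of one another.
\<close>

definition bump :: "real \<Rightarrow> 'a::euclidean_space \<Rightarrow> 'a \<Rightarrow> 'a \<Rightarrow> real" where
  "bump m a b x = (\<Prod>i\<in>Basis. exp_inv (m * ((x - a) \<bullet> i)) * exp_inv (m * ((b - x) \<bullet> i)))"

lemma smooth_on_inner: "open U \<Longrightarrow> smooth_on U (\<lambda>x. complex_of_real (x \<bullet> c))"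
  by (intro smooth_on_bounded_linear bounded_linear_compose[OF bounded_linear_of_real]
      bounded_linear_inner_left)

lemma smooth_bump: "smooth (\<lambda>x. complex_of_real (bump m a b x))"
proof -
  have affine: "smooth_on UNIV (\<lambda>x::'a. complex_of_real (\<alpha> + x \<bullet> c))" for \<alpha> c
    using smooth_on_add[OF open_UNIV smooth_on_const[OF open_UNIV, of "complex_of_real \<alpha>"]
        smooth_on_inner[OF open_UNIV, of c]] by simp
  have "smooth_on UNIV (\<lambda>x. \<Prod>i\<in>Basis. complex_of_real (exp_inv (- (m * (a \<bullet> i)) + x \<bullet> (m *\<^sub>R i)))
      * complex_of_real (exp_inv (m * (b \<bullet> i) + x \<bullet> (- m *\<^sub>R i))))"
    by (intro smooth_on_prod smooth_on_mult smooth_on_exp_inv affine open_UNIV)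
  also have "(\<lambda>x. \<Prod>i\<in>Basis. complex_of_real (exp_inv (- (m * (a \<bullet> i)) + x \<bullet> (m *\<^sub>R i)))
      * complex_of_real (exp_inv (m * (b \<bullet> i) + x \<bullet> (- m *\<^sub>R i)))) = (\<lambda>x. complex_of_real (bump m a b x))"
    by (simp add: bump_def algebra_simps)
  finally show ?thesis by (simp add: smooth_iff_smooth_on)
qed

lemma bump_nonneg: "0 \<le> bump m a b x"
  unfolding bump_def by (intro prod_nonneg) (simp add: exp_inv_nonneg)

lemma bump_le_1: "bump m a b x \<le> 1"
  unfolding bump_def by (intro prod_le_1) (simp add: exp_inv_nonneg exp_inv_le_1 mult_le_one)

lemma bump_pos: "m > 0 \<Longrightarrow> x \<in> box a b \<Longrightarrow> 0 < bump m a b x"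
  unfolding bump_def by (intro prod_pos) (auto simp: exp_inv_pos_iff mem_box inner_diff_left)

lemma bump_eq_0:
  assumes "m > 0" "x \<notin> box a b" shows "bump m a b x = 0"
proof -
  from assms(2) obtain i where "i \<in> Basis" "x \<bullet> i \<le> a \<bullet> i \<or> b \<bullet> i \<le> x \<bullet> i"
    by (auto simp: mem_box not_less)
  then show ?thesis using assms(1) unfolding bump_def
    by (intro prod_zero) (auto simp: exp_inv_eq_0_iff inner_diff_left mult_nonneg_nonpos intro!: bexI[of _ i])
qed

lemma bump_borel_measurable [measurable]: "bump m a b \<in> borel_measurable borel"
  unfolding bump_def exp_inv_def by measurable

lemma bump_tendsto_indicator: "(\<lambda>m. bump (real (Suc m)) a b x) \<longlonglongrightarrow> indicator (box a b) x"
proof (cases "x \<in> box a b")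
  case True
  have 1: "(\<lambda>m. exp_inv (real (Suc m) * t)) \<longlonglongrightarrow> 1" if "t > 0" for t
  proof -
    have "(\<lambda>m. exp (- (1 / t) * inverse (real (Suc m)))) \<longlonglongrightarrow> exp (- (1 / t) * 0)"
      by (intro tendsto_intros LIMSEQ_inverse_real_of_nat)
    moreover have "exp (- (1 / t) * inverse (real (Suc m))) = exp_inv (real (Suc m) * t)" for m
      using that by (simp add: exp_inv_def divide_inverse)
    ultimately show ?thesis by simp
  qed
  have "(\<lambda>m. bump (real (Suc m)) a b x) \<longlonglongrightarrow> (\<Prod>i\<in>(Basis::'a set). 1 * 1)"
    unfolding bump_def using True
    by (intro tendsto_prod tendsto_mult 1) (auto simp: mem_box inner_diff_left)
  then show ?thesis using True by simp
qed (simp add: bump_eq_0)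

section \<open>Functions determined by their integrals against bumps\<close>

lemma integral_zero_on_boxes_imp_AE_zero:
  fixes f :: "'a::euclidean_space \<Rightarrow> complex"
  assumes f: "integrable lborel f" and zero: "\<And>a b. (LINT x:box a b|lborel. f x) = 0"
  shows "AE x in lborel. f x = 0"
proof -
  have all: "(LINT x:A|lborel. f x) = 0" if "A \<in> sets borel" for A
  proof -
    have int: "set_integrable lborel A f" if "A \<in> sets borel" for A
      unfolding set_integrable_def using f that by (intro integrable_mult_indicator) auto
    have UNIV: "(LINT x:UNIV|lborel. f x) = 0"
    proof -
      let ?B = "\<lambda>n. box (- real n *\<^sub>R One) (real n *\<^sub>R One) :: 'a set"
      have "(\<lambda>n. LINT x:?B n|lborel. f x) \<longlonglongrightarrow> (LINT x:(\<Union>n. ?B n)|lborel. f x)"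
      proof (rule set_integral_cont_up)
        show "incseq ?B" unfolding incseq_def by (intro allI impI subset_box_imp) auto
        show "set_integrable lborel (\<Union>n. ?B n) f" using int[of UNIV] by (simp add: UN_box_eq_UNIV)
      qed simp
      then show ?thesis by (simp add: zero UN_box_eq_UNIV LIMSEQ_const_iff)
    qed
    have gen: "sets borel = sigma_sets UNIV (range (\<lambda>(a, b). box a b :: 'a set))"
      using borel_eq_box by (metis sets_measure_of_conv Pow_UNIV subset_UNIV sets_measure_of)
    have "Int_stable (range (\<lambda>(a, b). box a b :: 'a set))"
      by (auto simp: Int_stable_def box_Int_box)
    moreover have "range (\<lambda>(a, b). box a b :: 'a set) \<subseteq> Pow UNIV" by simp
    ultimately show ?thesis
      using that[unfolded gen]
    proof (induction A rule: sigma_sets_induct_disjoint)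
      case (basic A) then show ?case using zero by auto
    next
      case empty then show ?case by (simp add: set_lebesgue_integral_def)
    next
      case (compl A)
      have A: "A \<in> sets borel" using compl(1) gen by simp
      have "(LINT x:A \<union> (UNIV - A)|lborel. f x) = (LINT x:A|lborel. f x) + (LINT x:UNIV - A|lborel. f x)"
        using A by (intro set_integral_Un int) auto
      then show ?case using compl UNIV by (simp add: Un_absorb2)
    next
      case (union A)
      have A: "A i \<in> sets borel" for i using union(2) gen by auto
      have "(LINT x:(\<Union>i. A i)|lborel. f x) = (\<Sum>i. LINT x:A i|lborel. f x)"
        using A union(1)
        by (intro lebesgue_integral_countable_add int) (auto simp: disjoint_family_on_def)
      then show ?case using union by simp
    qed
  qed
  show ?thesis
    by (rule sigma_finite_measure.density_zero[OF sigma_finite_lborel f]) (use all in simp)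
qed

lemma set_integrable_imp_integrable_bump:
  assumes "m > 0" "set_integrable lborel (cbox a b) v"
  shows "integrable lborel (\<lambda>x. complex_of_real (bump m a b x) * v x)"
proof -
  have "integrable lborel (\<lambda>x. complex_of_real (bump m a b x) * (indicator (cbox a b) x *\<^sub>R v x))"
  proof (rule Bochner_Integration.integrable_bound)
    show "integrable lborel (\<lambda>x. norm (indicator (cbox a b) x *\<^sub>R v x))"
      using assms(2) unfolding set_integrable_def by (rule integrable_norm)
    have [measurable]: "(\<lambda>x. indicator (cbox a b) x *\<^sub>R v x) \<in> borel_measurable lborel"
      using assms(2) unfolding set_integrable_def by (rule borel_measurable_integrable)
    show "(\<lambda>x. complex_of_real (bump m a b x) * (indicator (cbox a b) x *\<^sub>R v x)) \<in> borel_measurable lborel"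
      by measurable
    show "AE x in lborel. norm (complex_of_real (bump m a b x) * (indicator (cbox a b) x *\<^sub>R v x))
        \<le> norm (norm (indicator (cbox a b) x *\<^sub>R v x))"
      using bump_nonneg[of m a b] bump_le_1[of m a b]
      by (intro AE_I2) (auto simp: norm_mult indicator_def intro!: mult_left_le_one_le)
  qed
  moreover have "complex_of_real (bump m a b x) * (indicator (cbox a b) x *\<^sub>R v x)
      = complex_of_real (bump m a b x) * v x" for x
    using bump_eq_0[OF assms(1), of x a b] box_subset_cbox[of a b] by (auto simp: indicator_def)
  ultimately show ?thesis by simp
qed

text \<open>
  The fundamental lemma of the calculus of variations. Sharpening the bumps turns the
  hypothesis into vanishing integrals over boxes, and countably many boxes exhaust \<open>U\<close>.
\<close>

lemma zero_against_bumps_imp_AE_zero: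
  fixes v :: "'a::euclidean_space \<Rightarrow> complex"
  assumes "open U" and int: "\<And>a b. set_integrable lborel (cbox a b) v"
    and zero: "\<And>m a b. m > 0 \<Longrightarrow> cbox a b \<subseteq> U \<Longrightarrow>
      (LINT x|lborel. complex_of_real (bump m a b x) * v x) = 0"
  shows "AE x in lborel. x \<in> U \<longrightarrow> v x = 0"
proof -
  have int_box: "set_integrable lborel (box a b) v" for a b
    by (rule set_integrable_subset[OF int[of a b]]) (auto simp: box_subset_cbox)
  have zero_box: "(LINT x:box a b|lborel. v x) = 0" if "cbox a b \<subseteq> U" for a b
  proof -
    have "(\<lambda>m. LINT x|lborel. complex_of_real (bump (real (Suc m)) a b x) * v x)
      \<longlonglongrightarrow> (LINT x|lborel. indicator (box a b) x *\<^sub>R v x)"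
    proof (rule integral_dominated_convergence)
      show "integrable lborel (\<lambda>x. norm (indicator (cbox a b) x *\<^sub>R v x))"
        using int[of a b] unfolding set_integrable_def by (rule integrable_norm)
      show "(\<lambda>x. indicator (box a b) x *\<^sub>R v x) \<in> borel_measurable lborel"
        using int_box[of a b] unfolding set_integrable_def by (rule borel_measurable_integrable)
      show "(\<lambda>x. complex_of_real (bump (real (Suc m)) a b x) * v x) \<in> borel_measurable lborel" for m
        using set_integrable_imp_integrable_bump[OF _ int, of "real (Suc m)"]
        by (intro borel_measurable_integrable) simp
      show "AE x in lborel. norm (complex_of_real (bump (real (Suc m)) a b x) * v x)
          \<le> norm (indicator (cbox a b) x *\<^sub>R v x)" for m
      proof (intro AE_I2)
        fix x
        show "norm (complex_of_real (bump (real (Suc m)) a b x) * v x)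
          \<le> norm (indicator (cbox a b) x *\<^sub>R v x)"
          using bump_nonneg[of "real (Suc m)" a b x] bump_le_1[of "real (Suc m)" a b x]
            bump_eq_0[of "real (Suc m)" x a b] subsetD[OF box_subset_cbox[of a b], of x]
          by (cases "x \<in> box a b"; cases "x \<in> cbox a b")
            (auto simp: norm_mult simp del: of_nat_Suc intro!: mult_left_le_one_le)
      qed
      show "AE x in lborel. (\<lambda>m. complex_of_real (bump (real (Suc m)) a b x) * v x)
          \<longlonglongrightarrow> indicator (box a b) x *\<^sub>R v x"
        using tendsto_mult[OF tendsto_of_real[OF bump_tendsto_indicator] tendsto_const]
        by (intro AE_I2) (simp add: scaleR_conv_of_real)
    qed
    moreover have "(LINT x|lborel. complex_of_real (bump (real (Suc m)) a b x) * v x) = 0" for m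
      using zero[of "real (Suc m)"] that by simp
    ultimately show ?thesis
      by (simp add: set_lebesgue_integral_def LIMSEQ_const_iff)
  qed
  have AE_cbox: "AE x in lborel. x \<in> cbox a b \<longrightarrow> v x = 0" if "cbox a b \<subseteq> U" for a b
  proof -
    have "AE x in lborel. indicator (box a b) x *\<^sub>R v x = 0"
    proof (rule integral_zero_on_boxes_imp_AE_zero)
      show "integrable lborel (\<lambda>x. indicator (box a b) x *\<^sub>R v x)"
        using int_box unfolding set_integrable_def .
      fix c d :: 'a
      obtain e f where ef: "box c d \<inter> box a b = box e f" by (simp add: box_Int_box)
      have "(LINT x:box c d|lborel. indicator (box a b) x *\<^sub>R v x) = (LINT x:box e f|lborel. v x)"
        unfolding set_lebesgue_integral_def ef[symmetric] by (simp add: indicator_inter_arith)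
      also have "\<dots> = 0"
      proof (cases "box e f = {}")
        case False
        then have "cbox e f = closure (box e f)" by (simp add: closure_box)
        also have "\<dots> \<subseteq> cbox a b"
          using ef box_subset_cbox[of a b] by (intro closure_minimal) auto
        finally show ?thesis using that by (intro zero_box) auto
      qed (simp add: set_lebesgue_integral_def)
      finally show "(LINT x:box c d|lborel. indicator (box a b) x *\<^sub>R v x) = 0" .
    qed
    moreover have "AE x in lborel. x \<notin> cbox a b - box a b"
    proof (rule AE_not_in)
      show "cbox a b - box a b \<in> null_sets lborel"
        using negligible_frontier_interval[of a b]
        by (simp add: negligible_iff_null_sets null_sets_completion_iff)
    qed
    ultimately show ?thesis by eventually_elim (auto split: split_indicator_asm)
  qed
  \<comment> \<open>closed boxes, since the hypothesis is about boxes whose closure lies in \<open>U\<close>\<close>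
  obtain D where D: "countable D" "D \<subseteq> Pow U" "\<And>X. X \<in> D \<Longrightarrow> \<exists>a b. X = cbox a b" "\<Union>D = U"
    using open_countable_Union_open_cbox[OF \<open>open U\<close>] by metis
  have "AE x in lborel. \<forall>X\<in>D. x \<in> X \<longrightarrow> v x = 0"
    unfolding AE_ball_countable[OF D(1)]
  proof
    fix X assume "X \<in> D"
    then obtain a b where "X = cbox a b" "cbox a b \<subseteq> U" using D(2,3) by blast
    then show "AE x in lborel. x \<in> X \<longrightarrow> v x = 0" using AE_cbox by simp
  qed
  then show ?thesis
  proof eventually_elim
    case (elim x)
    then show ?case unfolding D(4)[symmetric] by (meson UnionE)
  qed
qed

section \<open>Schwartz functions and cutoffs\<close>

lemma smooth_differentiable: "smooth f \<Longrightarrow> f differentiable at x"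
  by (simp add: smooth_iff_smooth_on smooth_on_differentiable)

lemma smooth_mult: "smooth f \<Longrightarrow> smooth g \<Longrightarrow> smooth (\<lambda>x. f x * g x)"
  by (simp add: smooth_iff_smooth_on smooth_on_mult)

lemma smooth_const: "smooth (\<lambda>_. c)"
  by (simp add: smooth_iff_smooth_on smooth_on_const)

lemma iter_partial_diff:
  assumes "smooth f" "smooth g" "bs \<in> lists Basis"
  shows "iter_partial bs (\<lambda>x. f x - g x) = (\<lambda>x. iter_partial bs f x - iter_partial bs g x)"
  using assms(3)
proof (induction bs)
  case (Cons b bs)
  have "iter_partial bs f differentiable at x" "iter_partial bs g differentiable at x" for x
    using assms(1,2) Cons.hyps(2) by (auto simp: smooth_def)
  then have "directional_deriv b (\<lambda>x. iter_partial bs f x - iter_partial bs g x) x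
      = directional_deriv b (iter_partial bs f) x - directional_deriv b (iter_partial bs g) x" for x
    by (subst directional_derivI[OF has_derivative_diff[OF has_derivative_frechet has_derivative_frechet]])
      (simp_all add: directional_deriv_def)
  then show ?case by (simp add: iter_partial_Cons Cons.IH fun_eq_iff)
qed simp

lemma schwartz_smooth: "f \<in> schwartz \<Longrightarrow> smooth f"
  by (simp add: schwartz_def)

lemma schwartz_directional_deriv:
  assumes "f \<in> schwartz" "b \<in> Basis"
  shows "directional_deriv b f \<in> schwartz"
  using assms smooth_on_directional_deriv[of UNIV f b]
  by (auto simp: schwartz_def smooth_iff_smooth_on iter_partial_snoc [symmetric])

lemma schwartz_decay:
  assumes "f \<in> schwartz"
  obtains C where "C \<ge> 0" "\<And>x. norm x ^ k * cmod (f x) \<le> C"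
proof -
  have "\<forall>bs\<in>lists Basis. bdd_above (range (\<lambda>x. norm x ^ k * cmod (iter_partial bs f x)))"
    using assms by (simp add: schwartz_def)
  from bspec[OF this lists.Nil] have "bdd_above (range (\<lambda>x. norm x ^ k * cmod (f x)))" by simp
  then obtain C where "\<And>x. norm x ^ k * cmod (f x) \<le> C" by (auto simp: bdd_above_def)
  then show ?thesis using that[of "max C 0"] by (simp add: le_max_iff_disj)
qed

lemma schwartz_continuous: "f \<in> schwartz \<Longrightarrow> continuous_on UNIV f"
  by (auto simp: continuous_on_eq_continuous_at dest!: schwartz_smooth
      intro!: differentiable_imp_continuous_within smooth_differentiable)

lemma schwartz_borel_measurable: "f \<in> schwartz \<Longrightarrow> f \<in> borel_measurable borel"
  by (intro borel_measurable_continuous_onI schwartz_continuous)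

text \<open>
  Decay of order \<open>n + 1\<close> dominates \<open>f\<close> by a series of indicator functions of the balls of radius \<open>2^k\<close>
  with coefficients of order \<open>2^(-k(n+1))\<close>, and these balls have volume of order \<open>2^(k n)\<close>.
\<close>

lemma schwartz_integrable:
  fixes f :: "'a::euclidean_space \<Rightarrow> complex"
  assumes "f \<in> schwartz"
  shows "integrable lborel f"
proof -
  let ?n = "DIM('a)"
  obtain A where A: "A \<ge> 0" "\<And>x. norm x ^ 0 * cmod (f x) \<le> A" by (rule schwartz_decay[OF assms, of 0]) blast
  obtain B where B: "B \<ge> 0" "\<And>x. norm x ^ (?n + 1) * cmod (f x) \<le> B"
    by (rule schwartz_decay[OF assms, of "?n + 1"]) blast
  define M where "M = A + B * 2 ^ (?n + 1)"
  have "M \<ge> 0" using A B by (simp add: M_def)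
  let ?t = "\<lambda>k (x::'a). ennreal (M * (1 / 2 ^ (?n + 1)) ^ k) * indicator (cball 0 (2 ^ k)) x"
  have pointwise: "ennreal (cmod (f x)) \<le> (\<Sum>k. ?t k x)" for x
  proof -
    \<comment> \<open>the first dyadic ball containing \<open>x\<close>; in it the decay of \<open>f\<close> has the right size\<close>
    obtain k where k: "norm x \<le> 2 ^ k" "k = 0 \<or> 2 ^ k \<le> 2 * norm x"
    proof -
      define k where "k = (LEAST k. norm x \<le> 2 ^ k)"
      have "\<exists>k. norm x \<le> 2 ^ k" using real_arch_pow[of 2 "norm x"] less_imp_le by auto
      then have "norm x \<le> 2 ^ k" unfolding k_def by (rule LeastI_ex)
      moreover have "2 ^ k \<le> 2 * norm x" if "k \<noteq> 0"
        using not_less_Least[of "k - 1" "\<lambda>k. norm x \<le> 2 ^ k"] that unfolding k_def[symmetric]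
        by (cases k) auto
      ultimately show ?thesis by (intro that[of k]) auto
    qed
    have "cmod (f x) * (2 ^ (?n + 1)) ^ k \<le> M"
    proof (cases "k = 0")
      case True
      then show ?thesis using A(2)[of x] B(1) by (simp add: M_def add_increasing2)
    next
      case False
      have "((2::real) ^ (?n + 1)) ^ k = (2 ^ k) ^ (?n + 1)"
        by (simp only: power_mult[symmetric] mult.commute)
      also have "(2 ^ k) ^ (?n + 1) \<le> (2 * norm x) ^ (?n + 1)"
        using k(2) False by (intro power_mono) auto
      finally have "cmod (f x) * (2 ^ (?n + 1)) ^ k \<le> cmod (f x) * (2 * norm x) ^ (?n + 1)"
        by (intro mult_left_mono) auto
      also have "\<dots> = 2 ^ (?n + 1) * (norm x ^ (?n + 1) * cmod (f x))"
        by (simp add: power_mult_distrib mult_ac)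
      also have "\<dots> \<le> 2 ^ (?n + 1) * B" by (intro mult_left_mono B) simp
      finally show ?thesis using A(1) by (simp add: M_def mult_ac)
    qed
    then have "cmod (f x) \<le> M * (1 / 2 ^ (?n + 1)) ^ k"
      by (simp add: power_one_over field_simps)
    then have "ennreal (cmod (f x)) \<le> ?t k x"
      using k(1) by (simp add: indicator_def ennreal_leI)
    also have "\<dots> = sum (\<lambda>k. ?t k x) {k}"
      by (simp only: sum.insert finite.emptyI empty_iff not_False_eq_True sum.empty add_0_right)
    also have "\<dots> \<le> (\<Sum>k. ?t k x)"
      by (rule sum_le_suminf) auto
    finally show ?thesis .
  qed
  have "(\<integral>\<^sup>+x. ennreal (cmod (f x)) \<partial>lborel) \<le> (\<integral>\<^sup>+x. (\<Sum>k. ?t k x) \<partial>lborel)"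
    by (intro nn_integral_mono pointwise)
  also have "\<dots> = (\<Sum>k. \<integral>\<^sup>+x. ?t k x \<partial>lborel)"
    by (rule nn_integral_suminf)
      (intro borel_measurable_times_ennreal borel_measurable_const borel_measurable_indicator, simp)
  also have "\<dots> = (\<Sum>k. ennreal (M * unit_ball_vol ?n * (1 / 2) ^ k))"
  proof (rule suminf_cong)
    fix k
    have "(1 / 2 ^ (?n + 1)) ^ k * (2 ^ k) ^ ?n = (1 / 2 :: real) ^ k"
    proof -
      have "(2 ^ k) ^ ?n = ((2::real) ^ ?n) ^ k" by (simp only: power_mult[symmetric] mult.commute)
      then show ?thesis by (simp add: power_mult_distrib power_divide)
    qed
    then have "M * (1 / 2 ^ (?n + 1)) ^ k * (unit_ball_vol ?n * (2 ^ k) ^ ?n)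
        = M * unit_ball_vol ?n * (1 / 2) ^ k" by (simp only: mult_ac)
    moreover have "(\<integral>\<^sup>+x. ?t k x \<partial>lborel)
        = ennreal (M * (1 / 2 ^ (?n + 1)) ^ k) * ennreal (unit_ball_vol ?n * (2 ^ k) ^ ?n)"
      by (subst nn_integral_cmult_indicator) (auto simp: emeasure_cball)
    ultimately show "(\<integral>\<^sup>+x. ?t k x \<partial>lborel) = ennreal (M * unit_ball_vol ?n * (1 / 2) ^ k)"
      using \<open>M \<ge> 0\<close> by (simp add: ennreal_mult[symmetric])
  qed
  also have "\<dots> < \<infinity>"
    using \<open>M \<ge> 0\<close>
    by (subst suminf_ennreal2) (auto intro!: summable_mult summable_geometric)
  finally show ?thesis
    using schwartz_borel_measurable[OF assms] by (intro integrableI_bounded) auto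
qed

text \<open>
  Dilates of one bump, normalised to the value 1 at the origin. The bound of \<open>cutoff_minus_1_bound\<close>
  replaces the more usual requirement that a cutoff be equal to 1 near the origin.
\<close>

definition cutoff :: "nat \<Rightarrow> 'a::euclidean_space \<Rightarrow> real" where
  "cutoff N x = bump 1 (- One) One ((1 / real (Suc N)) *\<^sub>R x) / bump 1 (- One) One (0::'a)"

lemma bump_0_pos: "0 < bump 1 (- One) One (0::'a::euclidean_space)"
  by (rule bump_pos) (auto simp: mem_box)

lemma smooth_scaleR: "smooth f \<Longrightarrow> smooth (\<lambda>x. f (c *\<^sub>R x))"
  by (rule smooth_compose_linear) (auto intro: bounded_linear_scaleR_right)

lemma directional_deriv_scaleR:
  assumes "f differentiable at (c *\<^sub>R x)"
  shows "directional_deriv b (\<lambda>x. f (c *\<^sub>R x)) x = c *\<^sub>R directional_deriv b f (c *\<^sub>R x)"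
proof -
  have "((\<lambda>x. f (c *\<^sub>R x)) has_derivative (\<lambda>h. frechet_derivative f (at (c *\<^sub>R x)) (c *\<^sub>R h))) (at x)"
    by (rule has_derivative_compose[OF bounded_linear_imp_has_derivative[OF bounded_linear_scaleR_right]
          has_derivative_frechet[OF assms]])
  from directional_derivI[OF this, of b] show ?thesis
    using linear_frechet_derivative[OF assms] by (simp add: linear_cmul directional_deriv_def)
qed

lemma cutoff_nonneg: "0 \<le> cutoff N x"
  and cutoff_le: "cutoff N (x::'a::euclidean_space) \<le> 1 / bump 1 (- One) One (0::'a)"
  unfolding cutoff_def using bump_0_pos[where ?'a='a]
  by (auto intro!: divide_nonneg_pos divide_right_mono bump_nonneg bump_le_1)

lemma cutoff_eq_0: "x \<notin> cbox (- real (Suc N) *\<^sub>R One) (real (Suc N) *\<^sub>R One) \<Longrightarrow> cutoff N x = 0"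
proof -
  assume "x \<notin> cbox (- real (Suc N) *\<^sub>R One) (real (Suc N) *\<^sub>R One)"
  then have "(1 / real (Suc N)) *\<^sub>R x \<notin> box (- One) One"
    by (auto simp: mem_box divide_simps simp del: of_nat_Suc) force+
  then show ?thesis by (simp add: cutoff_def bump_eq_0)
qed

lemma smooth_cutoff: "smooth (\<lambda>x. complex_of_real (cutoff N x))"
proof -
  have "smooth (\<lambda>x. complex_of_real (bump 1 (- One) One ((1 / real (Suc N)) *\<^sub>R x))
      * (1 / complex_of_real (bump 1 (- One) One (0::'a))))"
    by (intro smooth_mult smooth_const smooth_scaleR[OF smooth_bump])
  then show ?thesis by (simp add: cutoff_def)
qed

lemma cutoff_mult_in_schwartz:
  assumes "f \<in> schwartz"
  shows "(\<lambda>x. f x * complex_of_real (cutoff N x)) \<in> schwartz"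
proof (rule smooth_eq_0_outside_in_schwartz)
  show "smooth (\<lambda>x. f x * complex_of_real (cutoff N x))"
    by (intro smooth_mult schwartz_smooth smooth_cutoff assms)
  show "f x * complex_of_real (cutoff N x) = 0"
    if "x \<notin> cbox (- real (Suc N) *\<^sub>R One) (real (Suc N) *\<^sub>R One)" for x
    by (simp only: cutoff_eq_0[OF that] of_real_0 mult_zero_right)
qed (rule compact_cbox)

text \<open>
  A Lipschitz estimate at the origin for the undilated cutoff: near the origin from differentiability, far away
  from boundedness.
\<close>

lemma cutoff_minus_1_bound:
  obtains C where "C \<ge> 0"
    "\<And>N (x::'a::euclidean_space). \<bar>cutoff N x - 1\<bar> \<le> C * norm x / real (Suc N)"
proof -
  let ?\<zeta> = "\<lambda>x::'a. complex_of_real (cutoff 0 x)"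
  have cutoff_0: "cutoff N x = cutoff 0 ((1 / real (Suc N)) *\<^sub>R x)" for N and x :: 'a
    by (simp add: cutoff_def)
  have at_0: "?\<zeta> 0 = 1" using bump_0_pos[where ?'a='a] by (simp add: cutoff_def)
  let ?L = "frechet_derivative ?\<zeta> (at 0)"
  have der: "(?\<zeta> has_derivative ?L) (at 0)"
    by (intro has_derivative_frechet smooth_differentiable smooth_cutoff)
  obtain K where K: "\<And>x. norm (?L x) \<le> norm x * K"
    using bounded_linear.bounded[OF has_derivative_bounded_linear[OF der]] by blast
  obtain d where d: "d > 0" "\<And>x. norm x < d \<Longrightarrow> norm (?\<zeta> x - 1 - ?L x) \<le> norm x"
    using der[unfolded has_derivative_at_alt] at_0
    by (metis diff_zero mult_1 zero_less_one)
  define B where "B = 1 + 1 / bump 1 (- One) One (0::'a)"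
  define C where "C = max (1 + K) (B / d)"
  have "B > 0" using bump_0_pos[where ?'a='a] by (simp add: B_def add_pos_pos)
  then have "C \<ge> 0" using d(1) by (simp add: C_def le_max_iff_disj)
  have bound: "\<bar>cutoff 0 x - 1\<bar> \<le> C * norm x" for x :: 'a
  proof (cases "norm x < d")
    case True
    have "\<bar>cutoff 0 x - 1\<bar> = norm (?\<zeta> x - 1)"
      by (metis norm_of_real of_real_1 of_real_diff)
    also have "\<dots> \<le> norm (?\<zeta> x - 1 - ?L x) + norm (?L x)"
      by (metis add.commute diff_add_cancel norm_triangle_ineq)
    also have "\<dots> \<le> (1 + K) * norm x"
      using d(2)[OF True] K[of x] by (simp add: algebra_simps)
    also have "\<dots> \<le> C * norm x" by (intro mult_right_mono) (auto simp: C_def)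
    finally show ?thesis .
  next
    case False
    have "\<bar>cutoff 0 x - 1\<bar> \<le> B"
      using cutoff_nonneg[of 0 x] cutoff_le[of 0 x] by (simp add: B_def)
    also have "\<dots> \<le> B / d * norm x"
      using False d(1) \<open>B > 0\<close> by (simp add: field_simps)
    also have "\<dots> \<le> C * norm x" by (intro mult_right_mono) (auto simp: C_def)
    finally show ?thesis .
  qed
  show ?thesis
  proof (rule that[OF \<open>C \<ge> 0\<close>])
    show "\<bar>cutoff N x - 1\<bar> \<le> C * norm x / real (Suc N)" for N and x :: 'a
      using bound[of "(1 / real (Suc N)) *\<^sub>R x"] unfolding cutoff_0[of N x] by simp
  qed
qed

lemma cutoff_tendsto_1: "(\<lambda>N. cutoff N (x::'a::euclidean_space)) \<longlonglongrightarrow> 1"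
proof -
  obtain C where C: "\<And>N (x::'a). \<bar>cutoff N x - 1\<bar> \<le> C * norm x / real (Suc N)"
    by (rule cutoff_minus_1_bound) blast
  have "(\<lambda>N. C * norm x * inverse (real (Suc N))) \<longlonglongrightarrow> C * norm x * 0"
    by (intro tendsto_intros LIMSEQ_inverse_real_of_nat)
  then have "(\<lambda>N. cutoff N x - 1) \<longlonglongrightarrow> 0"
    unfolding mult_zero_right
  proof (rule Lim_null_comparison[rotated])
    show "\<forall>\<^sub>F N in sequentially. norm (cutoff N x - 1) \<le> C * norm x * inverse (real (Suc N))"
      using C[of _ x] by (intro always_eventually allI) (simp add: divide_inverse)
  qed
  then show ?thesis by (simp add: LIM_zero_iff)
qed

text \<open>
  Every partial derivative of \<open>f (cutoff N - 1)\<close> is a sum of terms of two kinds: those in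
  which no derivative has fallen on the cutoff, which are small because \<open>cutoff N - 1\<close> is small where \<open>f\<close>
  is not, and those in which at least one has, which carry a factor \<open>1 / (N + 1)\<close> from the dilation.
  Both kinds decay like \<open>1 / N\<close> in every Schwartz seminorm.
\<close>

inductive_set cutoff_errors :: "(nat \<Rightarrow> 'a::euclidean_space \<Rightarrow> complex) set" where
  undifferentiated: "f \<in> schwartz \<Longrightarrow> (\<lambda>N x. f x * complex_of_real (cutoff N x - 1)) \<in> cutoff_errors"
| differentiated: "f \<in> schwartz \<Longrightarrow> g \<in> schwartz \<Longrightarrow> (\<And>N. \<bar>c N\<bar> \<le> 1 / real (Suc N)) \<Longrightarrow>
    (\<lambda>N x. f x * (complex_of_real (c N) * g ((1 / real (Suc N)) *\<^sub>R x))) \<in> cutoff_errors"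
| add: "H \<in> cutoff_errors \<Longrightarrow> H' \<in> cutoff_errors \<Longrightarrow> (\<lambda>N x. H N x + H' N x) \<in> cutoff_errors"

lemma cutoff_errors_decay:
  "H \<in> cutoff_errors \<Longrightarrow> \<exists>C. \<forall>N x. norm x ^ k * cmod (H N x) \<le> C / real (Suc N)"
proof (induction H rule: cutoff_errors.induct)
  case (undifferentiated f)
  obtain A where A: "\<And>x. norm x ^ (k + 1) * cmod (f x) \<le> A"
    by (rule schwartz_decay[OF undifferentiated, of "k + 1"]) blast
  obtain C where C: "C \<ge> 0" "\<And>N (x::'a). \<bar>cutoff N x - 1\<bar> \<le> C * norm x / real (Suc N)"
    by (rule cutoff_minus_1_bound) blast
  have "norm x ^ k * cmod (f x * complex_of_real (cutoff N x - 1)) \<le> A * C / real (Suc N)" for N x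
  proof -
    have "norm x ^ k * cmod (f x * complex_of_real (cutoff N x - 1))
        = norm x ^ k * cmod (f x) * \<bar>cutoff N x - 1\<bar>" by (simp only: norm_mult norm_of_real mult.assoc)
    also have "\<dots> \<le> norm x ^ k * cmod (f x) * (C * norm x / real (Suc N))"
      by (intro mult_left_mono C) auto
    also have "\<dots> = (norm x ^ (k + 1) * cmod (f x)) * (C / real (Suc N))" by simp
    also have "\<dots> \<le> A * (C / real (Suc N))" by (intro mult_right_mono A) (use C in auto)
    finally show ?thesis by simp
  qed
  then show ?case by blast
next
  case (differentiated f g c)
  obtain A where A: "A \<ge> 0" "\<And>x. norm x ^ k * cmod (f x) \<le> A"
    by (rule schwartz_decay[OF differentiated(1), of k]) blast
  obtain B where B: "B \<ge> 0" "\<And>x. norm x ^ 0 * cmod (g x) \<le> B"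
    by (rule schwartz_decay[OF differentiated(2), of 0]) blast
  have "norm x ^ k * cmod (f x * (complex_of_real (c N) * g ((1 / real (Suc N)) *\<^sub>R x)))
      \<le> A * B / real (Suc N)" for N x
  proof -
    have "norm x ^ k * cmod (f x * (complex_of_real (c N) * g ((1 / real (Suc N)) *\<^sub>R x)))
      = (norm x ^ k * cmod (f x)) * (\<bar>c N\<bar> * cmod (g ((1 / real (Suc N)) *\<^sub>R x)))"
      by (simp only: norm_mult norm_of_real mult.assoc)
    also have "\<dots> \<le> A * (1 / real (Suc N) * B)"
      using A B(1) B(2)[of "(1 / real (Suc N)) *\<^sub>R x"] differentiated(3)[of N]
      by (intro mult_mono) auto
    finally show ?thesis by simp
  qed
  then show ?case by blast
next
  case (add H H')
  then obtain C C' where C: "\<And>N x. norm x ^ k * cmod (H N x) \<le> C / real (Suc N)"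
    "\<And>N x. norm x ^ k * cmod (H' N x) \<le> C' / real (Suc N)" by blast
  have "norm x ^ k * cmod (H N x + H' N x) \<le> (C + C') / real (Suc N)" for N x
  proof -
    have "norm x ^ k * cmod (H N x + H' N x) \<le> norm x ^ k * (cmod (H N x) + cmod (H' N x))"
      by (intro mult_left_mono norm_triangle_ineq) auto
    also have "\<dots> \<le> (C + C') / real (Suc N)"
      using C(1)[of x N] C(2)[of x N] by (simp add: algebra_simps add_divide_distrib)
    finally show ?thesis .
  qed
  then show ?case by blast
qed

lemma cutoff_errors_differentiable:
  "H \<in> cutoff_errors \<Longrightarrow> H N differentiable at x"
proof (induction H rule: cutoff_errors.induct)
  case (undifferentiated f)
  have "(\<lambda>x::'a. complex_of_real (cutoff N x) - 1) differentiable at x"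
    by (intro differentiable_diff differentiable_const smooth_differentiable smooth_cutoff)
  then have "(\<lambda>x. f x * (complex_of_real (cutoff N x) - 1)) differentiable at x"
    by (rule differentiable_mult[OF smooth_differentiable[OF schwartz_smooth[OF undifferentiated]]])
  then show ?case by simp
next
  case (differentiated f g c)
  then show ?case
    by (intro differentiable_mult differentiable_const smooth_differentiable smooth_scaleR schwartz_smooth)
qed (intro differentiable_add)

lemma cutoff_errors_closed:
  assumes "b \<in> Basis"
  shows "H \<in> cutoff_errors \<Longrightarrow> \<exists>H'\<in>cutoff_errors. \<forall>N. \<forall>x\<in>UNIV. directional_deriv b (H N) x = H' N x"
proof (induction H rule: cutoff_errors.induct)
  case (undifferentiated f)
  let ?\<zeta> = "\<lambda>x::'a. complex_of_real (cutoff 0 x)"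
  let ?H' = "\<lambda>N x. directional_deriv b f x * complex_of_real (cutoff N x - 1)
      + f x * (complex_of_real (1 / real (Suc N)) * directional_deriv b ?\<zeta> ((1 / real (Suc N)) *\<^sub>R x))"
  have "?\<zeta> \<in> schwartz"
    by (rule smooth_eq_0_outside_in_schwartz[OF smooth_cutoff compact_cbox[of "- real (Suc 0) *\<^sub>R One" "real (Suc 0) *\<^sub>R One"]])
      (simp only: cutoff_eq_0 of_real_0 not_False_eq_True)
  then have "?H' \<in> cutoff_errors"
    using undifferentiated assms
    by (intro cutoff_errors.intros schwartz_directional_deriv) auto
  moreover have "directional_deriv b (\<lambda>x. f x * complex_of_real (cutoff N x - 1)) x = ?H' N x" for N x
  proof -
    have cutoff_0: "cutoff N = (\<lambda>x. cutoff 0 ((1 / real (Suc N)) *\<^sub>R x))"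
      by (simp add: cutoff_def fun_eq_iff)
    have "directional_deriv b (\<lambda>x. complex_of_real (cutoff N x)) x
        = complex_of_real (1 / real (Suc N)) * directional_deriv b ?\<zeta> ((1 / real (Suc N)) *\<^sub>R x)"
      unfolding cutoff_0 scaleR_conv_of_real[symmetric]
      by (rule directional_deriv_scaleR[OF smooth_differentiable[OF smooth_cutoff]])
    moreover have "directional_deriv b (\<lambda>x. complex_of_real (cutoff N x - 1)) x
        = directional_deriv b (\<lambda>x. complex_of_real (cutoff N x)) x"
      using iter_partial_diff[OF smooth_cutoff[of N] smooth_const[of 1], of "[b]"] assms
        directional_derivI[OF has_derivative_const[of "1::complex" "at x"], of b]
      by (simp add: iter_partial_Cons fun_eq_iff)
    moreover have "(\<lambda>x::'a. complex_of_real (cutoff N x - 1)) differentiable at x"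
      unfolding of_real_diff
      by (simp add: differentiable_diff smooth_differentiable smooth_cutoff)
    ultimately show ?thesis
      by (subst directional_deriv_mult)
        (auto intro: smooth_differentiable schwartz_smooth undifferentiated)
  qed
  ultimately show ?case by (intro bexI[of _ ?H']) auto
next
  case (differentiated f g c)
  let ?H' = "\<lambda>N x. directional_deriv b f x * (complex_of_real (c N) * g ((1 / real (Suc N)) *\<^sub>R x))
      + f x * (complex_of_real (c N / real (Suc N)) * directional_deriv b g ((1 / real (Suc N)) *\<^sub>R x))"
  have "\<bar>c N / real (Suc N)\<bar> \<le> 1 / real (Suc N)" for N
  proof -
    have "\<bar>c N\<bar> \<le> 1" using differentiated(3)[of N] by (rule order_trans) simp
    then show ?thesis by (simp add: divide_right_mono)
  qed
  then have "?H' \<in> cutoff_errors"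
    using differentiated assms
    by (intro cutoff_errors.intros schwartz_directional_deriv) auto
  moreover have "directional_deriv b
      (\<lambda>x. f x * (complex_of_real (c N) * g ((1 / real (Suc N)) *\<^sub>R x))) x = ?H' N x" for N x
  proof -
    have g: "g differentiable at y" for y
      by (intro smooth_differentiable schwartz_smooth differentiated)
    have sg: "(\<lambda>x. g ((1 / real (Suc N)) *\<^sub>R x)) differentiable at x"
      by (intro smooth_differentiable smooth_scaleR schwartz_smooth differentiated)
    show ?thesis
      using directional_deriv_scaleR[OF g, of b "1 / real (Suc N)" x] sg
        directional_derivI[OF has_derivative_const[of "complex_of_real (c N)" "at x"], of b]
      by (simp add: directional_deriv_mult smooth_differentiable schwartz_smooth differentiated
          scaleR_conv_of_real)
  qed
  ultimately show ?case by (intro bexI[of _ ?H']) auto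
next
  case (add H H')
  then obtain K K' where K: "K \<in> cutoff_errors" "K' \<in> cutoff_errors"
    "\<And>N x. directional_deriv b (H N) x = K N x" "\<And>N x. directional_deriv b (H' N) x = K' N x" by blast
  have "directional_deriv b (\<lambda>x. H N x + H' N x) x = K N x + K' N x" for N x
    using directional_deriv_add[OF cutoff_errors_differentiable[OF add(1)] cutoff_errors_differentiable[OF add(2)]]
    by (simp add: K)
  then show ?case using cutoff_errors.add[OF K(1,2)] by (intro bexI[of _ "\<lambda>N x. K N x + K' N x"]) auto
qed

text \<open>
  The Schwartz topology is given by a subbase of seminorm balls around arbitrary centres; sequences that
  converge in every seminorm converge in it.
\<close>

lemma eventually_in_schwartz_open:
  assumes "openin schwartz_topology W" "f \<in> W"
    and g: "\<And>N. g N \<in> schwartz" and "f \<in> schwartz"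
    and small: "\<And>k bs. bs \<in> lists Basis \<Longrightarrow> \<exists>\<delta>. \<delta> \<longlonglongrightarrow> 0 \<and>
      (\<forall>N x. norm x ^ k * cmod (iter_partial bs (\<lambda>x. g N x - f x) x) \<le> \<delta> N)"
  shows "\<forall>\<^sub>F N in sequentially. g N \<in> W"
proof -
  have "generate_topology_on {{g \<in> schwartz. schwartz_seminorm k bs (\<lambda>x. g x - f x) < e} | f k bs e.
      f \<in> schwartz \<and> bs \<in> lists Basis \<and> e > 0} W"
    using assms(1) by (simp add: schwartz_topology_def openin_topology_generated_by_iff)
  then show ?thesis
    using \<open>f \<in> W\<close>
  proof (induction W rule: generate_topology_on.induct)
    case (Int a b)
    then show ?case by (auto intro: eventually_conj)
  next
    case (UN K)
    then obtain k where "k \<in> K" "f \<in> k" by blast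
    then have "\<forall>\<^sub>F N in sequentially. g N \<in> k" by (rule UN.IH)
    then show ?case using \<open>k \<in> K\<close> by (auto elim: eventually_mono)
  next
    case (Basis W)
    then obtain h k bs e where W: "W = {g \<in> schwartz. schwartz_seminorm k bs (\<lambda>x. g x - h x) < e}"
      and h: "h \<in> schwartz" and bs: "bs \<in> lists Basis" by blast
    let ?p = "\<lambda>f x. norm x ^ k * cmod (iter_partial bs f x)"
    have diff: "iter_partial bs (\<lambda>x. a x - c x) = (\<lambda>x. iter_partial bs a x - iter_partial bs c x)"
      if "a \<in> schwartz" "c \<in> schwartz" for a c
      using that bs by (intro iter_partial_diff schwartz_smooth)
    have fh: "schwartz_seminorm k bs (\<lambda>x. f x - h x) < e" using Basis(2) W by simp
    have le: "?p (\<lambda>x. f x - h x) x \<le> schwartz_seminorm k bs (\<lambda>x. f x - h x)" for x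
      unfolding schwartz_seminorm_def
    proof (rule cSUP_upper)
      have "bdd_above (range (?p f))" "bdd_above (range (?p h))"
        using \<open>f \<in> schwartz\<close> h bs by (simp_all add: schwartz_def)
      then obtain A B where AB: "\<And>x. ?p f x \<le> A" "\<And>x. ?p h x \<le> B" by (auto simp: bdd_above_def)
      have "?p (\<lambda>x. f x - h x) x \<le> A + B" for x
      proof -
        have "?p (\<lambda>x. f x - h x) x \<le> norm x ^ k * (cmod (iter_partial bs f x) + cmod (iter_partial bs h x))"
          unfolding diff[OF \<open>f \<in> schwartz\<close> h] by (intro mult_left_mono norm_triangle_ineq4) auto
        also have "\<dots> \<le> A + B" using AB[of x] by (simp add: distrib_left)
        finally show ?thesis .
      qed
      then show "bdd_above (range (?p (\<lambda>x. f x - h x)))" by (auto simp: bdd_above_def)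
    qed simp
    obtain \<delta> where \<delta>: "\<delta> \<longlonglongrightarrow> 0" "\<And>N x. ?p (\<lambda>x. g N x - f x) x \<le> \<delta> N"
      using small[OF bs, of k] by blast
    have "\<forall>\<^sub>F N in sequentially. \<delta> N < e - schwartz_seminorm k bs (\<lambda>x. f x - h x)"
      using \<delta>(1) fh by (intro order_tendstoD) auto
    then show ?case
    proof eventually_elim
      case (elim N)
      have "schwartz_seminorm k bs (\<lambda>x. g N x - h x) \<le> \<delta> N + schwartz_seminorm k bs (\<lambda>x. f x - h x)"
        unfolding schwartz_seminorm_def[of k bs "\<lambda>x. g N x - h x"]
      proof (rule cSUP_least)
        fix x
        have "?p (\<lambda>x. g N x - h x) x \<le> norm x ^ k * (cmod (iter_partial bs (\<lambda>x. g N x - f x) x)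
            + cmod (iter_partial bs (\<lambda>x. f x - h x) x))"
          unfolding diff[OF g h] diff[OF g \<open>f \<in> schwartz\<close>] diff[OF \<open>f \<in> schwartz\<close> h]
          by (intro mult_left_mono) (use norm_triangle_ineq[of "iter_partial bs (g N) x - iter_partial bs f x"
              "iter_partial bs f x - iter_partial bs h x"] in auto)
        also have "\<dots> \<le> \<delta> N + schwartz_seminorm k bs (\<lambda>x. f x - h x)"
          using \<delta>(2)[of x N] le[of x] by (simp add: distrib_left)
        finally show "?p (\<lambda>x. g N x - h x) x \<le> \<delta> N + schwartz_seminorm k bs (\<lambda>x. f x - h x)" .
      qed simp
      with elim g show ?case by (simp add: W)
    qed
  qed simp
qed

lemma tempered_distribution_cutoff_tendsto:
  assumes u: "u \<in> tempered_distribution" and f: "f \<in> schwartz"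
  shows "(\<lambda>N. u (\<lambda>x. f x * complex_of_real (cutoff N x))) \<longlonglongrightarrow> u f"
proof (rule topological_tendstoI)
  fix V :: "complex set" assume V: "open V" "u f \<in> V"
  let ?W = "{g \<in> schwartz. u g \<in> V}"
  let ?g = "\<lambda>N x. f x * complex_of_real (cutoff N x)"
  have "openin schwartz_topology ?W"
    using u V openin_continuous_map_preimage[of schwartz_topology euclidean u V]
    by (simp add: tempered_distribution_def topspace_schwartz_topology open_openin[symmetric])
  then have "\<forall>\<^sub>F N in sequentially. ?g N \<in> ?W"
  proof (rule eventually_in_schwartz_open)
    fix k and bs :: "'a list" assume bs: "bs \<in> lists Basis"
    have err: "(\<lambda>x. ?g N x - f x) = (\<lambda>x. f x * complex_of_real (cutoff N x - 1))" for N
      by (simp add: algebra_simps)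
    have "\<exists>H\<in>cutoff_errors. \<forall>N. \<forall>x\<in>UNIV. iter_partial bs (\<lambda>x. f x * complex_of_real (cutoff N x - 1)) x = H N x
        \<and> iter_partial bs (\<lambda>x. f x * complex_of_real (cutoff N x - 1)) differentiable at x"
      by (rule iter_partial_in_closed_family[OF open_UNIV, of cutoff_errors
            "\<lambda>N x. f x * complex_of_real (cutoff N x - 1)"])
        (use bs f cutoff_errors.undifferentiated cutoff_errors_differentiable cutoff_errors_closed in blast)+
    then obtain H where H: "H \<in> cutoff_errors" "\<And>N x. iter_partial bs (\<lambda>x. ?g N x - f x) x = H N x"
      unfolding err by blast
    from cutoff_errors_decay[OF H(1), of k] obtain C where
      C: "\<And>N x. norm x ^ k * cmod (H N x) \<le> C / real (Suc N)" by blast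
    have "(\<lambda>N. C * inverse (real (Suc N))) \<longlonglongrightarrow> C * 0"
      by (intro tendsto_intros LIMSEQ_inverse_real_of_nat)
    then show "\<exists>\<delta>. \<delta> \<longlonglongrightarrow> 0 \<and> (\<forall>N x. norm x ^ k * cmod (iter_partial bs (\<lambda>x. ?g N x - f x) x) \<le> \<delta> N)"
      using C unfolding H(2) by (intro exI[of _ "\<lambda>N. C / real (Suc N)"]) (simp add: divide_inverse)
  qed (use V f cutoff_mult_in_schwartz in auto)
  then show "\<forall>\<^sub>F N in sequentially. u (?g N) \<in> V" by (rule eventually_mono) simp
qed

section \<open>Off-diagonal test functions from disjoint supports\<close>

lemma smooth_on_norm_diff_powr:
  fixes e :: real
  defines "U \<equiv> {w :: 'a::euclidean_space \<times> 'a. fst w \<noteq> snd w}"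
  shows "open U" "smooth_on U (\<lambda>w. complex_of_real (norm (fst w - snd w) powr e))"
proof -
  have "U = - {w. fst w = snd w}" by (auto simp: U_def)
  moreover have "closed {w :: 'a \<times> 'a. fst w = snd w}"
    by (intro closed_Collect_eq continuous_intros)
  ultimately show U: "open U" by (simp add: open_Compl)
  let ?v = "\<lambda>w :: 'a \<times> 'a. (fst w - snd w) \<bullet> (fst w - snd w)"
  have "smooth_on U (\<lambda>w. \<Sum>i\<in>Basis. complex_of_real ((fst w - snd w) \<bullet> i) * complex_of_real ((fst w - snd w) \<bullet> i))"
    by (intro smooth_on_sum smooth_on_mult U smooth_on_bounded_linear
        bounded_linear_compose[OF bounded_linear_of_real]
        bounded_linear_compose[OF bounded_linear_inner_left]
        bounded_linear_sub bounded_linear_fst bounded_linear_snd)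
  also have "(\<lambda>w :: 'a \<times> 'a. \<Sum>i\<in>Basis. complex_of_real ((fst w - snd w) \<bullet> i) * complex_of_real ((fst w - snd w) \<bullet> i))
      = (\<lambda>w. complex_of_real (?v w))"
    by (rule ext, subst euclidean_inner) simp
  finally have "smooth_on U (\<lambda>w. complex_of_real ((\<lambda>t. 1 * t powr (e / 2)) (?v w)))"
  proof (rule smooth_on_compose_real[OF U, where T = "{0<..}" and \<Psi> = "{\<lambda>t. c * t powr a | c a. True}"])
    fix \<psi> :: "real \<Rightarrow> real" assume "\<psi> \<in> {\<lambda>t. c * t powr a | c a. True}"
    then obtain c a where \<psi>: "\<psi> = (\<lambda>t. c * t powr a)" by blast
    have "(\<psi> has_field_derivative c * a * t powr (a - 1)) (at t)" if "t > 0" for t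
      unfolding \<psi> using that by (auto intro!: derivative_eq_intros)
    then show "\<exists>\<psi>'\<in>{\<lambda>t. c * t powr a | c a. True}. \<forall>t\<in>{0<..}. (\<psi> has_real_derivative \<psi>' t) (at t)"
      by (intro bexI[of _ "\<lambda>t. (c * a) * t powr (a - 1)"]) auto
  next
    show "(\<lambda>t. 1 * t powr (e / 2)) \<in> {\<lambda>t. c * t powr a | c a. True}" by blast
  qed (auto simp: U_def)
  moreover have "1 * ?v w powr (e / 2) = norm (fst w - snd w) powr e" for w
  proof -
    have "?v w = norm (fst w - snd w) powr 2"
      by (cases "fst w = snd w") (simp_all add: powr_numeral power2_norm_eq_inner)
    then show ?thesis by (simp only: powr_powr mult_1) simp
  qed
  ultimately show "smooth_on U (\<lambda>w. complex_of_real (norm (fst w - snd w) powr e))" by simp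
qed

text \<open>
  The weight cancels the kernel of the fractional divergence, so that \<open>frac_div_od_test\<close> is an exact formula.
\<close>

definition od_test ::
  "real \<Rightarrow> (real ^ 'n \<Rightarrow> complex) \<Rightarrow> (real ^ 'n \<Rightarrow> complex) \<Rightarrow> (real ^ 'n) \<times> (real ^ 'n) \<Rightarrow> complex" where
  "od_test s \<eta> \<theta> w = complex_of_real (norm (fst w - snd w) powr (s + real CARD('n)))
     * (\<eta> (fst w) * \<theta> (snd w) - \<eta> (snd w) * \<theta> (fst w)) / 2"

text \<open>
  The plane off the diagonal, where the weight is smooth, and the complement of \<open>K \<times> L \<union> L \<times> K\<close>, where the function
  vanishes, are open and cover everything; the second contains the diagonal.
\<close>

lemma od_test_in_schwartz_od:
  fixes \<eta> \<theta> :: "real ^ 'n \<Rightarrow> complex"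
  assumes "smooth \<eta>" "smooth \<theta>" "compact K" "compact L" "K \<inter> L = {}"
    and \<eta>0: "\<And>x. x \<notin> K \<Longrightarrow> \<eta> x = 0" and \<theta>0: "\<And>x. x \<notin> L \<Longrightarrow> \<theta> x = 0"
  shows "od_test s \<eta> \<theta> \<in> schwartz_od"
proof -
  let ?G = "od_test s \<eta> \<theta>"
  let ?U = "{w :: (real ^ 'n) \<times> (real ^ 'n). fst w \<noteq> snd w}"
  let ?C = "K \<times> L \<union> L \<times> K"
  have C: "compact ?C" using assms by (intro compact_Un compact_Times)
  have zero: "?G w = 0" if "w \<notin> ?C" for w
    using that \<eta>0 \<theta>0 by (cases w) (auto simp: od_test_def)
  obtain i :: "real ^ 'n" where i: "i \<in> Basis" using nonempty_Basis by blast
  have fst: "smooth (\<lambda>w::(real ^ 'n) \<times> (real ^ 'n). \<zeta> (fst w))" if "smooth \<zeta>" for \<zeta>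
  proof (rule smooth_compose_linear[OF that bounded_linear_fst])
    fix b :: "(real ^ 'n) \<times> (real ^ 'n)" assume "b \<in> Basis"
    then have "fst b = 1 *\<^sub>R fst b \<and> fst b \<in> Basis \<or> fst b = 0 *\<^sub>R i" by (auto simp: Basis_prod_def)
    then show "\<exists>c. \<exists>b'\<in>Basis. fst b = c *\<^sub>R b'" using i by metis
  qed
  have snd: "smooth (\<lambda>w::(real ^ 'n) \<times> (real ^ 'n). \<zeta> (snd w))" if "smooth \<zeta>" for \<zeta>
  proof (rule smooth_compose_linear[OF that bounded_linear_snd])
    fix b :: "(real ^ 'n) \<times> (real ^ 'n)" assume "b \<in> Basis"
    then have "snd b = 1 *\<^sub>R snd b \<and> snd b \<in> Basis \<or> snd b = 0 *\<^sub>R i" by (auto simp: Basis_prod_def)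
    then show "\<exists>c. \<exists>b'\<in>Basis. snd b = c *\<^sub>R b'" using i by metis
  qed
  have "smooth_on ?U (\<lambda>w. complex_of_real (norm (fst w - snd w) powr (s + real CARD('n)))
     * (\<eta> (fst w) * \<theta> (snd w) + (- 1) * (\<eta> (snd w) * \<theta> (fst w))) * (1 / 2))"
    using fst snd assms
    by (intro smooth_on_mult smooth_on_add smooth_on_norm_diff_powr smooth_on_const
        smooth_on_subset[of UNIV _ ?U]) (auto simp: smooth_iff_smooth_on)
  then have "smooth_on ?U ?G"
    by (rule smooth_on_cong[OF smooth_on_norm_diff_powr(1)]) (simp add: od_test_def)
  moreover have "smooth_on (- ?C) ?G"
  proof -
    have "open (- ?C)" using compact_imp_closed[OF C] by (rule open_Compl)
    from smooth_on_cong[OF this smooth_on_const[OF this, of 0]] zero show ?thesis by (metis ComplD)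
  qed
  moreover have "?U \<union> - ?C = UNIV" using assms(5) by auto
  ultimately have "smooth ?G" using smooth_on_Un[of ?U ?G "- ?C"] by (simp add: smooth_iff_smooth_on)
  note sch = smooth_eq_0_outside_in_schwartz[OF this C zero]
  have "antisymmetric ?G" by (auto simp: antisymmetric_def od_test_def norm_minus_commute field_simps)
  moreover have "iter_partial bs ?G (z, z) = 0" if "bs \<in> lists Basis" for bs z
    using assms(5) by (intro sch(2) that) auto
  ultimately show ?thesis using sch(1) by (simp add: schwartz_od_def)
qed

lemma frac_div_od_test:
  fixes \<eta> \<theta> :: "real ^ 'n \<Rightarrow> complex"
  assumes "\<eta> \<in> schwartz" "\<theta> \<in> schwartz"
  shows "frac_div s (od_test s \<eta> \<theta>)
    = (\<lambda>x. (LINT z|lborel. \<theta> z) * \<eta> x + (- (LINT z|lborel. \<eta> z)) * \<theta> x)"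
proof
  fix x
  have "2 * od_test s \<eta> \<theta> (x, y) / complex_of_real (norm (x - y) powr s) / complex_of_real (norm (x - y) ^ CARD('n))
    = \<eta> x * \<theta> y - \<theta> x * \<eta> y" for y
    by (cases "x = y") (auto simp: od_test_def powr_add powr_realpow)
  then have "frac_div s (od_test s \<eta> \<theta>) x = (LINT y|lebesgue. \<eta> x * \<theta> y - \<theta> x * \<eta> y)"
    by (simp add: frac_div_def)
  also have "\<dots> = (LINT y|lborel. \<eta> x * \<theta> y - \<theta> x * \<eta> y)"
    using assms[THEN schwartz_borel_measurable] by (intro integral_completion) auto
  also have "\<dots> = \<eta> x * (LINT z|lborel. \<theta> z) - \<theta> x * (LINT z|lborel. \<eta> z)"
    using assms[THEN schwartz_integrable] by simp
  finally show "frac_div s (od_test s \<eta> \<theta>) x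
    = (LINT z|lborel. \<theta> z) * \<eta> x + (- (LINT z|lborel. \<eta> z)) * \<theta> x"
    by (simp add: mult.commute)
qed

lemma AE_lborel_swap:
  fixes P :: "'a::euclidean_space \<times> 'a \<Rightarrow> bool"
  assumes "AE w in lborel. P w"
  shows "AE w in lborel. P (snd w, fst w)"
proof -
  have "AE w in distr lborel lborel (\<lambda>(x, y). (y, x)). P w"
    using assms unfolding lborel_prod[symmetric]
    by (subst (asm) lborel_pair.distr_pair_swap) auto
  from AE_distrD[OF _ this] show ?thesis by (simp add: split_beta' lborel_prod[symmetric])
qed

text \<open>
  Antisymmetrising a Borel representative keeps both properties, because the swap of coordinates
  preserves null sets. Borel functions are what Fubini's theorem on the product needs.
\<close>

lemma antisymmetric_borel_representative:
  fixes F :: "'a::euclidean_space \<times> 'a \<Rightarrow> complex"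
  assumes F: "F \<in> borel_measurable lebesgue" "antisymmetric F"
  obtains F' where "F' \<in> borel_measurable borel" "antisymmetric F'" "AE w in lborel. F w = F' w"
proof -
  have "(\<lambda>w. Re (F w)) \<in> borel_measurable lebesgue" "(\<lambda>w. Im (F w)) \<in> borel_measurable lebesgue"
    using F(1) by measurable
  from this[THEN completion_ex_borel_measurable_real] obtain R I
    where R: "R \<in> borel_measurable lborel" "AE w in lborel. Re (F w) = R w"
      and I: "I \<in> borel_measurable lborel" "AE w in lborel. Im (F w) = I w"
    by blast
  define H where "H w = Complex (R w) (I w)" for w
  have H: "H \<in> borel_measurable borel"
    using R(1) I(1) unfolding H_def Complex_eq by measurable
  have FH: "AE w in lborel. F w = H w"
    using R(2) I(2) by eventually_elim (simp add: H_def complex_eq_iff)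
  define F' where "F' w = (H w - H (snd w, fst w)) / 2" for w
  show ?thesis
  proof (rule that)
    show "F' \<in> borel_measurable borel"
      using H unfolding F'_def borel_prod[symmetric] by measurable
    show "antisymmetric F'" by (auto simp: antisymmetric_def F'_def minus_divide_left)
    show "AE w in lborel. F w = F' w"
      using FH AE_lborel_swap[OF FH]
    proof eventually_elim
      case (elim w)
      have "F (fst w, snd w) = - F (snd w, fst w)"
        using F(2) unfolding antisymmetric_def by blast
      with elim show ?case by (simp add: F'_def)
    qed
  qed
qed

lemma fst_borel_measurable [measurable]:
    "(fst :: 'a::euclidean_space \<times> 'b::euclidean_space \<Rightarrow> 'a) \<in> borel_measurable borel"
  and snd_borel_measurable [measurable]:
    "(snd :: 'a::euclidean_space \<times> 'b::euclidean_space \<Rightarrow> 'b) \<in> borel_measurable borel"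
  by (intro borel_measurable_continuous_onI continuous_intros)+

text \<open>
  The measure \<open>dx dy / |x - y|^n\<close> is infinite near the diagonal, but the factor \<open>|x - y|^s\<close> compensates:
  \<open>|F| \<le> 1 + |F|^p\<close> reduces the claim to \<open>|x - y|^s\<close> on a bounded set and to the finite energy.
\<close>

lemma bounded_support_integrable:
  fixes F \<rho> :: "'a::euclidean_space \<times> 'a \<Rightarrow> complex"
  assumes "p \<ge> 1" "s > 0" and [measurable]: "F \<in> borel_measurable borel" "\<rho> \<in> borel_measurable borel"
    and P: "integrable lborel (\<lambda>w. cmod (F w) powr p / norm (fst w - snd w) ^ DIM('a))"
    and B: "\<And>w. cmod (\<rho> w) \<le> B" and "bounded S" and zero: "\<And>w. w \<notin> S \<Longrightarrow> \<rho> w = 0"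
  shows "integrable lborel (\<lambda>w. F w * complex_of_real (norm (fst w - snd w) powr s) * \<rho> w)"
proof -
  let ?d = "\<lambda>w :: 'a \<times> 'a. norm (fst w - snd w)"
  let ?P = "\<lambda>w. cmod (F w) powr p / ?d w ^ DIM('a)"
  obtain c where c: "S \<subseteq> cbox (- c) c" using bounded_subset_cbox_symmetric[OF \<open>bounded S\<close>] by blast
  obtain R where R: "\<And>w. w \<in> S \<Longrightarrow> norm w \<le> R" using \<open>bounded S\<close> by (auto simp: bounded_iff)
  define D where "D = 2 * max R 0"
  have D: "?d w \<le> D" if "w \<in> S" for w
  proof -
    have "?d w \<le> norm (fst w) + norm (snd w)" by (rule norm_triangle_ineq4)
    also have "\<dots> \<le> D"
      using R[OF that] norm_fst_le[of "fst w" "snd w"] norm_snd_le[of "snd w" "fst w"]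
      unfolding D_def prod.collapse by linarith
    finally show ?thesis .
  qed
  show ?thesis
  proof (rule Bochner_Integration.integrable_bound)
    have "integrable lborel (indicat_real (cbox (- c) c))"
      by (intro integrable_real_indicator) (use emeasure_lborel_cbox_finite[of "- c" c] in auto)
    then show "integrable lborel (\<lambda>w. B * (D powr s * indicat_real (cbox (- c) c) w + D powr (s + DIM('a)) * ?P w))"
      using P by (intro integrable_mult_right Bochner_Integration.integrable_add) auto
    show "(\<lambda>w. F w * complex_of_real (?d w powr s) * \<rho> w) \<in> borel_measurable lborel"
      by measurable
    show "AE w in lborel. norm (F w * complex_of_real (?d w powr s) * \<rho> w)
        \<le> norm (B * (D powr s * indicat_real (cbox (- c) c) w + D powr (s + DIM('a)) * ?P w))"
    proof (intro AE_I2)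
      fix w
      have "B \<ge> 0" using B[of w] norm_ge_zero order_trans by blast
      show "norm (F w * complex_of_real (?d w powr s) * \<rho> w)
        \<le> norm (B * (D powr s * indicat_real (cbox (- c) c) w + D powr (s + DIM('a)) * ?P w))"
      proof (cases "w \<in> S")
        case True
        have F1: "cmod (F w) \<le> 1 + cmod (F w) powr p"
        proof (cases "cmod (F w) \<le> 1")
          case False
          then have "cmod (F w) powr 1 \<le> cmod (F w) powr p" using \<open>p \<ge> 1\<close> by (intro powr_mono) auto
          then show ?thesis using False by simp
        qed (simp add: add_increasing2)
        have d: "?d w powr s = ?d w powr (s + DIM('a)) / ?d w ^ DIM('a)"
          by (cases "fst w = snd w") (auto simp: powr_add powr_realpow)
        have "cmod (F w) * ?d w powr s \<le> (1 + cmod (F w) powr p) * ?d w powr s"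
          by (intro mult_right_mono F1) auto
        also have "\<dots> = ?d w powr s + ?d w powr (s + DIM('a)) * ?P w"
          using d by (simp add: algebra_simps add_divide_distrib)
        also have "\<dots> \<le> D powr s + D powr (s + DIM('a)) * ?P w"
          using D[OF True] \<open>s > 0\<close> by (intro add_mono mult_right_mono powr_mono2) auto
        also have "\<dots> = D powr s * indicat_real (cbox (- c) c) w + D powr (s + DIM('a)) * ?P w"
          using c True by auto
        finally have "cmod (F w) * ?d w powr s * cmod (\<rho> w)
            \<le> (D powr s * indicat_real (cbox (- c) c) w + D powr (s + DIM('a)) * ?P w) * B"
          by (intro mult_mono B) auto
        then show ?thesis using \<open>B \<ge> 0\<close> by (simp add: norm_mult mult.commute)
      qed (simp add: zero)
    qed
  qed
qed

text \<open>
  The only place where the equation for the fractional gradient is used. Testing it with \<open>od_test s \<eta> \<theta>\<close>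
  gives \<open>u(\<eta>) \<integral>\<theta> - u(\<theta>) \<integral>\<eta>\<close> on one side; on the other, antisymmetry of \<open>F'\<close>
  makes the two halves of the test function contribute equally.
\<close>

lemma frac_grad_pairing:
  fixes F F' :: "(real ^ 'n) \<times> (real ^ 'n) \<Rightarrow> complex" and \<eta> \<theta> :: "real ^ 'n \<Rightarrow> complex"
  assumes u: "u \<in> tempered_distribution" and "p \<ge> 1" "s > 0"
    and F: "F \<in> Lp_od p" and grad: "\<And>G. G \<in> schwartz_od \<Longrightarrow> frac_grad s u G = od_distribution_of F G"
    and F' [measurable]: "F' \<in> borel_measurable borel" and "antisymmetric F'"
    and FF': "AE w in lborel. F w = F' w"
    and P: "integrable lborel (\<lambda>w. cmod (F' w) powr p / norm (fst w - snd w) ^ CARD('n))"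
    and smooth: "smooth \<eta>" "smooth \<theta>" and comp: "compact K" "compact L" and "K \<inter> L = {}"
    and \<eta>0: "\<And>x. x \<notin> K \<Longrightarrow> \<eta> x = 0" and \<theta>0: "\<And>x. x \<notin> L \<Longrightarrow> \<theta> x = 0"
  shows "u \<eta> * (LINT z|lborel. \<theta> z) - u \<theta> * (LINT z|lborel. \<eta> z)
    = (LINT w|lborel. F' w * complex_of_real (norm (fst w - snd w) powr s) * (\<eta> (fst w) * \<theta> (snd w)))"
proof -
  let ?G = "od_test s \<eta> \<theta>"
  let ?d = "\<lambda>w :: (real ^ 'n) \<times> (real ^ 'n). norm (fst w - snd w)"
  let ?H = "\<lambda>w. F' w * complex_of_real (?d w powr s) * (\<eta> (fst w) * \<theta> (snd w))"
  have \<eta>: "\<eta> \<in> schwartz" and \<theta>: "\<theta> \<in> schwartz"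
    using smooth_eq_0_outside_in_schwartz(1) smooth comp \<eta>0 \<theta>0 by blast+
  have [measurable]: "\<eta> \<in> borel_measurable borel" "\<theta> \<in> borel_measurable borel"
    using \<eta> \<theta> by (auto intro: schwartz_borel_measurable)
  have G: "?G \<in> schwartz_od"
    using od_test_in_schwartz_od[OF smooth comp \<open>K \<inter> L = {}\<close> \<eta>0 \<theta>0] by blast
  have Gm: "?G \<in> borel_measurable borel"
    using G by (auto simp: schwartz_od_def intro: schwartz_borel_measurable)
  have scale: "(\<lambda>x. c * f x) \<in> schwartz" if f: "f = \<eta> \<or> f = \<theta>" for c f
    using smooth_eq_0_outside_in_schwartz(1)[OF smooth_mult[OF smooth_const smooth(1)] comp(1)]
      smooth_eq_0_outside_in_schwartz(1)[OF smooth_mult[OF smooth_const smooth(2)] comp(2)]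
      \<eta>0 \<theta>0 f by auto
  have u_add: "u (\<lambda>x. f x + g x) = u f + u g" if "f \<in> schwartz" "g \<in> schwartz" for f g
    using u that by (simp add: tempered_distribution_def)
  have u_mult: "u (\<lambda>x. c * f x) = c * u f" if "f \<in> schwartz" for f c
    using u that by (simp add: tempered_distribution_def)
  have "frac_grad s u ?G = u \<eta> * (LINT z|lborel. \<theta> z) - u \<theta> * (LINT z|lborel. \<eta> z)"
    unfolding frac_grad_def frac_div_od_test[OF \<eta> \<theta>] u_add[OF scale scale, OF disjI1 disjI2, OF refl refl]
      u_mult[OF \<eta>] u_mult[OF \<theta>] by (simp add: mult.commute)
  moreover have "frac_grad s u ?G = od_distribution_of F ?G" by (rule grad[OF G])
  moreover have "od_distribution_of F ?G = (LINT w|lborel. ?H w)"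
  proof -
    obtain A where A: "\<And>x. cmod (\<eta> x) \<le> A" using schwartz_decay[OF \<eta>, of 0] by auto
    obtain B where B: "\<And>x. cmod (\<theta> x) \<le> B" using schwartz_decay[OF \<theta>, of 0] by auto
    have H: "integrable lborel ?H"
    proof (rule bounded_support_integrable[OF \<open>p \<ge> 1\<close> \<open>s > 0\<close> F'])
      show "(\<lambda>w. \<eta> (fst w) * \<theta> (snd w)) \<in> borel_measurable borel"
        by measurable
      show "cmod (\<eta> (fst w) * \<theta> (snd w)) \<le> A * B" for w
        unfolding norm_mult using A B by (intro mult_mono) (auto intro: order_trans[OF norm_ge_zero])
      show "bounded (K \<times> L)" using comp by (intro bounded_Times compact_imp_bounded)
      show "\<eta> (fst w) * \<theta> (snd w) = 0" if "w \<notin> K \<times> L" for w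
        using that \<eta>0[of "fst w"] \<theta>0[of "snd w"] by (auto simp: mem_Times_iff)
    qed (use P in auto)
    have Fm: "F \<in> borel_measurable lebesgue"
      using F by (simp add: Lp_od_def Lp_space_def od_measure_def)
    have dens: "(\<lambda>w. 1 / ?d w ^ CARD('n)) \<in> borel_measurable borel"
      by measurable
    have Gl: "?G \<in> borel_measurable lebesgue" and densl: "(\<lambda>w. 1 / ?d w ^ CARD('n)) \<in> borel_measurable lebesgue"
      using Gm dens by (auto intro: measurable_completion)
    have "od_distribution_of F ?G = (LINT w|lebesgue. (1 / ?d w ^ CARD('n)) *\<^sub>R (F w * ?G w))"
      unfolding od_distribution_of_def od_measure_def split_beta'
      by (rule integral_density) (use Fm Gl densl in auto)
    also have "\<dots> = (LINT w|lebesgue. (1 / ?d w ^ CARD('n)) *\<^sub>R (F' w * ?G w))"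
    proof (rule integral_cong_AE)
      show "AE w in lebesgue. (1 / ?d w ^ CARD('n)) *\<^sub>R (F w * ?G w) = (1 / ?d w ^ CARD('n)) *\<^sub>R (F' w * ?G w)"
        using AE_completion[OF FF'] by eventually_elim simp
      have F'l: "F' \<in> borel_measurable lebesgue" using F' by (auto intro: measurable_completion)
      show "(\<lambda>w. (1 / ?d w ^ CARD('n)) *\<^sub>R (F w * ?G w)) \<in> borel_measurable lebesgue"
        "(\<lambda>w. (1 / ?d w ^ CARD('n)) *\<^sub>R (F' w * ?G w)) \<in> borel_measurable lebesgue"
        by (intro borel_measurable_scaleR borel_measurable_times Fm F'l Gl densl)+
    qed
    also have "\<dots> = (LINT w|lborel. (1 / ?d w ^ CARD('n)) *\<^sub>R (F' w * ?G w))"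
      by (rule integral_completion) (use F' Gm dens in auto)
    also have "\<dots> = (LINT w|lborel. (?H w + ?H (snd w, fst w)) / 2)"
    proof (rule Bochner_Integration.integral_cong[OF refl])
      fix w :: "(real ^ 'n) \<times> (real ^ 'n)"
      have *: "F' (snd w, fst w) = - F' w"
        using \<open>antisymmetric F'\<close> unfolding antisymmetric_def by (metis prod.collapse)
      show "(1 / ?d w ^ CARD('n)) *\<^sub>R (F' w * ?G w) = (?H w + ?H (snd w, fst w)) / 2"
        by (cases "fst w = snd w")
          (auto simp: od_test_def * norm_minus_commute powr_add powr_realpow scaleR_conv_of_real field_simps)
    qed
    also have "\<dots> = ((LINT w|lborel. ?H w) + (LINT w|lborel. ?H (snd w, fst w))) / 2"
    proof -
      have "integrable (lborel \<Otimes>\<^sub>M lborel) ?H" using H by (simp add: lborel_prod)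
      from lborel_pair.integrable_product_swap[OF this] have "integrable lborel (\<lambda>w. ?H (snd w, fst w))"
        by (simp add: lborel_prod split_beta')
      then show ?thesis using H by simp
    qed
    also have "(LINT w|lborel. ?H (snd w, fst w)) = (LINT w|lborel. ?H w)"
    proof -
      have "?H \<in> borel_measurable (lborel \<Otimes>\<^sub>M lborel)"
        using borel_measurable_integrable[OF H] by (simp only: lborel_prod)
      from lborel_pair.integral_product_swap[OF this] show ?thesis
        by (simp add: lborel_prod split_beta')
    qed
    finally show ?thesis by simp
  qed
  ultimately show ?thesis by simp
qed

section \<open>Scalar estimates\<close>

text \<open>
  Jensen's inequality up to a factor 2, in a form that only asks for majorants. For every \<open>\<epsilon>\<close> the elementary
  \<open>t \<le> \<epsilon> + \<epsilon>^(1-p) t^p\<close> can be integrated against \<open>\<rho>\<close>; then \<open>\<epsilon>\<close> is chosen to balance the two terms.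
\<close>

lemma weighted_mean_bound:
  fixes h :: "'b \<Rightarrow> complex"
  assumes p: "p \<ge> 1" and h: "h \<in> borel_measurable M"
    and \<rho>: "integrable M \<rho>" "(LINT x|M. \<rho> x) = 1" "\<And>x. 0 \<le> \<rho> x"
    and T: "\<And>x. 0 \<le> T x" "\<And>x. cmod (h x) \<le> T x * \<rho> x"
    and Q: "integrable M Q" "\<And>x. \<rho> x * T x powr p \<le> Q x"
  shows "cmod (LINT x|M. h x) \<le> 2 * (LINT x|M. Q x) powr (1 / p)"
proof -
  let ?A = "LINT x|M. Q x"
  have bound: "cmod (LINT x|M. h x) \<le> \<epsilon> + \<epsilon> powr (1 - p) * ?A" if "\<epsilon> > 0" for \<epsilon>
  proof -
    have young: "t \<le> \<epsilon> + \<epsilon> powr (1 - p) * t powr p" if "t \<ge> 0" for t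
    proof (cases "t \<le> \<epsilon>")
      case False
      have "t = t powr (1 - p) * t powr p" using False \<open>\<epsilon> > 0\<close> by (simp flip: powr_add)
      also have "\<dots> \<le> \<epsilon> powr (1 - p) * t powr p"
        using False \<open>\<epsilon> > 0\<close> p by (intro mult_right_mono powr_mono2') auto
      finally show ?thesis using \<open>\<epsilon> > 0\<close> by simp
    qed (simp add: add_increasing2)
    have hb: "cmod (h x) \<le> \<epsilon> * \<rho> x + \<epsilon> powr (1 - p) * Q x" for x
    proof -
      have "cmod (h x) \<le> T x * \<rho> x" by (rule T)
      also have "\<dots> \<le> (\<epsilon> + \<epsilon> powr (1 - p) * T x powr p) * \<rho> x"
        by (intro mult_right_mono young T \<rho>)
      also have "\<dots> = \<epsilon> * \<rho> x + \<epsilon> powr (1 - p) * (\<rho> x * T x powr p)" by (simp add: algebra_simps)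
      also have "\<dots> \<le> \<epsilon> * \<rho> x + \<epsilon> powr (1 - p) * Q x"
        by (intro add_left_mono mult_left_mono Q) auto
      finally show ?thesis .
    qed
    have int: "integrable M (\<lambda>x. \<epsilon> * \<rho> x + \<epsilon> powr (1 - p) * Q x)" using \<rho> Q by auto
    have "integrable M h"
      by (rule Bochner_Integration.integrable_bound[OF int h])
        (use hb in \<open>auto intro: order_trans[OF _ abs_ge_self]\<close>)
    have "cmod (LINT x|M. h x) \<le> (LINT x|M. cmod (h x))" by (rule integral_norm_bound)
    also have "\<dots> \<le> (LINT x|M. \<epsilon> * \<rho> x + \<epsilon> powr (1 - p) * Q x)"
      using int hb \<open>integrable M h\<close> by (intro integral_mono) auto
    also have "\<dots> = \<epsilon> + \<epsilon> powr (1 - p) * ?A" using \<rho> Q by simp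
    finally show ?thesis .
  qed
  have "?A \<ge> 0"
    using Q(2) \<rho>(3) by (intro integral_nonneg_AE AE_I2) (meson order_trans mult_nonneg_nonneg powr_ge_zero)
  show ?thesis
  proof (cases "?A = 0")
    case True
    then have "cmod (LINT x|M. h x) \<le> 0 + \<epsilon>" if "\<epsilon> > 0" for \<epsilon> using bound[OF that] by simp
    then have "cmod (LINT x|M. h x) \<le> 0" by (rule field_le_epsilon)
    then show ?thesis by simp
  next
    case False
    then have "?A > 0" using \<open>?A \<ge> 0\<close> by simp
    have "(?A powr (1 / p)) powr (1 - p) * ?A = ?A powr ((1 / p) * (1 - p) + 1)"
      using \<open>?A > 0\<close> by (simp add: powr_powr powr_add)
    also have "(1 / p) * (1 - p) + 1 = 1 / p" using p by (simp add: field_simps)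
    finally show ?thesis using bound[of "?A powr (1 / p)"] \<open>?A > 0\<close> by simp
  qed
qed

text \<open>
  The two terms balance at the scale \<open>t = (N/g)^(1/(s+\<delta>))\<close>. Rounding \<open>t\<close> down to a power of 4 spoils the decreasing term by
  the factor \<open>4^\<delta>\<close> at most. If \<open>g\<close> or \<open>N\<close> vanishes there is no balance, but one of the limits \<open>k \<rightarrow> \<infinity>\<close> and \<open>k \<rightarrow> -\<infinity>\<close>
  forces \<open>f = 0\<close>.
\<close>

lemma optimise_over_dyadic_scales:
  fixes f g N s \<delta> A :: real
  assumes nonneg: "0 \<le> f" "0 \<le> g" "0 \<le> N" "0 \<le> A" and "s > 0" "\<delta> > 0"
    and bound: "\<And>k::int. f \<le> A * ((4 powr k) powr s * g + (4 powr k) powr (- \<delta>) * N)"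
  shows "f \<le> A * (1 + 4 powr \<delta>) * (g powr (\<delta> / (s + \<delta>)) * N powr (s / (s + \<delta>)))"
proof -
  have geometric: "(\<lambda>j. A * ((4 powr (- e)) ^ j * c)) \<longlonglongrightarrow> A * (0 * c)" if "e > 0" for e c :: real
    using that by (intro tendsto_intros LIMSEQ_power_zero) (simp add: powr_less_one)
  consider "g = 0" | "N = 0" | "g > 0" "N > 0" using nonneg by linarith
  then show ?thesis
  proof cases
    case 1
    have "f \<le> A * ((4 powr (- \<delta>)) ^ j * N)" for j :: nat
      using bound[of "int j"] 1 by (simp add: powr_powr mult.commute flip: powr_realpow)
    from LIMSEQ_le_const[OF geometric[OF \<open>\<delta> > 0\<close>, of N]] this have "f \<le> 0" by auto
    then show ?thesis using 1 by simp
  next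
    case 2
    have "f \<le> A * ((4 powr (- s)) ^ j * g)" for j :: nat
      using bound[of "- int j"] 2 by (simp add: powr_powr mult.commute flip: powr_realpow)
    from LIMSEQ_le_const[OF geometric[OF \<open>s > 0\<close>, of g]] this have "f \<le> 0" by auto
    then show ?thesis using 2 by simp
  next
    case 3
    define t where "t = (N / g) powr (1 / (s + \<delta>))"
    have t: "t > 0" using 3 by (simp add: t_def)
    define k where "k = \<lfloor>log 4 t\<rfloor>"
    have "4 powr k \<le> 4 powr log 4 t" unfolding k_def by (intro powr_mono) auto
    then have upper: "4 powr k \<le> t" using t by simp
    have "4 powr log 4 t \<le> 4 powr (k + 1)" unfolding k_def by (intro powr_mono) linarith+
    then have lower: "t / 4 \<le> 4 powr k" using t by (simp add: powr_add)
    have tg: "t powr s * g = g powr (\<delta> / (s + \<delta>)) * N powr (s / (s + \<delta>))"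
    proof -
      have "t powr s * g = N powr (s / (s + \<delta>)) / g powr (s / (s + \<delta>)) * g powr 1"
        using 3 by (simp add: t_def powr_powr powr_divide)
      also have "\<dots> = N powr (s / (s + \<delta>)) * g powr (1 - s / (s + \<delta>))"
        using 3 by (simp add: powr_diff)
      also have "1 - s / (s + \<delta>) = \<delta> / (s + \<delta>)" using assms by (simp add: field_simps)
      finally show ?thesis by simp
    qed
    have tN: "t powr (- \<delta>) * N = t powr s * g"
    proof -
      have "t powr (s + \<delta>) = N / g" using 3 assms by (simp add: t_def powr_powr)
      then have "N = t powr (s + \<delta>) * g" using 3 by simp
      also have "t powr (- \<delta>) * \<dots> = t powr (- \<delta> + (s + \<delta>)) * g"
        by (simp only: powr_add mult.assoc)
      finally show ?thesis by simp
    qed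
    have "f \<le> A * ((4 powr k) powr s * g + (4 powr k) powr (- \<delta>) * N)" by (rule bound)
    also have "\<dots> \<le> A * (t powr s * g + (t / 4) powr (- \<delta>) * N)"
      using upper lower t nonneg assms
      by (intro mult_left_mono add_mono mult_right_mono powr_mono2 powr_mono2') auto
    also have "(t / 4) powr (- \<delta>) * N = 4 powr \<delta> * (t powr (- \<delta>) * N)"
      using t by (simp add: powr_divide powr_minus field_simps)
    finally show ?thesis unfolding tN tg by (simp add: algebra_simps)
  qed
qed

lemma geometric_increments_limit:
  fixes t :: "nat \<Rightarrow> complex"
  assumes "0 \<le> \<rho>" "\<rho> < 1" and step: "\<And>j. cmod (t j - t (Suc j)) \<le> c * \<rho> ^ j"
  obtains L where "t \<longlonglongrightarrow> L" "cmod (t 0 - L) \<le> c / (1 - \<rho>)"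
proof -
  have geo: "(\<lambda>j. c * \<rho> ^ j) sums (c * (1 / (1 - \<rho>)))"
    using assms(1,2) by (intro sums_mult geometric_sums) simp
  have summ: "summable (\<lambda>j. cmod (t j - t (Suc j)))"
    by (rule summable_comparison_test'[OF sums_summable[OF geo]]) (use step in simp)
  then have "summable (\<lambda>j. t j - t (Suc j))" by (rule summable_norm_cancel)
  then have "(\<lambda>n. \<Sum>j<n. t j - t (Suc j)) \<longlonglongrightarrow> (\<Sum>j. t j - t (Suc j))" by (rule summable_LIMSEQ)
  then have "(\<lambda>n. t 0 - t n) \<longlonglongrightarrow> (\<Sum>j. t j - t (Suc j))" by (simp add: sum_lessThan_telescope')
  then have "(\<lambda>n. t 0 - (t 0 - t n)) \<longlonglongrightarrow> t 0 - (\<Sum>j. t j - t (Suc j))"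
    by (intro tendsto_diff tendsto_const)
  then have lim: "t \<longlonglongrightarrow> t 0 - (\<Sum>j. t j - t (Suc j))" by simp
  have "cmod (\<Sum>j. t j - t (Suc j)) \<le> (\<Sum>j. cmod (t j - t (Suc j)))" by (rule summable_norm[OF summ])
  also have "\<dots> \<le> (\<Sum>j. c * \<rho> ^ j)" by (rule suminf_le[OF step summ sums_summable[OF geo]])
  also have "\<dots> = c / (1 - \<rho>)" using sums_unique[OF geo] by simp
  finally show ?thesis using that[OF lim] by simp
qed

section \<open>Probes at all scales\<close>

definition unit_mass :: "'a::euclidean_space itself \<Rightarrow> real" where
  "unit_mass _ = (LINT x|lborel. bump 1 (2 *\<^sub>R One) (4 *\<^sub>R One) (x::'a))"

text \<open>
  The cell has side \<open>2 r\<close> and is shifted away from its base point \<open>a\<close> by \<open>2 r\<close> in every coordinate. Hence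
  it does not meet the ball of radius \<open>r\<close> around \<open>a\<close>, and a cell of scale \<open>4 r\<close> with a base point within distance
  \<open>r\<close> of \<open>a\<close> is disjoint from it.
\<close>

definition cell :: "'a::euclidean_space \<Rightarrow> real \<Rightarrow> 'a set" where
  "cell a r = cbox (a + (2 * r) *\<^sub>R One) (a + (4 * r) *\<^sub>R One)"

definition probe :: "'a::euclidean_space \<Rightarrow> real \<Rightarrow> 'a \<Rightarrow> real" where
  "probe a r x = bump (1 / r) (a + (2 * r) *\<^sub>R One) (a + (4 * r) *\<^sub>R One) x
     / (r ^ DIM('a) * unit_mass TYPE('a))"

lemma integrable_bump: "m > 0 \<Longrightarrow> integrable lborel (bump m a b)"
proof -
  assume "m > 0"
  moreover have "set_integrable lborel (cbox a b) (\<lambda>_. 1 :: complex)"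
    unfolding set_integrable_def using emeasure_lborel_cbox_finite[of a b]
    by (intro integrable_scaleR_left integrable_real_indicator) auto
  ultimately have "integrable lborel (\<lambda>x. complex_of_real (bump m a b x))"
    using set_integrable_imp_integrable_bump[of m a b "\<lambda>_. 1"] by simp
  then show ?thesis by (simp add: complex_of_real_integrable_eq)
qed

lemma unit_mass_pos: "unit_mass TYPE('a::euclidean_space) > 0"
proof -
  let ?b = "bump 1 (2 *\<^sub>R One) (4 *\<^sub>R One) :: 'a \<Rightarrow> real"
  have "unit_mass TYPE('a) \<ge> 0" by (simp add: unit_mass_def bump_nonneg)
  moreover have "unit_mass TYPE('a) \<noteq> 0"
  proof
    assume "unit_mass TYPE('a) = 0"
    then have "AE x in lborel. ?b x = 0"
      unfolding unit_mass_def by (subst (asm) integral_nonneg_eq_0_iff_AE) (auto simp: integrable_bump bump_nonneg)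
    then have "AE x in lborel. x \<notin> (box (2 *\<^sub>R One) (4 *\<^sub>R One) :: 'a set)"
      by eventually_elim (use bump_pos[of 1 _ "2 *\<^sub>R One :: 'a" "4 *\<^sub>R One"] in force)
    then have "emeasure lborel (box (2 *\<^sub>R One) (4 *\<^sub>R One) :: 'a set) = 0"
      by (subst (asm) AE_iff_measurable[OF _ refl]) auto
    then show False by (simp add: emeasure_lborel_box_eq algebra_simps prod_constant)
  qed
  ultimately show ?thesis by simp
qed

lemma bump_rescale:
  fixes a :: "'a::euclidean_space"
  assumes "r > 0"
  shows "bump (1 / r) (a + (2 * r) *\<^sub>R One) (a + (4 * r) *\<^sub>R One) (a + r *\<^sub>R x)
    = bump 1 (2 *\<^sub>R One) (4 *\<^sub>R One) x"
proof -
  have "1 / r * ((a + r *\<^sub>R x - (a + (2 * r) *\<^sub>R One)) \<bullet> i) = 1 * ((x - 2 *\<^sub>R One) \<bullet> i)"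
    "1 / r * ((a + (4 * r) *\<^sub>R One - (a + r *\<^sub>R x)) \<bullet> i) = 1 * ((4 *\<^sub>R One - x) \<bullet> i)" for i
    using assms by (simp_all add: inner_diff_left inner_add_left field_simps)
  then show ?thesis by (simp only: bump_def)
qed

lemma integral_probe:
  fixes a :: "'a::euclidean_space"
  assumes r: "r > 0"
  shows "(LINT x|lborel. probe a r x) = 1" "integrable lborel (probe a r)"
proof -
  let ?b = "bump (1 / r) (a + (2 * r) *\<^sub>R One) (a + (4 * r) *\<^sub>R One)"
  have "(LINT x|lborel. ?b x) = (LINT x|density (distr lborel borel (\<lambda>x. a + r *\<^sub>R x)) (\<lambda>_. ennreal (\<bar>r\<bar> ^ DIM('a))). ?b x)"
    using lborel_affine[of r a] r by (simp add: ennreal_power)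
  also have "\<dots> = (LINT x|lborel. r ^ DIM('a) * ?b (a + r *\<^sub>R x))"
    using r by (simp add: integral_density integral_distr)
  also have "\<dots> = r ^ DIM('a) * unit_mass TYPE('a)"
    using r by (simp add: bump_rescale unit_mass_def)
  finally show "(LINT x|lborel. probe a r x) = 1"
    using r unit_mass_pos[where ?'a='a] by (simp add: probe_def)
  show "integrable lborel (probe a r)"
    unfolding probe_def using r by (intro integrable_divide integrable_bump) simp
qed

lemma probe_nonneg: "r > 0 \<Longrightarrow> 0 \<le> probe a r x"
  and probe_le: "r > 0 \<Longrightarrow> probe a r (x::'a::euclidean_space) \<le> 1 / (r ^ DIM('a) * unit_mass TYPE('a))"
  unfolding probe_def using unit_mass_pos[where ?'a='a]
  by (auto intro!: divide_nonneg_pos divide_right_mono bump_nonneg bump_le_1)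

lemma probe_eq_0: "r > 0 \<Longrightarrow> x \<notin> cell a r \<Longrightarrow> probe a r x = 0"
  using bump_eq_0[of "1 / r" x] box_subset_cbox[of "a + (2 * r) *\<^sub>R One" "a + (4 * r) *\<^sub>R One"]
  by (auto simp: probe_def cell_def)

lemma probe_borel_measurable [measurable]: "probe a r \<in> borel_measurable borel"
  unfolding probe_def by measurable

lemma smooth_probe: "smooth (\<lambda>x. complex_of_real (probe a r x))"
  unfolding probe_def using smooth_mult[OF smooth_bump smooth_const, of "1 / r" "a + (2 * r) *\<^sub>R One"
      "a + (4 * r) *\<^sub>R One" "1 / complex_of_real (r ^ DIM('a) * unit_mass TYPE('a))" for a :: 'a]
  by simp

lemma compact_cell: "compact (cell a r)"
  by (simp add: cell_def compact_cbox)

lemma cellD: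
  assumes "x \<in> cell a r" "i \<in> Basis"
  shows "2 * r \<le> (x - a) \<bullet> i" "(x - a) \<bullet> i \<le> 4 * r"
  using assms by (auto simp: cell_def mem_box inner_diff_left inner_add_left algebra_simps)

lemma cell_dist:
  fixes a :: "'a::euclidean_space"
  assumes "x \<in> cell a r" "r > 0"
  shows "norm (x - a) \<le> 4 * r * DIM('a)" "norm (x - a) \<ge> 2 * r"
proof -
  have abs: "\<bar>(x - a) \<bullet> i\<bar> \<le> 4 * r" "2 * r \<le> \<bar>(x - a) \<bullet> i\<bar>" if "i \<in> Basis" for i
    using cellD[OF assms(1) that] assms(2) by auto
  have "norm (x - a) \<le> (\<Sum>i\<in>Basis. \<bar>(x - a) \<bullet> i\<bar>)" by (rule norm_le_l1)
  also have "\<dots> \<le> (\<Sum>i\<in>(Basis::'a set). 4 * r)" by (intro sum_mono abs)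
  finally show "norm (x - a) \<le> 4 * r * DIM('a)" by (simp add: mult_ac)
  obtain i :: 'a where i: "i \<in> Basis" using nonempty_Basis by blast
  show "norm (x - a) \<ge> 2 * r" using abs(2)[OF i] Basis_le_norm[OF i, of "x - a"] by simp
qed

lemma cells_disjoint:
  fixes a b :: "'a::euclidean_space"
  assumes "norm (a - b) \<le> r" "r > 0"
  shows "cell a r \<inter> cell b (4 * r) = {}"
proof -
  obtain i :: 'a where i: "i \<in> Basis" using nonempty_Basis by blast
  have "(x - b) \<bullet> i \<le> 5 * r" if "x \<in> cell a r" for x
    using cellD(2)[OF that i] Basis_le_norm[OF i, of "a - b"] assms(1) by (simp add: inner_diff_left)
  moreover have "8 * r \<le> (x - b) \<bullet> i" if "x \<in> cell b (4 * r)" for x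
    using cellD(1)[OF that i] by simp
  ultimately show ?thesis using assms(2) by force
qed

text \<open>
  A crude constant that serves both \<open>increment_mean_bound\<close> and \<open>average_diff_bound\<close>: up to powers of the scale \<open>r\<close>, the
  first factor bounds the height of a probe or of a product of two probes, and the points involved have distance
  at most \<open>21 n r\<close>. The 2 in front comes from \<open>weighted_mean_bound\<close>.
\<close>

definition mean_const :: "'a::euclidean_space itself \<Rightarrow> real \<Rightarrow> real \<Rightarrow> real" where
  "mean_const T s p = 2 * ((max 1 (1 / unit_mass T)) ^ 2 * (21 * real DIM('a)) powr (s * p + real DIM('a))) powr (1 / p)"

text \<open>
  The denominator sums the geometric series of scales, the last factor is the loss in \<open>optimise_over_dyadic_scales\<close>.
\<close>

definition sobolev_const :: "'a::euclidean_space itself \<Rightarrow> real \<Rightarrow> real \<Rightarrow> real" where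
  "sobolev_const T s p = mean_const T s p / (1 - 4 powr (- (real DIM('a) / p - s)))
     * (1 + 4 powr (real DIM('a) / p - s))"

lemma mean_const_pos: "0 < mean_const TYPE('a::euclidean_space) s p"
  by (auto simp: mean_const_def intro!: mult_pos_pos)

lemma sobolev_const_pos:
  assumes "p \<ge> 1" "s * p < real DIM('a::euclidean_space)"
  shows "0 < sobolev_const TYPE('a) s p"
proof -
  have "real DIM('a) / p - s > 0" using assms by (simp add: field_simps)
  then show ?thesis
    unfolding sobolev_const_def using mean_const_pos[where ?'a='a]
    by (intro mult_pos_pos divide_pos_pos add_pos_pos) (auto simp: powr_less_one)
qed

section \<open>Reconstruction of the distribution as a function\<close>

text \<open>
  What the rest of the argument uses of the fractional gradient is the pairing identity alone. The
  setting is an arbitrary Euclidean space with Borel measure.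
\<close>

locale gradient_pairing =
  fixes s p :: real and F :: "'a::euclidean_space \<times> 'a \<Rightarrow> complex" and u :: "('a \<Rightarrow> complex) \<Rightarrow> complex"
  assumes p: "p \<ge> 1" and s: "s > 0" and sp: "s * p < real DIM('a)"
    and F_measurable [measurable]: "F \<in> borel_measurable borel"
    and F_integrable: "integrable lborel (\<lambda>w. cmod (F w) powr p / norm (fst w - snd w) ^ DIM('a))"
    and pairing: "smooth \<eta> \<Longrightarrow> smooth \<theta> \<Longrightarrow> compact K \<Longrightarrow> compact L \<Longrightarrow> K \<inter> L = {} \<Longrightarrow>
      (\<And>x. x \<notin> K \<Longrightarrow> \<eta> x = 0) \<Longrightarrow> (\<And>x. x \<notin> L \<Longrightarrow> \<theta> x = 0) \<Longrightarrow>
      u \<eta> * (LINT z|lborel. \<theta> z) - u \<theta> * (LINT z|lborel. \<eta> z)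
      = (LINT w|lborel. F w * complex_of_real (norm (fst w - snd w) powr s) * (\<eta> (fst w) * \<theta> (snd w)))"
begin

definition energy_density :: "'a \<times> 'a \<Rightarrow> real" where
  "energy_density w = cmod (F w) powr p / norm (fst w - snd w) ^ DIM('a)"

definition energy :: real where
  "energy = (LINT w|lborel. energy_density w)"

definition local_energy :: "'a \<Rightarrow> real" where
  "local_energy x = (LINT z|lborel. energy_density (x, z))"

definition increment :: "'a \<times> 'a \<Rightarrow> complex" where
  "increment w = F w * complex_of_real (norm (fst w - snd w) powr s)"

definition average :: "'a \<Rightarrow> real \<Rightarrow> complex" where
  "average a r = u (\<lambda>x. complex_of_real (probe a r x))"

definition reconstruction :: "'a \<Rightarrow> real \<Rightarrow> 'a \<Rightarrow> complex" where
  "reconstruction a r x = average a r + (LINT z|lborel. increment (x, z) * complex_of_real (probe a r z))"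

lemma energy_density_measurable [measurable]: "energy_density \<in> borel_measurable borel"
  unfolding energy_density_def by measurable

lemma increment_measurable [measurable]: "increment \<in> borel_measurable borel"
  unfolding increment_def by measurable

lemma energy_density_nonneg: "0 \<le> energy_density w"
  by (simp add: energy_density_def)

lemma energy_nonneg: "0 \<le> energy" and local_energy_nonneg: "0 \<le> local_energy x"
  by (simp_all add: energy_def local_energy_def energy_density_nonneg)

lemma energy_density_integrable: "integrable lborel energy_density"
  unfolding energy_density_def[abs_def] by (rule F_integrable)

lemma energy_density_integrable_pair: "integrable (lborel \<Otimes>\<^sub>M lborel) energy_density"
  using energy_density_integrable by (simp add: lborel_prod)

lemma AE_energy_density_section: "AE x in lborel. integrable lborel (\<lambda>z. energy_density (x, z))"
  by (rule lborel_pair.AE_integrable_fst'[OF energy_density_integrable_pair])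

lemma local_energy_integrable: "integrable lborel local_energy"
  and integral_local_energy: "(LINT x|lborel. local_energy x) = energy"
  unfolding local_energy_def energy_def
  using lborel_pair.integrable_fst'[OF energy_density_integrable_pair]
    lborel_pair.integral_fst'[OF energy_density_integrable_pair] by (simp_all add: lborel_prod)

text \<open>
  Replacing \<open>|y - z|^(s p)\<close> by \<open>|y - z|^(s p + n)\<close> divided by the density's \<open>|y - z|^n\<close> turns a mean of \<open>|\<Phi>|^p\<close> over
  pairs of points at distance at most \<open>D\<close> into a power of \<open>D\<close> times energy.
\<close>

lemma weighted_increment_le:
  assumes "0 \<le> \<rho>" "\<rho> \<le> B" and D: "\<rho> \<noteq> 0 \<Longrightarrow> norm (fst w - snd w) \<le> D"
  shows "\<rho> * cmod (increment w) powr p \<le> B * D powr (s * p + DIM('a)) * energy_density w"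
proof (cases "\<rho> = 0")
  case True
  then show ?thesis using assms(2) energy_density_nonneg by simp
next
  case False
  let ?d = "norm (fst w - snd w)"
  have "cmod (increment w) powr p = cmod (F w) powr p * ?d powr (s * p)"
    by (simp add: increment_def norm_mult powr_mult powr_powr)
  also have "\<dots> = ?d powr (s * p + DIM('a)) * energy_density w"
    using s p by (cases "fst w = snd w") (auto simp: energy_density_def powr_add powr_realpow)
  also have "\<dots> \<le> D powr (s * p + DIM('a)) * energy_density w"
    using D[OF False] s p by (intro mult_right_mono powr_mono2 energy_density_nonneg) auto
  finally have "\<rho> * cmod (increment w) powr p \<le> B * (D powr (s * p + DIM('a)) * energy_density w)"
    using assms energy_density_nonneg by (intro mult_mono) auto
  then show ?thesis by simp
qed

lemma mean_const_bound:
  assumes "0 \<le> b" "b \<le> (max 1 (1 / unit_mass TYPE('a)))\<^sup>2" "0 < c" "c \<le> 21" "r > 0" "E \<ge> 0"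
  shows "2 * (b * r powr e * (c * real DIM('a) * r) powr (s * p + DIM('a)) * E) powr (1 / p)
    \<le> mean_const TYPE('a) s p * r powr ((e + s * p + DIM('a)) / p) * E powr (1 / p)"
proof -
  have "(b * r powr e * (c * real DIM('a) * r) powr (s * p + DIM('a)) * E)
      = (b * (c * real DIM('a)) powr (s * p + DIM('a))) * (r powr (e + s * p + DIM('a)) * E)"
    using assms by (simp add: powr_mult powr_add)
  also have "\<dots> \<le> ((max 1 (1 / unit_mass TYPE('a)))\<^sup>2 * (21 * real DIM('a)) powr (s * p + DIM('a)))
      * (r powr (e + s * p + DIM('a)) * E)"
    using assms s p by (intro mult_right_mono mult_mono powr_mono2) auto
  finally have "(b * r powr e * (c * real DIM('a) * r) powr (s * p + DIM('a)) * E) powr (1 / p)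
    \<le> (((max 1 (1 / unit_mass TYPE('a)))\<^sup>2 * (21 * real DIM('a)) powr (s * p + DIM('a)))
      * (r powr (e + s * p + DIM('a)) * E)) powr (1 / p)"
    using assms p by (intro powr_mono2) auto
  then show ?thesis
    using assms p by (simp add: mean_const_def powr_mult powr_powr)
qed

lemma increment_mean_bound:
  assumes r: "r > 0" and x: "norm (x - a) \<le> r" and int: "integrable lborel (\<lambda>z. energy_density (x, z))"
  shows "cmod (LINT z|lborel. increment (x, z) * complex_of_real (probe a r z))
    \<le> mean_const TYPE('a) s p * r powr s * local_energy x powr (1 / p)"
proof -
  let ?B = "1 / (r ^ DIM('a) * unit_mass TYPE('a))"
  have "cmod (LINT z|lborel. increment (x, z) * complex_of_real (probe a r z))
    \<le> 2 * (LINT z|lborel. ?B * (5 * real DIM('a) * r) powr (s * p + DIM('a)) * energy_density (x, z)) powr (1 / p)"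
  proof (rule weighted_mean_bound[OF p])
    show "cmod (increment (x, z) * complex_of_real (probe a r z)) \<le> cmod (increment (x, z)) * probe a r z" for z
      using probe_nonneg[OF r, of a z] by (simp add: norm_mult)
    show "probe a r z * cmod (increment (x, z)) powr p
      \<le> ?B * (5 * real DIM('a) * r) powr (s * p + DIM('a)) * energy_density (x, z)" for z
    proof (rule weighted_increment_le[OF probe_nonneg[OF r] probe_le[OF r]])
      assume "probe a r z \<noteq> 0"
      then have "z \<in> cell a r" using probe_eq_0[OF r] by blast
      have "norm (x - z) \<le> norm (x - a) + norm (z - a)" using norm_triangle_ineq4[of "x - a" "z - a"] by simp
      also have "\<dots> \<le> r + 4 * r * DIM('a)" using x cell_dist(1)[OF \<open>z \<in> cell a r\<close> r] by simp
      also have "\<dots> \<le> 5 * real DIM('a) * r"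
        using r DIM_positive[where ?'a='a] by (simp add: algebra_simps)
      finally show "norm (fst (x, z) - snd (x, z)) \<le> 5 * real DIM('a) * r" by simp
    qed
  qed (use integral_probe[OF r] probe_nonneg[OF r] int in auto)
  also have "(LINT z|lborel. ?B * (5 * real DIM('a) * r) powr (s * p + DIM('a)) * energy_density (x, z))
      = 1 / unit_mass TYPE('a) * r powr (- real DIM('a)) * (5 * real DIM('a) * r) powr (s * p + DIM('a)) * local_energy x"
    using r by (simp add: local_energy_def powr_minus powr_realpow field_simps)
  also have "2 * \<dots> powr (1 / p)
      \<le> mean_const TYPE('a) s p * r powr ((- real DIM('a) + s * p + DIM('a)) / p) * local_energy x powr (1 / p)"
  proof (rule mean_const_bound)
    have "1 / unit_mass TYPE('a) \<le> max 1 (1 / unit_mass TYPE('a))" by simp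
    also have "\<dots> \<le> (max 1 (1 / unit_mass TYPE('a)))\<^sup>2" by (rule self_le_power) auto
    finally show "1 / unit_mass TYPE('a) \<le> (max 1 (1 / unit_mass TYPE('a)))\<^sup>2" .
  qed (use r local_energy_nonneg unit_mass_pos[where ?'a='a] in auto)
  finally show ?thesis using p by simp
qed

lemma integral_pair_probes:
  assumes "r > 0" "r' > 0"
  shows "integrable lborel (\<lambda>w. probe a r (fst w) * probe b r' (snd w))"
    and "(LINT w|lborel. probe a r (fst w) * probe b r' (snd w)) = 1"
proof -
  let ?f = "\<lambda>w. probe a r (fst w) * probe b r' (snd w)"
  have int: "integrable (lborel \<Otimes>\<^sub>M lborel) ?f"
  proof (rule lborel_pair.Fubini_integrable)
    show "?f \<in> borel_measurable (lborel \<Otimes>\<^sub>M lborel)" by (simp add: lborel_prod)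
  qed (use integral_probe[OF assms(1), of a] integral_probe[OF assms(2), of b] in \<open>auto simp: abs_mult\<close>)
  then show "integrable lborel ?f" by (simp add: lborel_prod)
  from lborel_pair.integral_fst'[OF int] show "(LINT w|lborel. ?f w) = 1"
    using integral_probe(1)[OF assms(1), of a] integral_probe(1)[OF assms(2), of b]
    by (simp add: lborel_prod)
qed

lemma average_diff:
  assumes "r > 0" "r' > 0" "cell a r \<inter> cell b r' = {}"
  shows "average a r - average b r'
    = (LINT w|lborel. increment w * complex_of_real (probe a r (fst w) * probe b r' (snd w)))"
proof -
  have "average a r * (LINT z|lborel. complex_of_real (probe b r' z))
      - average b r' * (LINT z|lborel. complex_of_real (probe a r z))
    = (LINT w|lborel. F w * complex_of_real (norm (fst w - snd w) powr s)
        * (complex_of_real (probe a r (fst w)) * complex_of_real (probe b r' (snd w))))"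
    unfolding average_def
    by (rule pairing[OF smooth_probe smooth_probe compact_cell compact_cell assms(3)])
      (use assms probe_eq_0 in auto)
  then show ?thesis
    using integral_probe(1)[OF assms(1), of a] integral_probe(1)[OF assms(2), of b]
    by (simp add: increment_def)
qed

text \<open>
  Both probes have mass one and disjoint supports, so the difference is a mean of \<open>\<Phi>\<close> over two cells of
  size and distance comparable to \<open>r\<close>.
\<close>

lemma average_diff_bound:
  assumes r: "r > 0" and ab: "norm (a - b) \<le> r"
  shows "cmod (average a r - average b (4 * r))
    \<le> mean_const TYPE('a) s p * r powr (s - DIM('a) / p) * energy powr (1 / p)"
proof -
  let ?m = "unit_mass TYPE('a)" and ?n = "DIM('a)"
  let ?B = "1 / (r ^ ?n * ?m) * (1 / ((4 * r) ^ ?n * ?m))"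
  let ?\<rho> = "\<lambda>w. probe a r (fst w) * probe b (4 * r) (snd w)"
  have r4: "4 * r > 0" using r by simp
  have "cmod (average a r - average b (4 * r)) \<le>
    2 * (LINT w|lborel. ?B * (21 * real ?n * r) powr (s * p + ?n) * energy_density w) powr (1 / p)"
    unfolding average_diff[OF r r4 cells_disjoint[OF ab r]]
  proof (rule weighted_mean_bound[OF p])
    show nonneg: "0 \<le> ?\<rho> w" for w
      using probe_nonneg[OF r, of a "fst w"] probe_nonneg[OF r4, of b "snd w"] by simp
    show "cmod (increment w * complex_of_real (?\<rho> w)) \<le> cmod (increment w) * ?\<rho> w" for w
      using nonneg[of w] by (simp only: norm_mult norm_of_real abs_of_nonneg)
    show "?\<rho> w * cmod (increment w) powr p
      \<le> ?B * (21 * real ?n * r) powr (s * p + ?n) * energy_density w" for w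
    proof (rule weighted_increment_le[OF nonneg])
      show "?\<rho> w \<le> ?B"
        using probe_nonneg[OF r, of a "fst w"] probe_nonneg[OF r4, of b "snd w"]
          probe_le[OF r, of a "fst w"] probe_le[OF r4, of b "snd w"] unit_mass_pos[where ?'a='a] r
        by (intro mult_mono) auto
      assume "?\<rho> w \<noteq> 0"
      then have cells: "fst w \<in> cell a r" "snd w \<in> cell b (4 * r)"
        using probe_eq_0[OF r, of "fst w" a] probe_eq_0[OF r4, of "snd w" b] by auto
      have split: "fst w - snd w = (fst w - a) + (a - b) - (snd w - b)" by simp
      have "norm (fst w - snd w) \<le> norm ((fst w - a) + (a - b)) + norm (snd w - b)"
        by (subst split) (rule norm_triangle_ineq4)
      also have "\<dots> \<le> norm (fst w - a) + norm (a - b) + norm (snd w - b)"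
        by (intro add_right_mono norm_triangle_ineq)
      also have "\<dots> \<le> 4 * r * ?n + r + 4 * (4 * r) * ?n"
        using ab cell_dist(1)[OF cells(1) r] cell_dist(1)[OF cells(2) r4] by simp
      also have "\<dots> \<le> 21 * real ?n * r"
        using r DIM_positive[where ?'a='a] by (simp add: algebra_simps)
      finally show "norm (fst w - snd w) \<le> 21 * real ?n * r" .
    qed
  qed (use integral_pair_probes[OF r r4] energy_density_integrable in auto)
  also have "(LINT w|lborel. ?B * (21 * real ?n * r) powr (s * p + ?n) * energy_density w)
      = (1 / ?m)\<^sup>2 / 4 ^ ?n * r powr (- 2 * real ?n) * (21 * real ?n * r) powr (s * p + ?n) * energy"
  proof -
    have "r powr (- 2 * real ?n) = 1 / (r ^ ?n * r ^ ?n)"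
    proof -
      have "- 2 * real ?n = - (real ?n + real ?n)" by simp
      then show ?thesis using r by (simp only: powr_minus powr_add powr_realpow divide_inverse mult_1)
    qed
    then show ?thesis by (simp add: energy_def power_mult_distrib power2_eq_square)
  qed
  also have "2 * \<dots> powr (1 / p)
      \<le> mean_const TYPE('a) s p * r powr ((- 2 * real ?n + s * p + ?n) / p) * energy powr (1 / p)"
  proof (rule mean_const_bound)
    have "(1 / ?m)\<^sup>2 / 4 ^ ?n \<le> (1 / ?m)\<^sup>2 / 1" by (intro divide_left_mono) auto
    also have "\<dots> \<le> (max 1 (1 / ?m))\<^sup>2"
      using unit_mass_pos[where ?'a='a] by (simp only: div_by_1) (intro power_mono; simp)
    finally show "(1 / ?m)\<^sup>2 / 4 ^ ?n \<le> (max 1 (1 / ?m))\<^sup>2" .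
  qed (use r energy_nonneg in auto)
  also have "(- 2 * real ?n + s * p + ?n) / p = s - ?n / p" using p by (simp add: field_simps)
  finally show ?thesis .
qed

lemma decay_pos: "(real DIM('a) / p - s) > 0"
  using sp p by (simp add: field_simps)

text \<open>
  The increments between successive scales decay geometrically, because \<open>s < n / p\<close>. The limit is the
  same for all base points since, at large scales, \<open>average_diff_bound\<close> also compares different base points.
\<close>

lemma average_limit:
  obtains C where "\<And>(a::'a) (k::int). cmod (average a (4 powr real_of_int k) - C)
    \<le> mean_const TYPE('a) s p / (1 - 4 powr (- (real DIM('a) / p - s))) * ((4 powr real_of_int k) powr (- (real DIM('a) / p - s)) * energy powr (1 / p))"
proof -
  define A where "A = mean_const TYPE('a) s p * energy powr (1 / p)"
  have "A \<ge> 0" using mean_const_pos[where ?'a='a, of s p] by (simp add: A_def)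
  let ?\<rho> = "4 powr (- (real DIM('a) / p - s))"
  have \<rho>: "0 \<le> ?\<rho>" "?\<rho> < 1" using decay_pos by (simp_all add: powr_less_one)
  have step: "cmod (average a (4 powr real_of_int k) - average b (4 powr real_of_int (k + 1))) \<le> A * (4 powr real_of_int k) powr (- (real DIM('a) / p - s))"
    if "norm (a - b) \<le> 4 powr real_of_int k" for a b and k :: int
  proof -
    have "4 powr real_of_int (k + 1) = 4 * 4 powr real_of_int k" by (simp add: powr_add)
    then show ?thesis using average_diff_bound[OF _ that] by (simp add: A_def mult_ac)
  qed
  have shift: "(4 powr real_of_int (k + int j)) powr (- (real DIM('a) / p - s)) = (4 powr real_of_int k) powr (- (real DIM('a) / p - s)) * ?\<rho> ^ j" for k j
  proof -
    have "?\<rho> ^ j = (4 powr real j) powr (- (real DIM('a) / p - s))"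
      by (simp add: powr_powr mult.commute flip: powr_realpow)
    then show ?thesis by (simp add: powr_add powr_mult)
  qed
  have incr: "cmod (average a (4 powr real_of_int (k + int j)) - average a (4 powr real_of_int (k + int (Suc j))))
      \<le> A * (4 powr real_of_int k) powr (- (real DIM('a) / p - s)) * ?\<rho> ^ j" for a and k :: int and j
    using step[of a a "k + int j"] shift[of k j] by (simp add: algebra_simps)
  have limit: "\<exists>L. (\<lambda>j. average a (4 powr real_of_int (k + int j))) \<longlonglongrightarrow> L \<and>
      cmod (average a (4 powr real_of_int k) - L) \<le> A * (4 powr real_of_int k) powr (- (real DIM('a) / p - s)) / (1 - ?\<rho>)" for a and k :: int
  proof -
    obtain L where "(\<lambda>j. average a (4 powr real_of_int (k + int j))) \<longlonglongrightarrow> L"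
      "cmod (average a (4 powr real_of_int (k + int 0)) - L) \<le> A * (4 powr real_of_int k) powr (- (real DIM('a) / p - s)) / (1 - ?\<rho>)"
      by (rule geometric_increments_limit[OF \<rho> incr])
    then show ?thesis by auto
  qed
  obtain C where C: "(\<lambda>j. average 0 (4 powr real_of_int (0 + int j))) \<longlonglongrightarrow> C" using limit[of 0 0] by blast
  have "cmod (average a (4 powr real_of_int k) - C) \<le> A * (4 powr real_of_int k) powr (- (real DIM('a) / p - s)) / (1 - ?\<rho>)" for a and k :: int
  proof -
    obtain L where L: "(\<lambda>j. average a (4 powr real_of_int (k + int j))) \<longlonglongrightarrow> L"
      "cmod (average a (4 powr real_of_int k) - L) \<le> A * (4 powr real_of_int k) powr (- (real DIM('a) / p - s)) / (1 - ?\<rho>)" using limit by blast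
    have ev: "\<forall>\<^sub>F j in sequentially. norm (a - 0) \<le> 4 powr real_of_int (k + int j)"
    proof -
      have "real j \<le> 4 ^ j" for j
      proof (induction j)
        case (Suc j)
        then show ?case using one_le_power[of "4::real" j] unfolding of_nat_Suc power_Suc by linarith
      qed simp
      then have "filterlim (\<lambda>j. 4 ^ j :: real) at_top sequentially"
        by (intro filterlim_at_top_mono[OF filterlim_real_sequentially] always_eventually allI)
      then have "filterlim (\<lambda>j. 4 powr real_of_int k * 4 ^ j :: real) at_top sequentially"
        by (rule filterlim_tendsto_pos_mult_at_top[OF tendsto_const, rotated]) simp
      then have "\<forall>\<^sub>F j in sequentially. norm (a - 0) \<le> 4 powr real_of_int k * 4 ^ j"
        by (simp add: filterlim_at_top)
      then show ?thesis by (simp add: powr_add powr_realpow)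
    qed
    have "(\<lambda>j. average a (4 powr real_of_int (k + int j)) - average 0 (4 powr real_of_int (k + int j + 1))) \<longlonglongrightarrow> 0"
    proof (rule Lim_null_comparison)
      show "\<forall>\<^sub>F j in sequentially. norm (average a (4 powr real_of_int (k + int j)) - average 0 (4 powr real_of_int (k + int j + 1)))
          \<le> A * (4 powr real_of_int k) powr (- (real DIM('a) / p - s)) * ?\<rho> ^ j"
        using ev
      proof eventually_elim
        case (elim j)
        show ?case using step[OF elim] unfolding shift by (simp only: mult.assoc)
      qed
      show "(\<lambda>j. A * (4 powr real_of_int k) powr (- (real DIM('a) / p - s)) * ?\<rho> ^ j) \<longlonglongrightarrow> 0"
        using \<rho> by (intro tendsto_mult_right_zero LIMSEQ_power_zero) simp
    qed
    from tendsto_diff[OF L(1) this]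
    have "(\<lambda>j. average 0 (4 powr real_of_int (k + int j + 1))) \<longlonglongrightarrow> L" by simp
    \<comment> \<open>both sequences are brought to a common index, as \<open>k + 1\<close> may be negative\<close>
    from LIMSEQ_ignore_initial_segment[OF this, of "nat (- (k + 1))"]
    have "(\<lambda>j. average 0 (4 powr real_of_int (k + int (j + nat (- (k + 1))) + 1))) \<longlonglongrightarrow> L" .
    moreover have "(\<lambda>j. average 0 (4 powr real_of_int (0 + int (j + nat (k + 1))))) \<longlonglongrightarrow> C"
      by (rule LIMSEQ_ignore_initial_segment[OF C])
    moreover have "0 + int (j + nat (k + 1)) = k + int (j + nat (- (k + 1))) + 1" for j by simp
    ultimately have "L = C" by (simp only: LIMSEQ_unique)
    with L(2) show ?thesis by simp
  qed
  then show ?thesis by (intro that[of C]) (simp add: A_def mult_ac)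
qed

lemma increment_integrable:
  assumes [measurable]: "\<rho> \<in> borel_measurable borel" and "\<And>w. cmod (\<rho> w) \<le> B"
    and "bounded S" "\<And>w. w \<notin> S \<Longrightarrow> \<rho> w = 0"
  shows "integrable lborel (\<lambda>w. increment w * \<rho> w)"
  unfolding increment_def
  by (rule bounded_support_integrable[OF p s F_measurable assms(1) F_integrable assms(2-4)])

lemma increment_probe_integrable:
  assumes r: "r > 0" and [measurable]: "\<eta> \<in> borel_measurable borel" and B: "\<And>x. cmod (\<eta> x) \<le> B"
    and K: "bounded K" "\<And>x. x \<notin> K \<Longrightarrow> \<eta> x = 0"
  shows "integrable (lborel \<Otimes>\<^sub>M lborel) (\<lambda>w. increment w * (\<eta> (fst w) * complex_of_real (probe a r (snd w))))"
  unfolding lborel_prod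
proof (rule increment_integrable)
  have "B \<ge> 0" using B norm_ge_zero order_trans by blast
  then show "cmod (\<eta> (fst w) * complex_of_real (probe a r (snd w)))
      \<le> B * (1 / (r ^ DIM('a) * unit_mass TYPE('a)))" for w
    unfolding norm_mult using B probe_le[OF r, of a "snd w"] probe_nonneg[OF r, of a "snd w"]
    by (intro mult_mono) auto
  show "bounded (K \<times> cell a r)" using K(1) compact_imp_bounded[OF compact_cell] by (intro bounded_Times)
  show "\<eta> (fst w) * complex_of_real (probe a r (snd w)) = 0" if "w \<notin> K \<times> cell a r" for w
    using that K(2)[of "fst w"] probe_eq_0[OF r, of "snd w" a] by (auto simp: mem_Times_iff)
qed measurable

lemma reconstruction_measurable [measurable]: "reconstruction a r \<in> borel_measurable borel"
proof -
  have [measurable]: "increment \<in> borel_measurable (borel \<Otimes>\<^sub>M borel)"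
    using increment_measurable by (simp add: borel_prod)
  have "(\<lambda>x. LINT z|lborel. increment (x, z) * complex_of_real (probe a r z)) \<in> borel_measurable borel"
    by measurable
  then show ?thesis unfolding reconstruction_def by measurable
qed

lemma reconstruction_integrable:
  assumes r: "r > 0"
  shows "set_integrable lborel (cbox c d) (reconstruction a r)"
proof -
  have "integrable lborel (\<lambda>x. LINT z|lborel. increment (x, z)
      * (indicator (cbox c d) x * complex_of_real (probe a r z)))"
    using lborel_pair.integrable_fst'[OF increment_probe_integrable[OF r, of "indicator (cbox c d)" 1 "cbox c d"]]
    by (simp add: bounded_cbox indicator_def)
  also have "(\<lambda>x. LINT z|lborel. increment (x, z) * (indicator (cbox c d) x * complex_of_real (probe a r z)))
    = (\<lambda>x. indicat_real (cbox c d) x *\<^sub>R (LINT z|lborel. increment (x, z) * complex_of_real (probe a r z)))"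
    by (auto simp: indicator_def)
  finally have "set_integrable lborel (cbox c d) (\<lambda>x. LINT z|lborel. increment (x, z) * complex_of_real (probe a r z))"
    by (simp add: set_integrable_def)
  moreover have "set_integrable lborel (cbox c d) (\<lambda>_. average a r)"
    unfolding set_integrable_def using emeasure_lborel_cbox_finite[of c d]
    by (intro integrable_scaleR_left integrable_real_indicator) auto
  ultimately show ?thesis unfolding reconstruction_def by (rule set_integral_add(1)[rotated])
qed

text \<open>
  The pairing identity with \<open>\<theta>\<close> a probe, after Fubini's theorem.
\<close>

lemma pairing_reconstruction:
  assumes r: "r > 0" and \<eta>: "smooth \<eta>" "compact K" "\<And>x. x \<notin> K \<Longrightarrow> \<eta> x = 0" and disj: "K \<inter> cell a r = {}"
  shows "integrable lborel (\<lambda>x. \<eta> x * reconstruction a r x)"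
    and "u \<eta> = (LINT x|lborel. \<eta> x * reconstruction a r x)"
proof -
  have S: "\<eta> \<in> schwartz" using smooth_eq_0_outside_in_schwartz(1)[OF \<eta>] .
  obtain B where B: "\<And>x. cmod (\<eta> x) \<le> B" using schwartz_decay[OF S, of 0] by auto
  have [measurable]: "\<eta> \<in> borel_measurable borel" by (rule schwartz_borel_measurable[OF S])
  let ?f = "\<lambda>w. increment w * (\<eta> (fst w) * complex_of_real (probe a r (snd w)))"
  have f: "integrable (lborel \<Otimes>\<^sub>M lborel) ?f"
    by (rule increment_probe_integrable[OF r _ B compact_imp_bounded[OF \<eta>(2)] \<eta>(3)]) auto
  have sec: "(LINT z|lborel. ?f (x, z)) = \<eta> x * (LINT z|lborel. increment (x, z) * complex_of_real (probe a r z))" for x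
  proof -
    have "(LINT z|lborel. ?f (x, z)) = (LINT z|lborel. \<eta> x * (increment (x, z) * complex_of_real (probe a r z)))"
      by (simp add: mult_ac)
    then show ?thesis by simp
  qed
  have int1: "integrable lborel (\<lambda>x. \<eta> x * (LINT z|lborel. increment (x, z) * complex_of_real (probe a r z)))"
    using lborel_pair.integrable_fst'[OF f] unfolding sec .
  have int2: "integrable lborel (\<lambda>x. \<eta> x * average a r)" using schwartz_integrable[OF S] by simp
  show "integrable lborel (\<lambda>x. \<eta> x * reconstruction a r x)"
    using Bochner_Integration.integrable_add[OF int2 int1] by (simp add: reconstruction_def distrib_left)
  have "u \<eta> * (LINT z|lborel. complex_of_real (probe a r z)) - average a r * (LINT z|lborel. \<eta> z)
      = (LINT w|lborel. ?f w)"
    unfolding average_def increment_def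
    by (rule pairing[OF \<eta>(1) smooth_probe \<eta>(2) compact_cell disj \<eta>(3)]) (use probe_eq_0[OF r] in auto)
  moreover have "(LINT w|lborel. ?f w)
      = (LINT x|lborel. \<eta> x * (LINT z|lborel. increment (x, z) * complex_of_real (probe a r z)))"
    using lborel_pair.integral_fst'[OF f] unfolding sec by (simp add: lborel_prod)
  moreover have "(LINT x|lborel. \<eta> x * reconstruction a r x) = (LINT x|lborel. \<eta> x * average a r)
      + (LINT x|lborel. \<eta> x * (LINT z|lborel. increment (x, z) * complex_of_real (probe a r z)))"
    using Bochner_Integration.integral_add[OF int2 int1] by (simp add: reconstruction_def distrib_left)
  ultimately show "u \<eta> = (LINT x|lborel. \<eta> x * reconstruction a r x)"
    using integral_probe(1)[OF r, of a] by (simp add: algebra_simps)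
qed

lemma reconstructions_agree:
  assumes r: "r > 0" "r' > 0"
  shows "AE x in lborel. x \<notin> cell a r \<and> x \<notin> cell b r' \<longrightarrow> reconstruction a r x = reconstruction b r' x"
proof -
  let ?U = "- (cell a r \<union> cell b r')"
  have "AE x in lborel. x \<in> ?U \<longrightarrow> reconstruction a r x - reconstruction b r' x = 0"
  proof (rule zero_against_bumps_imp_AE_zero)
    show "open ?U" by (intro open_Compl closed_Un compact_imp_closed compact_cell)
    show "set_integrable lborel (cbox c d) (\<lambda>x. reconstruction a r x - reconstruction b r' x)" for c d
      by (intro set_integral_diff(1) reconstruction_integrable r)
    fix m :: real and c d :: 'a assume "m > 0" and sub: "cbox c d \<subseteq> ?U"
    let ?\<eta> = "\<lambda>x. complex_of_real (bump m c d x)"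
    have \<eta>0: "?\<eta> x = 0" if "x \<notin> cbox c d" for x
      using that bump_eq_0[OF \<open>m > 0\<close>] box_subset_cbox by fastforce
    have "cbox c d \<inter> cell a r = {}" "cbox c d \<inter> cell b r' = {}" using sub by auto
    note A = pairing_reconstruction[OF r(1) smooth_bump compact_cbox \<eta>0 this(1)]
      and B = pairing_reconstruction[OF r(2) smooth_bump compact_cbox \<eta>0 this(2)]
    show "(LINT x|lborel. ?\<eta> x * (reconstruction a r x - reconstruction b r' x)) = 0"
      using Bochner_Integration.integral_diff[OF A(1) B(1)] A(2) B(2) by (simp add: right_diff_distrib)
  qed
  then show ?thesis by eventually_elim auto
qed

text \<open>
  Two disjoint cells suffice, because every point lies off one of them.
\<close>

definition representative :: "'a \<Rightarrow> complex" where
  "representative x = (if x \<in> cell 0 1 then reconstruction 0 4 x else reconstruction 0 1 x)"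

lemma representative_measurable [measurable]: "representative \<in> borel_measurable borel"
proof -
  have [measurable]: "cell 0 1 \<in> sets (borel :: 'a measure)"
    by (intro borel_closed compact_imp_closed compact_cell)
  show ?thesis unfolding representative_def by measurable
qed

lemma representative_eq_reconstruction:
  assumes "r > 0"
  shows "AE x in lborel. x \<notin> cell a r \<longrightarrow> representative x = reconstruction a r x"
proof -
  have disj: "cell (0::'a) 1 \<inter> cell 0 4 = {}" using cells_disjoint[of "0::'a" 0 1] by simp
  have "AE x in lborel. x \<notin> cell 0 1 \<and> x \<notin> cell a r \<longrightarrow> reconstruction 0 1 x = reconstruction a r x"
    "AE x in lborel. x \<notin> cell 0 4 \<and> x \<notin> cell a r \<longrightarrow> reconstruction 0 4 x = reconstruction a r x"
    using assms by (intro reconstructions_agree; simp)+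
  then show ?thesis
    by eventually_elim (use disj in \<open>auto simp: representative_def\<close>)
qed

text \<open>
  A probe of large scale lives off any given compact set, so a single reconstruction serves.
\<close>

lemma pairing_representative:
  assumes \<eta>: "smooth \<eta>" "compact K" "\<And>x. x \<notin> K \<Longrightarrow> \<eta> x = 0"
  shows "u \<eta> = (LINT x|lborel. \<eta> x * representative x)"
proof -
  obtain R where R: "\<And>x. x \<in> K \<Longrightarrow> norm x \<le> R"
    using compact_imp_bounded[OF \<eta>(2)] by (auto simp: bounded_iff)
  define r where "r = max R 1"
  have r: "r > 0" by (simp add: r_def)
  have disj: "K \<inter> cell 0 r = {}"
    using R cell_dist(2)[OF _ r, of _ 0] by (force simp: r_def)
  have [measurable]: "\<eta> \<in> borel_measurable borel"
    by (rule schwartz_borel_measurable[OF smooth_eq_0_outside_in_schwartz(1)[OF \<eta>]])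
  have "u \<eta> = (LINT x|lborel. \<eta> x * reconstruction 0 r x)" by (rule pairing_reconstruction(2)[OF r \<eta> disj])
  also have "\<dots> = (LINT x|lborel. \<eta> x * representative x)"
  proof (rule integral_cong_AE)
    show "AE x in lborel. \<eta> x * reconstruction 0 r x = \<eta> x * representative x"
      using representative_eq_reconstruction[OF r, of 0]
    proof eventually_elim
      case (elim x)
      show ?case
      proof (cases "x \<in> K")
        case True
        then have "x \<notin> cell 0 r" using disj by blast
        with elim show ?thesis by simp
      qed (simp add: \<eta>(3))
    qed
  qed simp_all
  finally show ?thesis .
qed

section \<open>The Sobolev inequality\<close>

text \<open>
  For a given point and scale the base point of the probe has to be chosen near the point; to keep one exceptional null set,
  base points come from a countable dense set and scales from the powers of 4.
\<close>

lemma representative_pointwise: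
  assumes q: "1 / q = 1 / p - s / real DIM('a)"
  obtains C where "AE x in lborel. cmod (representative x - C)
    \<le> sobolev_const TYPE('a) s p * (local_energy x powr (1 / q) * energy powr (s / real DIM('a)))"
proof -
  define A where "A = mean_const TYPE('a) s p / (1 - 4 powr (- (real DIM('a) / p - s)))"
  have \<rho>: "0 < (4::real) powr (- (real DIM('a) / p - s))" "4 powr (- (real DIM('a) / p - s)) < 1" using decay_pos by (simp_all add: powr_less_one)
  have A: "A \<ge> mean_const TYPE('a) s p" "A > 0"
    using \<rho> mean_const_pos[where ?'a='a, of s p] unfolding A_def by (simp_all add: field_simps)
  obtain C where C: "\<And>(a::'a) (k::int). cmod (average a (4 powr real_of_int k) - C)
    \<le> A * ((4 powr real_of_int k) powr (- (real DIM('a) / p - s)) * energy powr (1 / p))"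
    using average_limit unfolding A_def by blast
  obtain X :: "'a set" where X: "countable X" "\<And>U. open U \<Longrightarrow> U \<noteq> {} \<Longrightarrow> \<exists>a\<in>X. a \<in> U"
    using countable_dense_exists by metis
  have "AE x in lborel. \<forall>k::int. \<forall>a\<in>X. x \<notin> cell a (4 powr real_of_int k) \<longrightarrow> representative x = reconstruction a (4 powr real_of_int k) x"
    by (simp add: AE_all_countable AE_ball_countable[OF X(1)] representative_eq_reconstruction)
  then have "AE x in lborel. cmod (representative x - C)
    \<le> sobolev_const TYPE('a) s p * (local_energy x powr (1 / q) * energy powr (s / real DIM('a)))"
    using AE_energy_density_section
  proof eventually_elim
    case (elim x)
    have "cmod (representative x - C) \<le> A * ((4 powr real_of_int k) powr s * local_energy x powr (1 / p)
        + (4 powr real_of_int k) powr (- (real DIM('a) / p - s)) * energy powr (1 / p))" for k :: int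
    proof -
      let ?r = "4 powr real_of_int k"
      have "ball x ?r \<noteq> {}" by simp
      then obtain a where a: "a \<in> X" "a \<in> ball x ?r" using X(2)[of "ball x ?r"] by auto
      then have xa: "norm (x - a) \<le> ?r" by (simp add: dist_norm)
      have "x \<notin> cell a ?r"
      proof
        assume "x \<in> cell a ?r"
        from cell_dist(2)[OF this] have "2 * ?r \<le> norm (x - a)" by simp
        moreover have "?r > 0" by simp
        ultimately show False using xa by linarith
      qed
      then have eq: "representative x - C = (average a ?r - C)
          + (LINT z|lborel. increment (x, z) * complex_of_real (probe a ?r z))"
        using elim(1) a(1) by (simp add: reconstruction_def)
      have "cmod (representative x - C) \<le> A * (?r powr (- (real DIM('a) / p - s)) * energy powr (1 / p))
          + mean_const TYPE('a) s p * ?r powr s * local_energy x powr (1 / p)"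
        unfolding eq by (rule norm_triangle_mono[OF C increment_mean_bound[OF _ xa elim(2)]]) simp
      also have "mean_const TYPE('a) s p * ?r powr s * local_energy x powr (1 / p)
          \<le> A * ?r powr s * local_energy x powr (1 / p)"
        by (intro mult_right_mono A) auto
      finally show ?thesis by (simp add: algebra_simps)
    qed
    from optimise_over_dyadic_scales[OF norm_ge_zero _ _ _ s decay_pos this]
    have "cmod (representative x - C) \<le> A * (1 + 4 powr (real DIM('a) / p - s))
      * ((local_energy x powr (1 / p)) powr ((real DIM('a) / p - s) / (s + (real DIM('a) / p - s))) * (energy powr (1 / p)) powr (s / (s + (real DIM('a) / p - s))))"
      using A by simp
    moreover have "1 / p * ((real DIM('a) / p - s) / (s + (real DIM('a) / p - s))) = 1 / q"
      "1 / p * (s / (s + (real DIM('a) / p - s))) = s / real DIM('a)"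
      unfolding q using p DIM_positive[where ?'a='a] by (simp_all add: field_simps)
    ultimately show ?case by (simp only: powr_powr sobolev_const_def A_def)
  qed
  then show ?thesis by (rule that)
qed

text \<open>
  The constants are chosen so that the \<open>q\<close>-th power of the pointwise bound is a multiple of the local energy, which is
  integrable. The identity for \<open>u\<close> extends to Schwartz functions by dominated convergence
  along the cutoffs, with \<open>|f| \<le> 1 + |f|^q\<close> providing the majorant.
\<close>

lemma representative_sobolev_bound:
  assumes q: "1 / q = 1 / p - s / real DIM('a)" "q > 1" and u: "u \<in> tempered_distribution"
  obtains C f where "f \<in> borel_measurable borel" "integrable lborel (\<lambda>x. cmod (f x) powr q)"
    "(LINT x|lborel. cmod (f x) powr q) powr (1 / q) \<le> sobolev_const TYPE('a) s p * energy powr (1 / p)"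
    "\<And>\<phi>. \<phi> \<in> schwartz \<Longrightarrow> u \<phi> = C * (LINT x|lborel. \<phi> x) + (LINT x|lborel. f x * \<phi> x)"
proof -
  let ?K = "sobolev_const TYPE('a) s p"
  obtain C where C: "AE x in lborel. cmod (representative x - C)
    \<le> ?K * (local_energy x powr (1 / q) * energy powr (s / real DIM('a)))"
    by (rule representative_pointwise[OF q(1)])
  define f where "f x = representative x - C" for x
  have f [measurable]: "f \<in> borel_measurable borel" unfolding f_def by measurable
  let ?M = "?K powr q * energy powr (s / real DIM('a) * q)"
  have bound: "AE x in lborel. cmod (f x) powr q \<le> ?M * local_energy x"
    using C
  proof eventually_elim
    case (elim x)
    then have "cmod (f x) powr q \<le> (?K * (local_energy x powr (1 / q) * energy powr (s / real DIM('a)))) powr q"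
      using q(2) unfolding f_def by (intro powr_mono2) auto
    also have "\<dots> = ?M * local_energy x"
      using sobolev_const_pos[OF p sp] energy_nonneg local_energy_nonneg[of x] q(2) by (simp add: powr_mult powr_powr)
    finally show ?case .
  qed
  have fq: "integrable lborel (\<lambda>x. cmod (f x) powr q)"
    by (rule Bochner_Integration.integrable_bound[OF integrable_mult_right[OF local_energy_integrable, of ?M]])
      (use bound in \<open>auto elim!: eventually_mono intro: order_trans[OF _ abs_ge_self]\<close>)
  have "(LINT x|lborel. cmod (f x) powr q) \<le> (LINT x|lborel. ?M * local_energy x)"
    using fq local_energy_integrable bound by (intro integral_mono_AE) auto
  also have "\<dots> = ?M * energy" by (simp add: integral_local_energy)
  finally have "(LINT x|lborel. cmod (f x) powr q) powr (1 / q) \<le> (?M * energy) powr (1 / q)"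
    using q(2) by (intro powr_mono2) auto
  also have "\<dots> = ?K * (energy powr (s / real DIM('a)) * energy powr (1 / q))"
    using sobolev_const_pos[OF p sp] energy_nonneg q(2) by (simp add: powr_mult powr_powr)
  also have "energy powr (s / real DIM('a)) * energy powr (1 / q) = energy powr (1 / p)"
    unfolding powr_add[symmetric] by (simp add: q(1))
  finally have norm: "(LINT x|lborel. cmod (f x) powr q) powr (1 / q) \<le> ?K * energy powr (1 / p)" .
  have pair: "u \<phi> = C * (LINT x|lborel. \<phi> x) + (LINT x|lborel. f x * \<phi> x)" if \<phi>: "\<phi> \<in> schwartz" for \<phi>
  proof -
    have [measurable]: "\<phi> \<in> borel_measurable borel" by (rule schwartz_borel_measurable[OF \<phi>])
    obtain B where B: "B \<ge> 0" "\<And>x. cmod (\<phi> x) \<le> B" using schwartz_decay[OF \<phi>, of 0] by auto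
    define Z where "Z = 1 / bump 1 (- One) One (0::'a)"
    have Z: "\<bar>cutoff N x\<bar> \<le> Z" for N and x :: 'a
      using cutoff_nonneg[of N x] cutoff_le[of N x] by (simp add: Z_def)
    have "Z \<ge> 0" using Z[of 0 0] by linarith
    have [measurable]: "cutoff N \<in> borel_measurable (borel :: 'a measure)" for N
      unfolding cutoff_def by measurable
    let ?w = "\<lambda>x. Z * (cmod (\<phi> x) + B * cmod (f x) powr q)"
    have w: "integrable lborel ?w" using schwartz_integrable[OF \<phi>] fq by auto
    have f\<phi>: "cmod (f x * (\<phi> x * complex_of_real (cutoff N x))) \<le> ?w x" for N x
    proof -
      have f1: "cmod (f x) \<le> 1 + cmod (f x) powr q"
      proof (cases "cmod (f x) \<le> 1")
        case False
        then have "cmod (f x) powr 1 \<le> cmod (f x) powr q" using q(2) by (intro powr_mono) auto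
        then show ?thesis using False by simp
      qed (simp add: add_increasing2)
      have "cmod (f x) * cmod (\<phi> x) \<le> (1 + cmod (f x) powr q) * cmod (\<phi> x)"
        by (intro mult_right_mono f1) auto
      also have "\<dots> \<le> cmod (\<phi> x) + B * cmod (f x) powr q"
        using mult_left_mono[OF B(2), of "cmod (f x) powr q" x] by (simp add: algebra_simps)
      finally have "(cmod (f x) * cmod (\<phi> x)) * \<bar>cutoff N x\<bar> \<le> (cmod (\<phi> x) + B * cmod (f x) powr q) * Z"
        using Z B(1) by (intro mult_mono) auto
      then show ?thesis by (simp add: norm_mult mult_ac)
    qed
    have \<phi>w: "cmod (\<phi> x * complex_of_real (cutoff N x)) \<le> Z * cmod (\<phi> x)" for N x
      using mult_right_mono[OF Z, of "cmod (\<phi> x)" N x] by (simp add: norm_mult mult.commute)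
    have cut: "(\<lambda>N. complex_of_real (cutoff N x)) \<longlonglongrightarrow> 1" for x :: 'a
      using tendsto_of_real[OF cutoff_tendsto_1[of x], where ?'a=complex] by simp
    have lim1: "(\<lambda>N. LINT x|lborel. \<phi> x * complex_of_real (cutoff N x)) \<longlonglongrightarrow> (LINT x|lborel. \<phi> x)"
    proof (rule integral_dominated_convergence)
      show "integrable lborel (\<lambda>x. Z * cmod (\<phi> x))" using schwartz_integrable[OF \<phi>] by auto
      show "AE x in lborel. (\<lambda>N. \<phi> x * complex_of_real (cutoff N x)) \<longlonglongrightarrow> \<phi> x"
        using tendsto_mult[OF tendsto_const cut] by (intro AE_I2) simp
    qed (use \<phi>w in auto)
    have lim2: "(\<lambda>N. LINT x|lborel. f x * (\<phi> x * complex_of_real (cutoff N x))) \<longlonglongrightarrow> (LINT x|lborel. f x * \<phi> x)"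
    proof (rule integral_dominated_convergence[OF _ _ w])
      show "AE x in lborel. (\<lambda>N. f x * (\<phi> x * complex_of_real (cutoff N x))) \<longlonglongrightarrow> f x * \<phi> x"
        using tendsto_mult[OF tendsto_const tendsto_mult[OF tendsto_const cut]] by (intro AE_I2) simp
    qed (use f\<phi> in auto)
    have "u (\<lambda>x. \<phi> x * complex_of_real (cutoff N x))
      = C * (LINT x|lborel. \<phi> x * complex_of_real (cutoff N x))
        + (LINT x|lborel. f x * (\<phi> x * complex_of_real (cutoff N x)))" for N
    proof -
      have 1: "integrable lborel (\<lambda>x. \<phi> x * complex_of_real (cutoff N x))"
        by (rule schwartz_integrable[OF cutoff_mult_in_schwartz[OF \<phi>]])
      have 2: "integrable lborel (\<lambda>x. f x * (\<phi> x * complex_of_real (cutoff N x)))"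
        by (rule Bochner_Integration.integrable_bound[OF w])
          (use f\<phi> in \<open>auto intro: order_trans[OF _ abs_ge_self]\<close>)
      have "u (\<lambda>x. \<phi> x * complex_of_real (cutoff N x))
          = (LINT x|lborel. \<phi> x * complex_of_real (cutoff N x) * representative x)"
      proof (rule pairing_representative)
        show "smooth (\<lambda>x. \<phi> x * complex_of_real (cutoff N x))"
          by (intro schwartz_smooth cutoff_mult_in_schwartz \<phi>)
        show "\<phi> x * complex_of_real (cutoff N x) = 0"
          if "x \<notin> cbox (- real (Suc N) *\<^sub>R One) (real (Suc N) *\<^sub>R One)" for x
          by (simp only: cutoff_eq_0[OF that] of_real_0 mult_zero_right)
      qed (rule compact_cbox)
      also have "\<dots> = (LINT x|lborel. C * (\<phi> x * complex_of_real (cutoff N x))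
          + f x * (\<phi> x * complex_of_real (cutoff N x)))"
        by (simp add: f_def algebra_simps)
      finally show ?thesis using 1 2 by simp
    qed
    then have "(\<lambda>N. u (\<lambda>x. \<phi> x * complex_of_real (cutoff N x)))
        \<longlonglongrightarrow> C * (LINT x|lborel. \<phi> x) + (LINT x|lborel. f x * \<phi> x)"
      using tendsto_add[OF tendsto_mult[OF tendsto_const lim1] lim2] by simp
    from LIMSEQ_unique[OF tempered_distribution_cutoff_tendsto[OF u \<phi>] this] show ?thesis .
  qed
  show ?thesis by (rule that[OF f fq norm pair])
qed

end

lemma Lp_od_energy:
  fixes F F' :: "(real ^ 'n) \<times> (real ^ 'n) \<Rightarrow> complex"
  assumes F: "F \<in> Lp_od p" and [measurable]: "F' \<in> borel_measurable borel"
    and FF': "AE w in lborel. F w = F' w"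
  shows "integrable lborel (\<lambda>w. cmod (F' w) powr p / norm (fst w - snd w) ^ CARD('n))"
    and "Lp_od_norm p F
      = (LINT w|lborel. cmod (F' w) powr p / norm (fst w - snd w) ^ CARD('n)) powr (1 / p)"
proof -
  let ?d = "\<lambda>w :: (real ^ 'n) \<times> (real ^ 'n). 1 / norm (fst w - snd w) ^ CARD('n)"
  have od: "od_measure = density lebesgue (\<lambda>w. ennreal (?d w))"
    by (simp add: od_measure_def split_beta')
  have Fm: "F \<in> borel_measurable lebesgue" and Fi: "integrable od_measure (\<lambda>w. cmod (F w) powr p)"
    using F by (auto simp: Lp_od_def Lp_space_def od_measure_def)
  have F'l: "F' \<in> borel_measurable lebesgue" by (auto intro: measurable_completion)
  have d: "?d \<in> borel_measurable borel" by measurable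
  then have dl: "?d \<in> borel_measurable lebesgue" by (auto intro: measurable_completion)
  have Fp: "(\<lambda>w. cmod (F w) powr p) \<in> borel_measurable lebesgue" using Fm by measurable
  have F'p: "(\<lambda>w. cmod (F' w) powr p) \<in> borel_measurable lebesgue" using F'l by measurable
  have ae: "AE w in lebesgue. ?d w *\<^sub>R cmod (F w) powr p = ?d w *\<^sub>R cmod (F' w) powr p"
    using AE_completion[OF FF'] by eventually_elim simp
  have m: "(\<lambda>w. ?d w *\<^sub>R cmod (F w) powr p) \<in> borel_measurable lebesgue"
    "(\<lambda>w. ?d w *\<^sub>R cmod (F' w) powr p) \<in> borel_measurable lebesgue"
    by (intro borel_measurable_scaleR dl Fp F'p)+
  have m': "(\<lambda>w. ?d w *\<^sub>R cmod (F' w) powr p) \<in> borel_measurable lborel" by measurable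
  have "integrable lebesgue (\<lambda>w. ?d w *\<^sub>R cmod (F w) powr p)"
    using Fi unfolding od by (subst (asm) integrable_density) (use Fp dl in auto)
  then have "integrable lebesgue (\<lambda>w. ?d w *\<^sub>R cmod (F' w) powr p)"
    using integrable_cong_AE[OF m ae] by blast
  then have "integrable lborel (\<lambda>w. ?d w *\<^sub>R cmod (F' w) powr p)"
    using integrable_completion[OF m'] by blast
  then show "integrable lborel (\<lambda>w. cmod (F' w) powr p / norm (fst w - snd w) ^ CARD('n))" by simp
  have "(LINT w|od_measure. cmod (F w) powr p) = (LINT w|lebesgue. ?d w *\<^sub>R cmod (F w) powr p)"
    unfolding od by (rule integral_density) (use Fp dl in auto)
  also have "\<dots> = (LINT w|lebesgue. ?d w *\<^sub>R cmod (F' w) powr p)" by (rule integral_cong_AE[OF m ae])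
  also have "\<dots> = (LINT w|lborel. ?d w *\<^sub>R cmod (F' w) powr p)" by (rule integral_completion[OF m'])
  finally show "Lp_od_norm p F
      = (LINT w|lborel. cmod (F' w) powr p / norm (fst w - snd w) ^ CARD('n)) powr (1 / p)"
    by (simp add: Lp_od_norm_def Lp_norm_def)
qed

theorem theorem4p2:
  fixes p q s :: real
  assumes "p \<ge> 1" and "q > 1" and "0 < s" and "s < 1"
    and "s * p < real CARD('n::finite)"
    and "1 / q = 1 / p - s / real CARD('n)"
  shows "\<exists>K>0. \<forall>(u :: (real ^ 'n \<Rightarrow> complex) \<Rightarrow> complex) \<in> tempered_distribution.
           \<forall>F \<in> Lp_od p.
             (\<forall>G \<in> schwartz_od. frac_grad s u G = od_distribution_of F G) \<longrightarrow>
             (\<exists>C. \<exists>f \<in> Lp_space q lebesgue.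
                (\<forall>\<phi> \<in> schwartz. u \<phi> - distribution_of (\<lambda>_. C) \<phi> = distribution_of f \<phi>) \<and>
                Lp_norm q lebesgue f \<le> K * Lp_od_norm p F)"
proof -
  let ?K = "sobolev_const TYPE(real ^ 'n) s p"
  have "?K > 0" using assms by (intro sobolev_const_pos) auto
  moreover have "\<exists>C. \<exists>f \<in> Lp_space q lebesgue.
      (\<forall>\<phi> \<in> schwartz. u \<phi> - distribution_of (\<lambda>_. C) \<phi> = distribution_of f \<phi>) \<and>
      Lp_norm q lebesgue f \<le> ?K * Lp_od_norm p F"
    if u: "u \<in> tempered_distribution" and F: "F \<in> Lp_od p"
      and grad: "\<forall>G \<in> schwartz_od. frac_grad s u G = od_distribution_of F G"
    for u :: "(real ^ 'n \<Rightarrow> complex) \<Rightarrow> complex" and F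
  proof -
    have "F \<in> borel_measurable lebesgue" "antisymmetric F"
      using F by (simp_all add: Lp_od_def Lp_space_def od_measure_def)
    then obtain F' where F': "F' \<in> borel_measurable borel" "antisymmetric F'" "AE w in lborel. F w = F' w"
      by (rule antisymmetric_borel_representative)
    note energy = Lp_od_energy[OF F F'(1,3)]
    interpret gradient_pairing s p F' u
    proof
      show "integrable lborel (\<lambda>w. cmod (F' w) powr p / norm (fst w - snd w) ^ DIM(real ^ 'n))"
        using energy(1) by simp
      fix \<eta> \<theta> :: "real ^ 'n \<Rightarrow> complex" and K L
      assume A: "smooth \<eta>" "smooth \<theta>" "compact K" "compact L" "K \<inter> L = {}"
        "\<And>x. x \<notin> K \<Longrightarrow> \<eta> x = 0" "\<And>x. x \<notin> L \<Longrightarrow> \<theta> x = 0"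
      show "u \<eta> * (LINT z|lborel. \<theta> z) - u \<theta> * (LINT z|lborel. \<eta> z)
          = (LINT w|lborel. F' w * complex_of_real (norm (fst w - snd w) powr s) * (\<eta> (fst w) * \<theta> (snd w)))"
        by (rule frac_grad_pairing[OF u \<open>p \<ge> 1\<close> \<open>0 < s\<close> F bspec[OF grad] F' energy(1) A])
    qed (use assms F' in auto)
    have q: "1 / q = 1 / p - s / real DIM(real ^ 'n)" using assms by simp
    obtain C f where f: "f \<in> borel_measurable borel" "integrable lborel (\<lambda>x. cmod (f x) powr q)"
      "(LINT x|lborel. cmod (f x) powr q) powr (1 / q) \<le> ?K * energy powr (1 / p)"
      "\<And>\<phi>. \<phi> \<in> schwartz \<Longrightarrow> u \<phi> = C * (LINT x|lborel. \<phi> x) + (LINT x|lborel. f x * \<phi> x)"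
      by (rule representative_sobolev_bound[OF q \<open>q > 1\<close> u]) blast
    have fq: "(\<lambda>x. cmod (f x) powr q) \<in> borel_measurable lborel" using f(1) by measurable
    have "f \<in> Lp_space q lebesgue"
      using f(1,2) integrable_completion[OF fq] by (auto simp: Lp_space_def intro: measurable_completion)
    moreover have "u \<phi> - distribution_of (\<lambda>_. C) \<phi> = distribution_of f \<phi>" if \<phi>: "\<phi> \<in> schwartz" for \<phi>
    proof -
      have "\<phi> \<in> borel_measurable borel" by (rule schwartz_borel_measurable[OF \<phi>])
      then have "distribution_of (\<lambda>_. C) \<phi> = (LINT x|lborel. C * \<phi> x)"
        "distribution_of f \<phi> = (LINT x|lborel. f x * \<phi> x)"
        unfolding distribution_of_def using f(1) by (auto intro!: integral_completion)
      then show ?thesis using f(4)[OF \<phi>] by simp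
    qed
    moreover have "Lp_norm q lebesgue f \<le> ?K * Lp_od_norm p F"
      using f(3) energy(2) integral_completion[OF fq]
      by (simp add: Lp_norm_def energy_def energy_density_def)
    ultimately show ?thesis by blast
  qed
  ultimately show ?thesis by blast
qed

end
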